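(* Let $J\subseteq\mathbb{R}$ be a non-degenerate interval, $K\subseteq\mathbb{R}^n$ a compact convex set with non-empty interior, $P\subseteq F$ a convex subset with non-empty interior in a locally convex space $F$, and $$f\colon P\times J\times K\to\mathbb{R}^n$$ a smooth function such that $f(p,t,x)=0$ for all $p\in P$, $t\in J$ and $x\in\partial K$. Then the initial value problem $$y'(t)=f(p,t,y(t)),\quad y(t_0)=x_0$$ has a unique solution $y_{p,t_0,x_0}\colon J\to K$ defined on all of $J$, for all $p\in P$, $t_0\in J$, and $x_0\in K$. The associated flow $$P\times J\times J\times K\to K,\quad (p,t_0,t,x_0)\mapsto y_{p,t_0,x_0}(t)$$ is smooth.
   Context: All locally convex spaces are real and Hausdorff. $C^r$-maps (Bastiani/Keller $C^r_c$). Let $E,F$ be locally convex spaces, $r\in\mathbb{N}_0\cup\{\infty\}$. For $U\subseteq E$ open, $f\colon U\to F$ is $C^r$ if it is continuous, the iterated directional derivatives $d^{(k)}f(x,y_1,\dots,y_k)=(D_{y_k}\cdots D_{y_1}f)(x)$ exist for all $k\in\mathbb{N}$, $k\le r$, $x\in U$, $y_i\in E$, and all $d^{(k)}f\colon U\times E^k\to F$ are continuous. If $U\subseteq E$ is a subset with dense interior $U^0$ that is locally convex (every $x\in U$ has a convex neighbourhood in $U$; e.g. a convex set with non-empty interior), then $f\colon U\to F$ is $C^r$ if $f$ is continuous, $f|_{U^0}$ is $C^r$ and each $d^{(k)}(f|_{U^0})$ ($k\le r$) has a continuous extension to $U\times E^k\to F$. Smooth means $C^\infty$; a map into $K\subseteq\mathbb{R}^n$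 is smooth if it is smooth as a map into $\mathbb{R}^n$. Solutions of initial value problems are $C^1$-curves. *)

theory Defs
  imports "HOL-Analysis.Analysis" "HOL-Library.Extended_Nat"
begin

section \<open>Real Hausdorff locally convex spaces\<close>

text \<open>
  The second axiom says that zero has a basis of convex neighbourhoods. Convexity is written out,
  since \<^const>\<open>convex\<close> cannot be used for the type of a class under construction.
\<close>
class locally_convex_space = real_vector + topological_ab_group_add + t2_space +
  assumes tendsto_scaleR_Pair:
      "LIM x (nhds (r::real) \<times>\<^sub>F nhds a). fst x *\<^sub>R snd x :> nhds (r *\<^sub>R a)"
    and convex_nhd_zero_aux:
      "open U \<Longrightarrow> 0 \<in> U \<Longrightarrow> \<exists>V. open V \<and>
         (\<forall>x\<in>V. \<forall>y\<in>V. \<forall>u\<ge>0. \<forall>v\<ge>0. u + v = 1 \<longrightarrow> u *\<^sub>R x + v *\<^sub>R y \<in> V) \<and>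
         0 \<in> V \<and> V \<subseteq> U"

lemma convex_nhd_zero:
  fixes U :: "'a::locally_convex_space set"
  assumes "open U" "0 \<in> U"
  shows "\<exists>V. open V \<and> convex V \<and> 0 \<in> V \<and> V \<subseteq> U"
  using convex_nhd_zero_aux[OF assms] unfolding convex_def .

lemma tendsto_fst_nhds: "(fst \<longlongrightarrow> fst a) (nhds a)"
  by (rule tendsto_fst[OF filterlim_ident])

lemma tendsto_snd_nhds: "(snd \<longlongrightarrow> snd a) (nhds a)"
  by (rule tendsto_snd[OF filterlim_ident])

instance real_normed_vector < locally_convex_space
proof
  fix r :: real and a :: 'a
  show "LIM x (nhds r \<times>\<^sub>F nhds a). fst x *\<^sub>R snd x :> nhds (r *\<^sub>R a)"
    unfolding nhds_prod[symmetric]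
    using tendsto_scaleR[OF tendsto_fst_nhds[of "(r, a)"] tendsto_snd_nhds[of "(r, a)"]] by simp
next
  fix U :: "'a set"
  assume "open U" "0 \<in> U"
  then obtain e where "e > 0" "ball 0 e \<subseteq> U"
    using open_contains_ball by blast
  then have "open (ball (0::'a) e) \<and> convex (ball (0::'a) e) \<and> 0 \<in> ball (0::'a) e \<and> ball 0 e \<subseteq> U"
    by simp
  then show "\<exists>V. open V \<and>
      (\<forall>x\<in>V. \<forall>y\<in>V. \<forall>u\<ge>0. \<forall>v\<ge>0. u + v = 1 \<longrightarrow> u *\<^sub>R x + v *\<^sub>R y \<in> V) \<and> 0 \<in> V \<and> V \<subseteq> U"
    unfolding convex_def by (rule exI)
qed

instance prod :: (topological_monoid_add, topological_monoid_add) topological_monoid_add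
proof
  fix a b :: "'a \<times> 'b"
  note l1 = tendsto_fst[OF tendsto_fst_nhds[of "(a, b)"], simplified]
    and l2 = tendsto_snd[OF tendsto_fst_nhds[of "(a, b)"], simplified]
    and l3 = tendsto_fst[OF tendsto_snd_nhds[of "(a, b)"], simplified]
    and l4 = tendsto_snd[OF tendsto_snd_nhds[of "(a, b)"], simplified]
  show "LIM x (nhds a \<times>\<^sub>F nhds b). fst x + snd x :> nhds (a + b)"
    unfolding nhds_prod[symmetric] plus_prod_def
    by (intro tendsto_Pair tendsto_add l1 l2 l3 l4)
qed

instance prod :: (topological_group_add, topological_group_add) topological_group_add
proof
  fix a :: "'a \<times> 'b"
  show "(uminus \<longlongrightarrow> - a) (nhds a)"
    unfolding uminus_prod_def
    by (intro tendsto_Pair tendsto_minus tendsto_fst_nhds tendsto_snd_nhds)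
qed

instance prod :: (topological_ab_group_add, topological_ab_group_add) topological_ab_group_add ..

lemma tendsto_scaleR_lcs:
  fixes a :: "'a::locally_convex_space"
  assumes "(f \<longlongrightarrow> r) F" "(g \<longlongrightarrow> a) F"
  shows "((\<lambda>x. f x *\<^sub>R g x) \<longlongrightarrow> r *\<^sub>R a) F"
  using filterlim_compose[OF tendsto_scaleR_Pair, of "\<lambda>x. (f x, g x)" r a F] assms
  by (simp add: nhds_prod[symmetric] tendsto_Pair)

instance prod :: (locally_convex_space, locally_convex_space) locally_convex_space
proof
  fix r :: real and a :: "'a \<times> 'b"
  note l1 = tendsto_fst_nhds[of "(r, a)", simplified]
    and l2 = tendsto_fst[OF tendsto_snd_nhds[of "(r, a)"], simplified]
    and l3 = tendsto_snd[OF tendsto_snd_nhds[of "(r, a)"], simplified]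
  show "LIM x (nhds r \<times>\<^sub>F nhds a). fst x *\<^sub>R snd x :> nhds (r *\<^sub>R a)"
    unfolding nhds_prod[symmetric] scaleR_prod_def
    by (intro tendsto_Pair tendsto_scaleR_lcs l1 l2 l3)
next
  fix U :: "('a \<times> 'b) set"
  assume "open U" "0 \<in> U"
  then obtain A B where "open A" "open B" "0 \<in> A \<times> B" "A \<times> B \<subseteq> U"
    by (rule open_prod_elim)
  moreover from this obtain V where "open V" "convex V" "0 \<in> V" "V \<subseteq> A"
    using convex_nhd_zero[of A] by (auto simp: zero_prod_def)
  moreover from calculation obtain W where "open W" "convex W" "0 \<in> W" "W \<subseteq> B"
    using convex_nhd_zero[of B] by (auto simp: zero_prod_def)
  ultimately have
    "open (V \<times> W) \<and> convex (V \<times> W) \<and> 0 \<in> V \<times> W \<and> V \<times> W \<subseteq> U"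
    by (auto simp: open_Times convex_Times zero_prod_def)
  then show "\<exists>V. open V \<and>
      (\<forall>x\<in>V. \<forall>y\<in>V. \<forall>u\<ge>0. \<forall>v\<ge>0. u + v = 1 \<longrightarrow> u *\<^sub>R x + v *\<^sub>R y \<in> V) \<and> 0 \<in> V \<and> V \<subseteq> U"
    unfolding convex_def by (rule exI)
qed


section \<open>Maps of class $C^r$ in the sense of Bastiani and Keller\<close>

definition has_dir_derivative ::
    "('a::locally_convex_space \<Rightarrow> 'b::locally_convex_space) \<Rightarrow> 'b \<Rightarrow> 'a \<Rightarrow> 'a \<Rightarrow> bool" where
  "has_dir_derivative f v x y \<longleftrightarrow>
     ((\<lambda>t::real. inverse t *\<^sub>R (f (x + t *\<^sub>R y) - f x)) \<longlongrightarrow> v) (at 0)"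

definition dir_derivative ::
    "('a::locally_convex_space \<Rightarrow> 'b::locally_convex_space) \<Rightarrow> 'a \<Rightarrow> 'a \<Rightarrow> 'b" where
  "dir_derivative f x y = (THE v. has_dir_derivative f v x y)"

lemma dir_derivative_eq: "has_dir_derivative f v x y \<Longrightarrow> dir_derivative f x y = v"
  unfolding dir_derivative_def has_dir_derivative_def
  by (rule the_equality) (auto intro: tendsto_unique[OF trivial_limit_at])

text \<open>
  The value \<^term>\<open>iter_dir_derivative f k x y\<close> is $d^{(k)}f(x,y_1,\dots,y_k)$, with the directions
  numbered from zero: \<^term>\<open>y (i::nat)\<close> stands for $y_{i+1}$, and only the values of \<^term>\<open>y\<close>
  below \<^term>\<open>k\<close> matter.
\<close>
primrec iter_dir_derivative ::
    "('a::locally_convex_space \<Rightarrow> 'b::locally_convex_space) \<Rightarrow> nat \<Rightarrow> 'a \<Rightarrow> (nat \<Rightarrow> 'a) \<Rightarrow> 'b" where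
  "iter_dir_derivative f 0 x y = f x"
| "iter_dir_derivative f (Suc k) x y =
     dir_derivative (\<lambda>z. iter_dir_derivative f k z y) x (y k)"

text \<open>
  $E^k$, as the set of functions on $\{0,\dots,k-1\}$; the subspace topology it gets from
  \<^typ>\<open>nat \<Rightarrow> 'a\<close> is the product topology.
\<close>
abbreviation directions :: "nat \<Rightarrow> (nat \<Rightarrow> 'a) set" where
  "directions k \<equiv> {..<k} \<rightarrow>\<^sub>E UNIV"

text \<open>
  Intended for open \<^term>\<open>U\<close>. As \<^term>\<open>U\<close> is open, only the values of \<^term>\<open>f\<close> on \<^term>\<open>U\<close> matter.
\<close>
definition Cr_on_open ::
    "enat \<Rightarrow> 'a set \<Rightarrow> ('a::locally_convex_space \<Rightarrow> 'b::locally_convex_space) \<Rightarrow> bool" where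
  "Cr_on_open r U f \<longleftrightarrow>
     continuous_on U f \<and>
     (\<forall>k. enat (Suc k) \<le> r \<longrightarrow>
        (\<forall>x\<in>U. \<forall>y. \<exists>v. has_dir_derivative (\<lambda>z. iter_dir_derivative f k z y) v x (y k))) \<and>
     (\<forall>k. enat k \<le> r \<longrightarrow>
        continuous_on (U \<times> directions k) (\<lambda>(x, y). iter_dir_derivative f k x y))"

text \<open>
  Intended for sets \<^term>\<open>U\<close> that have dense interior and are locally convex, for example convex
  sets with non-empty interior.
\<close>
definition Cr_on ::
    "enat \<Rightarrow> 'a set \<Rightarrow> ('a::locally_convex_space \<Rightarrow> 'b::locally_convex_space) \<Rightarrow> bool" where
  "Cr_on r U f \<longleftrightarrow>
     continuous_on U f \<and>
     Cr_on_open r (interior U) f \<and>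
     (\<forall>k. enat k \<le> r \<longrightarrow>
        (\<exists>g. continuous_on (U \<times> directions k) g \<and>
             (\<forall>x\<in>interior U. \<forall>y\<in>directions k. g (x, y) = iter_dir_derivative f k x y)))"

abbreviation smooth_on ::
    "'a set \<Rightarrow> ('a::locally_convex_space \<Rightarrow> 'b::locally_convex_space) \<Rightarrow> bool" where
  "smooth_on \<equiv> Cr_on \<infinity>"

lemma Cr_on_iff_Cr_on_open: "open U \<Longrightarrow> Cr_on r U f \<longleftrightarrow> Cr_on_open r U f"
  unfolding Cr_on_def Cr_on_open_def by (auto simp: interior_open)


section \<open>Initial value problems\<close>

text \<open>
  Curves defined on \<^term>\<open>J\<close> are represented by functions that are \<^const>\<open>undefined\<close> outside
  \<^term>\<open>J\<close>, so that solutions on \<^term>\<open>J\<close> can be unique. At an endpoint of \<^term>\<open>J\<close> contained in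
  \<^term>\<open>J\<close>, the derivative is one-sided.
\<close>
definition ivp_solution ::
    "(real \<Rightarrow> 'b::real_normed_vector \<Rightarrow> 'b) \<Rightarrow> real set \<Rightarrow> 'b set \<Rightarrow> real \<Rightarrow> 'b \<Rightarrow> (real \<Rightarrow> 'b) \<Rightarrow> bool"
  where
  "ivp_solution f J K t\<^sub>0 x\<^sub>0 y \<longleftrightarrow>
     y \<in> J \<rightarrow>\<^sub>E K \<and>
     Cr_on 1 J y \<and>
     (\<forall>t\<in>J. (y has_vector_derivative f t (y t)) (at t within J)) \<and>
     y t\<^sub>0 = x\<^sub>0"

definition flow ::
    "('p \<times> real \<times> 'b \<Rightarrow> 'b::real_normed_vector) \<Rightarrow> real set \<Rightarrow> 'b set \<Rightarrow>
     'p \<times> real \<times> real \<times> 'b \<Rightarrow> 'b" where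
  "flow f J K = (\<lambda>(p, t\<^sub>0, t, x\<^sub>0). (THE y. ivp_solution (\<lambda>s x. f (p, s, x)) J K t\<^sub>0 x\<^sub>0 y) t)"

end

theory Submission
  imports Defs
begin

text \<open>
  Composing with the closest point projection onto \<open>K\<close> extends the field to all of \<open>\<real>\<^sup>n\<close>, with
  value zero off \<open>K\<close> and with the same Lipschitz constants, so solutions exist on all of \<open>J\<close> and do
  not leave \<open>K\<close>. After an affine change of time the flow is the value at time \<open>1\<close> of the solution
  \<open>u\<close> of an integral equation over \<open>[0, 1]\<close> whose parameter \<open>x = (p, t\<^sub>0, t, x\<^sub>0)\<close> ranges over a convex
  set with non-empty interior. By Hadamard's lemma the difference quotients
  \<open>(u (x + e d) - u x) / e\<close> solve a linear integral equation whose coefficients extend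
  continuously to \<open>e = 0\<close>, so they converge by continuous dependence on \<open>e\<close>. The limit solves a linear
  equation whose coefficients are built from \<open>u\<close> and the jets of the field; if \<open>u\<close> is of class \<open>C\<^sup>k\<close>,
  so is this limit, and hence \<open>u\<close> is of class \<open>C\<^sup>k\<^sup>+\<^sup>1\<close>. Linear equations are treated in the same way.
\<close>

section \<open>Directional derivatives\<close>

text \<open>The parameters range over a locally convex space, which need not be normed, so there is
  no norm for derivatives in \<open>p\<close> and no implicit function theorem to call upon. All
  estimates are carried out in the \<real>^n variable, with constants that are uniform on a
  neighbourhood of a given parameter because \<open>[0,1]\<close> and \<open>K\<close> are compact.
  Hadamard's lemma fits this: it needs only continuity in the parameter, and no remainder has to be
  estimated.

  The other obstacle is the boundary. The derivatives of the field exist in the interior and extend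
  by continuity, while solutions are only known to stay in \<open>K\<close>. So the field enters
  through identities that survive passage to the closure, namely multilinearity and the fundamental
  theorem of calculus along segments, and never through its own difference quotients. The projection
  is in general not differentiable; it is removed from the equation, by invariance of
  \<open>K\<close>, before anything is differentiated.\<close>

lemma continuous_on_scaleR_lcs [continuous_intros]:
  fixes g :: "'a::topological_space \<Rightarrow> 'b::locally_convex_space"
  assumes "continuous_on S f" "continuous_on S g"
  shows "continuous_on S (\<lambda>x. f x *\<^sub>R g x)"
  using assms unfolding continuous_on_def by (blast intro: tendsto_scaleR_lcs)

lemma tendsto_line_lcs:
  fixes x y :: "'a::locally_convex_space"
  shows "((\<lambda>t::real. x + t *\<^sub>R y) \<longlongrightarrow> x) (nhds 0)"
proof -
  have "((\<lambda>t::real. x + t *\<^sub>R y) \<longlongrightarrow> x + 0 *\<^sub>R y) (nhds 0)"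
    by (intro tendsto_add tendsto_const tendsto_scaleR_lcs filterlim_ident)
  then show ?thesis by simp
qed

lemma eventually_line_lcs:
  fixes x y :: "'a::locally_convex_space"
  assumes "open S" "x \<in> S"
  shows "\<forall>\<^sub>F t in nhds (0::real). x + t *\<^sub>R y \<in> S"
  using topological_tendstoD[OF tendsto_line_lcs assms] .

lemma line_in_open_lcs:
  fixes x y :: "'a::locally_convex_space"
  assumes "open S" "x \<in> S"
  obtains r :: real where "r > 0" "\<forall>t. \<bar>t\<bar> < r \<longrightarrow> x + t *\<^sub>R y \<in> S"
  using eventually_line_lcs[OF assms, of y] unfolding eventually_nhds_metric by auto

section \<open>Reaching the boundary of a convex set from its interior\<close>

text \<open>The homothety with centre \<open>x\<close> and ratio \<open>t\<close> maps the convex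
  set \<open>V\<close> into itself. Its inverse \<open>h\<close> is continuous, so the preimage of
  \<open>interior V\<close> under \<open>h\<close> is an open subset of \<open>V\<close>, and it
  contains the point in question.\<close>

lemma convex_shrink_interior:
  fixes V :: "'a::locally_convex_space set"
  assumes "convex V" "x \<in> V" "c \<in> interior V" "0 < t" "t \<le> 1"
  shows "x + t *\<^sub>R (c - x) \<in> interior V"
proof -
  define h where "h = (\<lambda>w. x + inverse t *\<^sub>R (w - x))"
  have "continuous_on UNIV h"
    unfolding h_def by (intro continuous_intros)
  then have "open (h -` interior V)"
    by (simp add: continuous_on_open_vimage)
  moreover have "h -` interior V \<subseteq> V"
  proof
    fix w assume "w \<in> h -` interior V"
    then have "h w \<in> V" using interior_subset by auto
    then have "(1 - t) *\<^sub>R x + t *\<^sub>R h w \<in> V"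
      using assms by (intro convexD) auto
    moreover have "(1 - t) *\<^sub>R x + t *\<^sub>R h w = w"
      using assms by (simp add: h_def algebra_simps)
    ultimately show "w \<in> V" by simp
  qed
  moreover have "x + t *\<^sub>R (c - x) \<in> h -` interior V"
    using assms by (simp add: h_def)
  ultimately show ?thesis by (meson interiorI)
qed

text \<open>Every \<open>x\<close> in \<open>V\<close> is approached along the segment towards an
  interior point \<open>c\<close>, and limits along this path are unique. By this device identities
  between derivatives pass to the boundary.\<close>

lemma eq_on_convex_from_interior:
  fixes V :: "'a::locally_convex_space set" and g h :: "'a \<Rightarrow> 'b::t2_space"
  assumes "convex V" "interior V \<noteq> {}" and g: "continuous_on V g" and h: "continuous_on V h"
    and eq: "\<And>x. x \<in> interior V \<Longrightarrow> g x = h x" and x: "x \<in> V"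
  shows "g x = h x"
proof -
  obtain c where c: "c \<in> interior V" using assms by blast
  have *: "\<forall>\<^sub>F t in at_right (0::real). x + t *\<^sub>R (c - x) \<in> interior V"
    using convex_shrink_interior[OF assms(1) x c]
    by (intro eventually_at_rightI[of 0 1]) auto
  have l: "((\<lambda>t. x + t *\<^sub>R (c - x)) \<longlongrightarrow> x) (at_right (0::real))"
    using tendsto_line_lcs tendsto_mono at_within_le_nhds by blast
  have t: "((\<lambda>t. k (x + t *\<^sub>R (c - x))) \<longlongrightarrow> k x) (at_right (0::real))"
    if "continuous_on V k" for k :: "'a \<Rightarrow> 'b"
    using that l x by (rule continuous_on_tendsto_compose)
      (use * interior_subset[of V] in \<open>auto elim!: eventually_mono\<close>)
  have "((\<lambda>t. h (x + t *\<^sub>R (c - x))) \<longlongrightarrow> g x) (at_right (0::real))"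
    by (rule Lim_transform_eventually[OF t[OF g]]) (use * eq in \<open>auto elim: eventually_mono\<close>)
  then show ?thesis
    using t[OF h] tendsto_unique trivial_limit_at_right_real by blast
qed

section \<open>Calculus rules for directional derivatives\<close>

text \<open>Directional differentiability does not imply continuity; what it yields is a limit along
  the line \<open>x + t y\<close>. The product and chain rules below make do with this.\<close>

lemma has_dir_derivative_imp_tendsto:
  assumes "has_dir_derivative f v x y"
  shows "((\<lambda>t. f (x + t *\<^sub>R y)) \<longlongrightarrow> f x) (at 0)"
proof -
  have "((\<lambda>t. f x + t *\<^sub>R (inverse t *\<^sub>R (f (x + t *\<^sub>R y) - f x))) \<longlongrightarrow> f x + 0 *\<^sub>R v) (at 0)"
    using assms unfolding has_dir_derivative_def
    by (intro tendsto_add tendsto_const tendsto_scaleR_lcs) auto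
  then have "((\<lambda>t. f x + t *\<^sub>R (inverse t *\<^sub>R (f (x + t *\<^sub>R y) - f x))) \<longlongrightarrow> f x) (at 0)"
    by simp
  then show ?thesis
    by (rule Lim_transform_eventually) (auto simp: eventually_at_filter)
qed

lemma has_dir_derivative_transform:
  assumes "open S" "x \<in> S" "\<And>z. z \<in> S \<Longrightarrow> f z = g z" "has_dir_derivative f v x y"
  shows "has_dir_derivative g v x y"
  using assms(4) unfolding has_dir_derivative_def
proof (rule Lim_transform_eventually)
  have "\<forall>\<^sub>F t in at (0::real). x + t *\<^sub>R y \<in> S"
    using eventually_line_lcs[OF assms(1,2), of y]
    by (auto simp: eventually_at_filter elim!: eventually_mono)
  then show "\<forall>\<^sub>F t in at 0. inverse t *\<^sub>R (f (x + t *\<^sub>R y) - f x) = inverse t *\<^sub>R (g (x + t *\<^sub>R y) - g x)"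
    by eventually_elim (use assms in simp)
qed

lemma has_dir_derivative_const: "has_dir_derivative (\<lambda>_. c) 0 x y"
  unfolding has_dir_derivative_def by simp

lemma has_dir_derivative_zero: "has_dir_derivative f 0 x 0"
  unfolding has_dir_derivative_def by simp

lemma has_dir_derivative_linear_self:
  assumes "linear L"
  shows "has_dir_derivative L (L y) x y"
  unfolding has_dir_derivative_def
proof (rule Lim_transform_eventually[OF tendsto_const])
  show "\<forall>\<^sub>F t in at 0. L y = inverse t *\<^sub>R (L (x + t *\<^sub>R y) - L x)"
    using assms by (auto simp: eventually_at_filter linear_add linear_scale)
qed

lemma has_dir_derivative_add:
  assumes "has_dir_derivative f v x y" "has_dir_derivative g w x y"
  shows "has_dir_derivative (\<lambda>x. f x + g x) (v + w) x y"
  using tendsto_add[OF assms[unfolded has_dir_derivative_def]]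
  unfolding has_dir_derivative_def by (simp add: algebra_simps)

lemma has_dir_derivative_Pair:
  assumes "has_dir_derivative f v x y" "has_dir_derivative g w x y"
  shows "has_dir_derivative (\<lambda>x. (f x, g x)) (v, w) x y"
  using tendsto_Pair[OF assms[unfolded has_dir_derivative_def]]
  unfolding has_dir_derivative_def by simp

lemma has_dir_derivative_linear:
  assumes "linear L" "continuous_on UNIV L" "has_dir_derivative f v x y"
  shows "has_dir_derivative (\<lambda>x. L (f x)) (L v) x y"
proof -
  have "((\<lambda>t. L (inverse t *\<^sub>R (f (x + t *\<^sub>R y) - f x))) \<longlongrightarrow> L v) (at 0)"
    by (rule continuous_on_tendsto_compose[OF assms(2) assms(3)[unfolded has_dir_derivative_def]]) auto
  then show ?thesis
    unfolding has_dir_derivative_def using assms(1) by (simp add: linear_scale linear_diff)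
qed

lemma has_dir_derivative_scaleR:
  fixes f :: "'a::locally_convex_space \<Rightarrow> real"
  assumes f: "has_dir_derivative f a x y" and g: "has_dir_derivative g w x y"
  shows "has_dir_derivative (\<lambda>x. f x *\<^sub>R g x) (a *\<^sub>R g x + f x *\<^sub>R w) x y"
proof -
  have "((\<lambda>t. (inverse t *\<^sub>R (f (x + t *\<^sub>R y) - f x)) *\<^sub>R g (x + t *\<^sub>R y)
      + f x *\<^sub>R (inverse t *\<^sub>R (g (x + t *\<^sub>R y) - g x))) \<longlongrightarrow> a *\<^sub>R g x + f x *\<^sub>R w) (at 0)"
    using assms has_dir_derivative_imp_tendsto[OF g] unfolding has_dir_derivative_def
    by (intro tendsto_add tendsto_scaleR_lcs tendsto_const)
  then show ?thesis
    unfolding has_dir_derivative_def by (simp add: algebra_simps)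
qed

lemma has_dir_derivative_scale_dir:
  assumes "has_dir_derivative f v x y"
  shows "has_dir_derivative f (a *\<^sub>R v) x (a *\<^sub>R y)"
proof (cases "a = 0")
  case True
  then show ?thesis by (simp add: has_dir_derivative_zero)
next
  case False
  \<comment> \<open>The substitution \<open>t * a\<close> must avoid 0, which is why
    \<open>a = 0\<close> was split off.\<close>
  have "filterlim (\<lambda>t. t * a) (at 0) (at 0)"
    using False by (auto simp: filterlim_at eventually_at_filter intro!: tendsto_eq_intros)
  from filterlim_compose[OF assms[unfolded has_dir_derivative_def] this]
  have "((\<lambda>t. a *\<^sub>R (inverse (t * a) *\<^sub>R (f (x + (t * a) *\<^sub>R y) - f x))) \<longlongrightarrow> a *\<^sub>R v) (at 0)"
    by (intro tendsto_scaleR_lcs tendsto_const)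
  moreover have "a * (inverse t * inverse a) = inverse t" for t
    using False by (simp add: field_simps)
  ultimately show ?thesis
    unfolding has_dir_derivative_def by simp
qed

text \<open>Restriction to a line turns a directional derivative into a vector derivative in one
  real variable, to which the fundamental theorem of calculus applies.\<close>

lemma has_dir_derivative_imp_line_derivative:
  fixes f :: "'a::locally_convex_space \<Rightarrow> 'b::real_normed_vector"
  assumes "has_dir_derivative f v (a + t *\<^sub>R y) y"
  shows "((\<lambda>t. f (a + t *\<^sub>R y)) has_vector_derivative v) (at t within S)"
proof -
  have "((\<lambda>h. (f (a + (t + h) *\<^sub>R y) - f (a + t *\<^sub>R y)) /\<^sub>R h) \<longlongrightarrow> v) (at 0)"
    using assms unfolding has_dir_derivative_def by (simp add: algebra_simps)
  then have "((\<lambda>h. norm ((f (a + (t + h) *\<^sub>R y) - f (a + t *\<^sub>R y)) /\<^sub>R h - v)) \<longlongrightarrow> 0) (at 0)"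
    by (rule tendsto_norm_zero[OF LIM_zero])
  then have "((\<lambda>h. norm (f (a + (t + h) *\<^sub>R y) - f (a + t *\<^sub>R y) - h *\<^sub>R v) / norm h) \<longlongrightarrow> 0) (at 0)"
  proof (rule Lim_transform_eventually)
    have "norm (w /\<^sub>R h - v) = norm (w - h *\<^sub>R v) / norm h" if "h \<noteq> 0" for h and w :: 'b
    proof -
      have "w /\<^sub>R h - v = (w - h *\<^sub>R v) /\<^sub>R h" using that by (simp add: algebra_simps)
      then show ?thesis by (simp add: divide_inverse)
    qed
    then show "\<forall>\<^sub>F h in at 0. norm ((f (a + (t + h) *\<^sub>R y) - f (a + t *\<^sub>R y)) /\<^sub>R h - v) =
        norm (f (a + (t + h) *\<^sub>R y) - f (a + t *\<^sub>R y) - h *\<^sub>R v) / norm h"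
      by (auto simp: eventually_at_filter)
  qed
  then have "((\<lambda>t. f (a + t *\<^sub>R y)) has_vector_derivative v) (at t)"
    unfolding has_vector_derivative_def has_derivative_at
    by (simp add: bounded_linear_scaleR_left)
  then show ?thesis by (rule has_vector_derivative_at_within)
qed


section \<open>Volterra integral equations with a parameter\<close>

lemma has_integral_exp_scaled:
  fixes k t :: real
  assumes "k \<noteq> 0" "0 \<le> t"
  shows "((\<lambda>s. exp (k * s)) has_integral (exp (k * t) - 1) / k) {0..t}"
proof -
  have "((\<lambda>s. exp (k * s)) has_integral (exp (k * t) / k - exp (k * 0) / k)) {0..t}"
    by (rule fundamental_theorem_of_calculus[OF assms(2)])
      (use assms in \<open>auto intro!: derivative_eq_intros simp flip: has_real_derivative_iff_has_vector_derivative\<close>)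
  then show ?thesis by (simp add: diff_divide_distrib)
qed

text \<open>Let \<open>M\<close> be the maximum of \<open>exp (- (2 * L * t)) * d t\<close>.
  Evaluating the inequality at a maximum point bounds the integral term by \<open>M / 2\<close>,
  whence \<open>M \<le> e + M / 2\<close>. The rate \<open>2 * L\<close> in place of
  \<open>L\<close> produces the factor 1/2. As \<open>d\<close> may be negative,
  \<open>M \<le> 0\<close> is a case of its own.\<close>

lemma gronwall_unit_interval:
  fixes d :: "real \<Rightarrow> real"
  assumes d: "continuous_on {0..1} d" and "0 \<le> e" "0 < L"
    and le: "\<And>t. t \<in> {0..1} \<Longrightarrow> d t \<le> e + L * integral {0..t} d"
    and t: "t \<in> {0..1}"
  shows "d t \<le> 2 * e * exp (2 * L)"
proof -
  have "continuous_on {0..1} (\<lambda>s. exp (- (2 * L * s)) * d s)"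
    by (intro continuous_intros d)
  then obtain s where s: "s \<in> {0..1}"
    and max: "\<And>r. r \<in> {0..1} \<Longrightarrow> exp (- (2 * L * r)) * d r \<le> exp (- (2 * L * s)) * d s"
    using continuous_attains_sup[of "{0..1::real}" "\<lambda>s. exp (- (2 * L * s)) * d s"] by auto
  define M where "M = exp (- (2 * L * s)) * d s"
  have bound: "d r \<le> M * exp (2 * L * r)" if "r \<in> {0..1}" for r
    using max[OF that] by (simp add: M_def exp_minus field_simps)
  have "M \<le> 2 * e"
  proof (cases "M \<le> 0")
    case True
    then show ?thesis using assms by simp
  next
    case False
    have "integral {0..s} d \<le> M * ((exp (2 * L * s) - 1) / (2 * L))"
    proof (rule has_integral_le)
      show "(d has_integral integral {0..s} d) {0..s}"
        using s by (intro integrable_integral integrable_continuous_interval continuous_on_subset[OF d]) auto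
      show "((\<lambda>r. M * exp (2 * L * r)) has_integral M * ((exp (2 * L * s) - 1) / (2 * L))) {0..s}"
        using s \<open>0 < L\<close> by (intro has_integral_mult_right has_integral_exp_scaled) auto
    qed (use s bound in auto)
    then have "L * integral {0..s} d \<le> L * (M * ((exp (2 * L * s) - 1) / (2 * L)))"
      using \<open>0 < L\<close> by (intro mult_left_mono) auto
    also have "\<dots> = M / 2 * (exp (2 * L * s) - 1)"
      using \<open>0 < L\<close> by (simp add: field_simps)
    finally have "d s \<le> e + M / 2 * (exp (2 * L * s) - 1)"
      using le[OF s] by simp
    then have "exp (- (2 * L * s)) * d s \<le> exp (- (2 * L * s)) * (e + M / 2 * (exp (2 * L * s) - 1))"
      by (intro mult_left_mono) auto
    also have "\<dots> = e * exp (- (2 * L * s)) + M / 2 * (1 - exp (- (2 * L * s)))"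
      by (simp add: algebra_simps flip: exp_add)
    also have "\<dots> \<le> e * 1 + M / 2 * 1"
      using False \<open>0 \<le> e\<close> \<open>0 < L\<close> s by (intro add_mono mult_left_mono) auto
    finally show ?thesis by (simp flip: M_def)
  qed
  have "d t \<le> M * exp (2 * L * t)" by (rule bound[OF t])
  also have "\<dots> \<le> 2 * e * exp (2 * L * t)"
    using \<open>M \<le> 2 * e\<close> by (intro mult_right_mono) auto
  also have "\<dots> \<le> 2 * e * exp (2 * L)"
    using t assms by (intro mult_left_mono) auto
  finally show ?thesis .
qed

text \<open>With a separate \<open>h\<close>, goals that agree with the composition only pointwise,
  such as functions of tuples, can be matched; the pointwise equation is left as a goal.\<close>

lemma continuous_on_compose_eq:
  assumes "continuous_on T g" "continuous_on S f" "\<And>x. x \<in> S \<Longrightarrow> f x \<in> T" "\<And>x. x \<in> S \<Longrightarrow> h x = g (f x)"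
  shows "continuous_on S h"
proof -
  have "continuous_on S (\<lambda>x. g (f x))"
    using assms(3) by (intro continuous_on_compose2[OF assms(1,2)]) auto
  moreover have "continuous_on S h \<longleftrightarrow> continuous_on S (\<lambda>x. g (f x))"
    by (rule continuous_on_cong[OF refl]) (rule assms(4))
  ultimately show ?thesis by blast
qed

lemma continuous_on_graph:
  assumes "continuous_on (S \<times> UNIV) (\<lambda>(s, z). g s z)" "continuous_on S u"
  shows "continuous_on S (\<lambda>s. g s (u s))"
proof -
  have "continuous_on S (\<lambda>s. (s, u s))" by (intro continuous_intros assms(2))
  from continuous_on_compose2[OF assms(1) this] show ?thesis by auto
qed

text \<open>Inserting \<open>g\<^sub>1 s (u\<^sub>2 s)\<close> splits the integrand into a Lipschitz
  part and a perturbation measured only along the curve \<open>u\<^sub>2\<close>. The errors of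
  \<open>c\<close> and of \<open>g\<close> contribute \<open>e\<close> each, and Gronwall doubles
  their sum, hence the factor 4.\<close>

lemma volterra_compare:
  fixes u\<^sub>1 u\<^sub>2 :: "real \<Rightarrow> 'b::euclidean_space"
  assumes u1: "continuous_on {0..1} u\<^sub>1" and u2: "continuous_on {0..1} u\<^sub>2"
    and g1: "continuous_on ({0..1} \<times> UNIV) (\<lambda>(s, z). g\<^sub>1 s z)"
    and g2: "continuous_on ({0..1} \<times> UNIV) (\<lambda>(s, z). g\<^sub>2 s z)"
    and eq1: "\<And>t. t \<in> {0..1} \<Longrightarrow> u\<^sub>1 t = c\<^sub>1 t + integral {0..t} (\<lambda>s. g\<^sub>1 s (u\<^sub>1 s))"
    and eq2: "\<And>t. t \<in> {0..1} \<Longrightarrow> u\<^sub>2 t = c\<^sub>2 t + integral {0..t} (\<lambda>s. g\<^sub>2 s (u\<^sub>2 s))"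
    and lip: "\<And>s z z'. s \<in> {0..1} \<Longrightarrow> norm (g\<^sub>1 s z - g\<^sub>1 s z') \<le> L * norm (z - z')" and "0 < L"
    and c: "\<And>t. t \<in> {0..1} \<Longrightarrow> norm (c\<^sub>1 t - c\<^sub>2 t) \<le> e"
    and g: "\<And>s. s \<in> {0..1} \<Longrightarrow> norm (g\<^sub>1 s (u\<^sub>2 s) - g\<^sub>2 s (u\<^sub>2 s)) \<le> e"
    and t: "t \<in> {0..1}"
  shows "norm (u\<^sub>1 t - u\<^sub>2 t) \<le> 4 * e * exp (2 * L)"
proof -
  define d where "d t = norm (u\<^sub>1 t - u\<^sub>2 t)" for t
  have d: "continuous_on {0..1} d"
    unfolding d_def by (intro continuous_intros u1 u2)
  have "0 \<le> e" using c[OF t] norm_ge_zero order_trans by blast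
  have "d t \<le> 2 * (2 * e) * exp (2 * L)"
  proof (rule gronwall_unit_interval[OF d _ \<open>0 < L\<close> _ t])
    fix t :: real assume t: "t \<in> {0..1}"
    have int: "h integrable_on {0..t}" if "continuous_on {0..1} h" for h :: "real \<Rightarrow> 'c::euclidean_space"
      using t by (intro integrable_continuous_interval continuous_on_subset[OF that]) auto
    note i = int[OF continuous_on_graph[OF g1 u1]] int[OF continuous_on_graph[OF g2 u2]] int[OF d]
    have "norm (integral {0..t} (\<lambda>s. g\<^sub>1 s (u\<^sub>1 s) - g\<^sub>2 s (u\<^sub>2 s)))
      \<le> integral {0..t} (\<lambda>s. L * d s + e)"
    proof (rule integral_norm_bound_integral)
      show "(\<lambda>s. g\<^sub>1 s (u\<^sub>1 s) - g\<^sub>2 s (u\<^sub>2 s)) integrable_on {0..t}"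
        using i by (intro integrable_diff)
      show "(\<lambda>s. L * d s + e) integrable_on {0..t}"
        using i by (intro integrable_add integrable_on_mult_right) auto
      fix s assume "s \<in> {0..t}"
      then have s: "s \<in> {0..1}" using t by auto
      have "norm (g\<^sub>1 s (u\<^sub>1 s) - g\<^sub>2 s (u\<^sub>2 s))
        \<le> norm (g\<^sub>1 s (u\<^sub>1 s) - g\<^sub>1 s (u\<^sub>2 s)) + norm (g\<^sub>1 s (u\<^sub>2 s) - g\<^sub>2 s (u\<^sub>2 s))"
        by (rule order_trans[OF _ norm_triangle_ineq]) simp
      also have "\<dots> \<le> L * d s + e"
        unfolding d_def by (intro add_mono lip g s)
      finally show "norm (g\<^sub>1 s (u\<^sub>1 s) - g\<^sub>2 s (u\<^sub>2 s)) \<le> L * d s + e" .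
    qed
    also have "integral {0..t} (\<lambda>s. L * d s + e) = L * integral {0..t} d + t * e"
      using i t by (subst integral_add) (auto intro: integrable_on_mult_right)
    also have "\<dots> \<le> L * integral {0..t} d + e"
      using t \<open>0 \<le> e\<close> by (simp add: mult_left_le_one_le)
    finally have "norm (integral {0..t} (\<lambda>s. g\<^sub>1 s (u\<^sub>1 s) - g\<^sub>2 s (u\<^sub>2 s))) \<le> L * integral {0..t} d + e" .
    moreover have "u\<^sub>1 t - u\<^sub>2 t = (c\<^sub>1 t - c\<^sub>2 t) + integral {0..t} (\<lambda>s. g\<^sub>1 s (u\<^sub>1 s) - g\<^sub>2 s (u\<^sub>2 s))"
      using eq1[OF t] eq2[OF t] i by (simp add: integral_diff)
    then have "d t \<le> norm (c\<^sub>1 t - c\<^sub>2 t) + norm (integral {0..t} (\<lambda>s. g\<^sub>1 s (u\<^sub>1 s) - g\<^sub>2 s (u\<^sub>2 s)))"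
      unfolding d_def by (simp only: norm_triangle_ineq)
    ultimately show "d t \<le> 2 * e + L * integral {0..t} d"
      using c[OF t] by simp
  qed (use \<open>0 \<le> e\<close> in auto)
  then show ?thesis by (simp add: d_def)
qed

lemma volterra_unique:
  fixes u\<^sub>1 u\<^sub>2 :: "real \<Rightarrow> 'b::euclidean_space"
  assumes "continuous_on {0..1} u\<^sub>1" "continuous_on {0..1} u\<^sub>2"
    and "continuous_on ({0..1} \<times> UNIV) (\<lambda>(s, z). g s z)"
    and "\<And>t. t \<in> {0..1} \<Longrightarrow> u\<^sub>1 t = c t + integral {0..t} (\<lambda>s. g s (u\<^sub>1 s))"
    and "\<And>t. t \<in> {0..1} \<Longrightarrow> u\<^sub>2 t = c t + integral {0..t} (\<lambda>s. g s (u\<^sub>2 s))"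
    and "\<And>s z z'. s \<in> {0..1} \<Longrightarrow> norm (g s z - g s z') \<le> L * norm (z - z')" and "0 < L"
    and "t \<in> {0..1}"
  shows "u\<^sub>1 t = u\<^sub>2 t"
  using volterra_compare[OF assms(1-3) assms(3-7), of 0 t] assms(8) by simp

text \<open>The weight \<open>exp (- 2 L t)\<close> turns the integral operator into a contraction.\<close>
lemma volterra_exists:
  fixes c :: "real \<Rightarrow> 'b::euclidean_space"
  assumes c: "continuous_on {0..1} c"
    and g: "continuous_on ({0..1} \<times> UNIV) (\<lambda>(s, z). g s z)"
    and lip: "\<And>s z z'. s \<in> {0..1} \<Longrightarrow> norm (g s z - g s z') \<le> L * norm (z - z')" and "0 < L"
  shows "\<exists>u. continuous_on {0..1} u \<and>
    (\<forall>t\<in>{0..1}. u t = c t + integral {0..t} (\<lambda>s. g s (u s)))"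
proof -
  \<comment> \<open>The fixed point theorem is applied to the bounded continuous functions on the
    whole line; clamping the argument to \<open>[0,1]\<close> produces such functions.\<close>
  define cl :: "real \<Rightarrow> real" where "cl t = max 0 (min 1 t)" for t
  \<comment> \<open>The unknown \<open>z\<close> is the rescaled solution
    \<open>exp (- (2 * L * s)) *\<^sub>R u s\<close>, so the ordinary sup norm of \<open>z\<close>
    is the weighted norm of \<open>u\<close>.\<close>
  define G where "G z s = g s (exp (2 * L * s) *\<^sub>R z s)" for z s
  define F where "F z t = exp (- (2 * L * t)) *\<^sub>R (c t + integral {0..t} (G z))" for z t
  define T where "T z = Bcontfun (\<lambda>t. F (apply_bcontfun z) (cl t))" for z
  have cl: "cl t \<in> {0..1}" for t by (auto simp: cl_def)
  have G: "continuous_on {0..1} (G z)" if "continuous_on {0..1} z" for z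
    unfolding G_def by (intro continuous_on_graph[OF g] continuous_intros that)
  have F: "continuous_on {0..1} (F z)" if "continuous_on {0..1} z" for z
    unfolding F_def
    by (intro continuous_intros c indefinite_integral_continuous_1 integrable_continuous_interval G that)
  have "continuous_on UNIV cl"
    unfolding cl_def by (intro continuous_intros)
  then have cont: "continuous_on UNIV (\<lambda>t. F z (cl t))" if "continuous_on {0..1} z" for z
    using continuous_on_compose2[OF F[OF that]] cl by blast
  have Fb: "(\<lambda>t. F (apply_bcontfun z) (cl t)) \<in> bcontfun" for z
  proof -
    have "compact (F (apply_bcontfun z) ` {0..1})"
      by (intro compact_continuous_image F) auto
    then obtain b where "\<forall>v\<in>F (apply_bcontfun z) ` {0..1}. norm v \<le> b"
      using compact_imp_bounded bounded_iff by metis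
    then show ?thesis
      using cl by (intro bcontfun_normI[of _ b] cont) auto
  qed
  have T: "apply_bcontfun (T z) t = F (apply_bcontfun z) (cl t)" for z t
    unfolding T_def by (simp add: Bcontfun_inverse[OF Fb])
  have contr: "dist (T z) (T w) \<le> 1 / 2 * dist z w" for z w
  proof (rule dist_bound)
    fix t'
    define t where "t = cl t'"
    have t: "t \<in> {0..1}" unfolding t_def by (rule cl)
    have i: "G (apply_bcontfun v) integrable_on {0..t}" for v
      using t by (intro integrable_continuous_interval continuous_on_subset[OF G]) auto
    have "norm (integral {0..t} (\<lambda>s. G (apply_bcontfun z) s - G (apply_bcontfun w) s))
      \<le> (L * dist z w) * ((exp (2 * L * t) - 1) / (2 * L))"
    proof -
      have e: "((\<lambda>s. (L * dist z w) * exp (2 * L * s)) has_integral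
          (L * dist z w) * ((exp (2 * L * t) - 1) / (2 * L))) {0..t}"
        using t \<open>0 < L\<close> by (intro has_integral_mult_right has_integral_exp_scaled) auto
      have "norm (integral {0..t} (\<lambda>s. G (apply_bcontfun z) s - G (apply_bcontfun w) s))
        \<le> integral {0..t} (\<lambda>s. (L * dist z w) * exp (2 * L * s))"
      proof (rule integral_norm_bound_integral)
        show "(\<lambda>s. G (apply_bcontfun z) s - G (apply_bcontfun w) s) integrable_on {0..t}"
          by (intro integrable_diff i)
        show "(\<lambda>s. (L * dist z w) * exp (2 * L * s)) integrable_on {0..t}"
          using e by blast
        fix s assume "s \<in> {0..t}"
        then have s: "s \<in> {0..1}" using t by auto
        have "norm (G (apply_bcontfun z) s - G (apply_bcontfun w) s)
          \<le> L * norm (exp (2 * L * s) *\<^sub>R apply_bcontfun z s - exp (2 * L * s) *\<^sub>R apply_bcontfun w s)"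
          unfolding G_def by (rule lip[OF s])
        also have "\<dots> = L * exp (2 * L * s) * dist (apply_bcontfun z s) (apply_bcontfun w s)"
          by (simp add: dist_norm flip: scaleR_diff_right)
        also have "\<dots> \<le> L * exp (2 * L * s) * dist z w"
          using \<open>0 < L\<close> by (intro mult_left_mono dist_bounded) auto
        finally show "norm (G (apply_bcontfun z) s - G (apply_bcontfun w) s)
          \<le> (L * dist z w) * exp (2 * L * s)" by (simp add: ac_simps)
      qed
      then show ?thesis by (simp only: integral_unique[OF e])
    qed
    also have "\<dots> = dist z w / 2 * (exp (2 * L * t) - 1)"
      using \<open>0 < L\<close> by (simp add: field_simps)
    finally have *: "norm (integral {0..t} (\<lambda>s. G (apply_bcontfun z) s - G (apply_bcontfun w) s))
      \<le> dist z w / 2 * (exp (2 * L * t) - 1)" .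
    have "dist (apply_bcontfun (T z) t') (apply_bcontfun (T w) t') =
      exp (- (2 * L * t)) * norm (integral {0..t} (\<lambda>s. G (apply_bcontfun z) s - G (apply_bcontfun w) s))"
      using i unfolding T by (simp add: F_def dist_norm integral_diff flip: t_def scaleR_diff_right)
    also have "\<dots> \<le> exp (- (2 * L * t)) * (dist z w / 2 * (exp (2 * L * t) - 1))"
      by (intro mult_left_mono *) auto
    also have "\<dots> = dist z w / 2 * (1 - exp (- (2 * L * t)))"
      by (simp add: algebra_simps flip: exp_add)
    also have "\<dots> \<le> dist z w / 2 * 1"
      by (intro mult_left_mono) auto
    finally show "dist (apply_bcontfun (T z) t') (apply_bcontfun (T w) t') \<le> 1 / 2 * dist z w"
      by simp
  qed
  then obtain z where z: "T z = z"
    using banach_fix_type[of "1 / 2" T] by auto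
  define u where "u t = exp (2 * L * t) *\<^sub>R apply_bcontfun z t" for t
  have "u t = c t + integral {0..t} (\<lambda>s. g s (u s))" if t: "t \<in> {0..1}" for t
  proof -
    have "cl t = t" using t by (auto simp: cl_def)
    then have "apply_bcontfun z t = exp (- (2 * L * t)) *\<^sub>R (c t + integral {0..t} (\<lambda>s. g s (u s)))"
      using T[of z t] by (simp add: z F_def G_def[abs_def] u_def)
    then have "u t = (exp (2 * L * t) * exp (- (2 * L * t))) *\<^sub>R (c t + integral {0..t} (\<lambda>s. g s (u s)))"
      by (subst u_def) simp
    then show ?thesis by (simp flip: exp_add)
  qed
  moreover have "continuous_on {0..1} u"
    unfolding u_def by (intro continuous_intros continuous_on_apply_bcontfun)
  ultimately show ?thesis by blast
qed

section \<open>Continuous dependence on a parameter in a topological space\<close>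

text \<open>The distance from \<open>u q' t'\<close> to \<open>u q t\<close> splits at
  \<open>u q t'\<close>: the first part is small uniformly in \<open>t'\<close>, the second by
  continuity of the single curve \<open>u q\<close>.\<close>

lemma continuous_on_Times_uniform:
  fixes u :: "'q::topological_space \<Rightarrow> 't::topological_space \<Rightarrow> 'b::metric_space"
  assumes unif: "\<And>q e. q \<in> Q \<Longrightarrow> 0 < e \<Longrightarrow>
      \<exists>X. open X \<and> q \<in> X \<and> (\<forall>q'\<in>X \<inter> Q. \<forall>t\<in>T. dist (u q' t) (u q t) \<le> e)"
    and cont: "\<And>q. q \<in> Q \<Longrightarrow> continuous_on T (u q)"
  shows "continuous_on (Q \<times> T) (\<lambda>(q, t). u q t)"
  unfolding continuous_on_def
proof safe
  fix q t assume q: "q \<in> Q" and t: "t \<in> T"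
  show "((\<lambda>(q, t). u q t) \<longlongrightarrow> u q t) (at (q, t) within Q \<times> T)"
  proof (rule tendstoI)
    fix e :: real assume "0 < e"
    then obtain X where X: "open X" "q \<in> X" "\<And>q' t. q' \<in> X \<inter> Q \<Longrightarrow> t \<in> T \<Longrightarrow> dist (u q' t) (u q t) \<le> e / 2"
      using unif[OF q, of "e / 2"] by auto
    have "\<forall>\<^sub>F t' in at t within T. dist (u q t') (u q t) < e / 2"
      by (rule tendstoD) (use cont[OF q] t \<open>0 < e\<close> in \<open>auto simp: continuous_on_def\<close>)
    then obtain Y where Y: "open Y" "t \<in> Y"
      and Y': "\<forall>t'\<in>Y. t' \<noteq> t \<longrightarrow> t' \<in> T \<longrightarrow> dist (u q t') (u q t) < e / 2"
      unfolding eventually_at_topological by blast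
    have Y3: "dist (u q t') (u q t) < e / 2" if "t' \<in> Y" "t' \<in> T" for t'
      using Y' that \<open>0 < e\<close> by (cases "t' = t") auto
    have "dist (u q' t') (u q t) < e" if "(q', t') \<in> X \<times> Y" "(q', t') \<in> Q \<times> T" for q' t'
      using X(3)[of q' t'] Y3[of t'] that dist_triangle[of "u q' t'" "u q t" "u q t'"] by auto
    then show "\<forall>\<^sub>F x in at (q, t) within Q \<times> T. dist (case x of (q, t) \<Rightarrow> u q t) (u q t) < e"
      unfolding eventually_at_topological using X(1,2) Y(1,2)
      by (intro exI[of _ "X \<times> Y"] conjI open_Times ballI impI) auto
  qed
qed

text \<open>A solution is chosen for each parameter separately. The choices need no coherence: near
  \<open>q\<close> all of them share one Lipschitz constant, and the comparison estimate against the
  solution at \<open>q\<close> gives continuity in the parameter.\<close>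

lemma volterra_family:
  fixes c :: "'q::topological_space \<Rightarrow> real \<Rightarrow> 'b::euclidean_space"
  assumes c: "continuous_on (Q \<times> {0..1}) (\<lambda>(q, t). c q t)"
    and g: "continuous_on (Q \<times> {0..1} \<times> UNIV) (\<lambda>(q, s, z). g q s z)"
    and lip: "\<And>q. q \<in> Q \<Longrightarrow> \<exists>X L. open X \<and> q \<in> X \<and> 0 < L \<and>
      (\<forall>q'\<in>X \<inter> Q. \<forall>s\<in>{0..1}. \<forall>z z'. norm (g q' s z - g q' s z') \<le> L * norm (z - z'))"
  obtains u where "continuous_on (Q \<times> {0..1}) (\<lambda>(q, t). u q t)"
    and "\<forall>q\<in>Q. \<forall>t\<in>{0..1}. u q t = c q t + integral {0..t} (\<lambda>s. g q s (u q s))"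
proof -
  have gq: "continuous_on ({0..1} \<times> UNIV) (\<lambda>(s, z). g q s z)" if "q \<in> Q" for q
  proof -
    have "continuous_on ({0..1} \<times> UNIV) (\<lambda>x::real \<times> 'b. (q, x))" by (intro continuous_intros)
    from continuous_on_compose2[OF g this] show ?thesis using that by auto
  qed
  have cq: "continuous_on {0..1} (c q)" if "q \<in> Q" for q
  proof -
    have "continuous_on {0..1} (\<lambda>s::real. (q, s))" by (intro continuous_intros)
    from continuous_on_compose2[OF c this] show ?thesis using that by auto
  qed
  define sol where "sol q u \<longleftrightarrow> continuous_on {0..1} u \<and>
      (\<forall>t\<in>{0..1}. u t = c q t + integral {0..t} (\<lambda>s. g q s (u s)))" for q u
  have ex: "\<exists>u. sol q u" if q: "q \<in> Q" for q
  proof -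
    from lip[OF q] obtain X L where "q \<in> X" "0 < L"
      and L: "\<forall>q'\<in>X \<inter> Q. \<forall>s\<in>{0..1}. \<forall>z z'. norm (g q' s z - g q' s z') \<le> L * norm (z - z')"
      by (elim exE conjE)
    have "norm (g q s z - g q s z') \<le> L * norm (z - z')" if "s \<in> {0..1}" for s z z'
      using bspec[OF L, of q] \<open>q \<in> X\<close> q that by simp
    from volterra_exists[OF cq[OF q] gq[OF q] this \<open>0 < L\<close>] show ?thesis
      unfolding sol_def .
  qed
  define u where "u q = (SOME u. sol q u)" for q
  have sol: "sol q (u q)" if "q \<in> Q" for q
    unfolding u_def using ex[OF that] by (rule someI_ex)
  have u: "continuous_on {0..1} (u q)" if "q \<in> Q" for q
    using sol[OF that] by (simp only: sol_def)
  have eq: "u q t = c q t + integral {0..t} (\<lambda>s. g q s (u q s))" if "q \<in> Q" "t \<in> {0..1}" for q t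
    using sol[OF that(1)] that(2) unfolding sol_def by (elim conjE) (rule bspec)
  have "continuous_on (Q \<times> {0..1}) (\<lambda>(q, t). u q t)"
  proof (rule continuous_on_Times_uniform[OF _ u])
    fix q and e :: real assume q: "q \<in> Q" and "0 < e"
    from lip[OF q] obtain X L where X: "open X" "q \<in> X" "0 < L"
      and L': "\<forall>q'\<in>X \<inter> Q. \<forall>s\<in>{0..1}. \<forall>z z'. norm (g q' s z - g q' s z') \<le> L * norm (z - z')"
      by (elim exE conjE)
    have L: "norm (g q' s z - g q' s z') \<le> L * norm (z - z')"
      if "q' \<in> X \<inter> Q" "s \<in> {0..1}" for q' s z z'
      using bspec[OF L', of q'] that by simp
    \<comment> \<open>Chosen so that the comparison bound \<open>4 * e' * exp (2 * L)\<close> is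
      exactly \<open>e\<close>.\<close>
    define e' where "e' = e / (4 * exp (2 * L))"
    have "0 < e'" using \<open>0 < e\<close> by (simp add: e'_def)
    obtain Y where Y: "q \<in> Y" "open Y" "\<forall>q'\<in>Y \<inter> Q. \<forall>t\<in>{0..1}. dist (c q' t) (c q t) \<le> e'"
      by (rule continuous_on_prod_compactE[OF c compact_Icc q \<open>0 < e'\<close>, unfolded prod.case])
    \<comment> \<open>The fields at \<open>q'\<close> and \<open>q\<close> are compared only along
      the fixed curve \<open>u q\<close>. Over the compact interval their closeness is uniform in
      \<open>s\<close>, although \<open>z\<close> ranges over the whole space.\<close>
    have g': "continuous_on (Q \<times> {0..1}) (\<lambda>(q', s). g q' s (u q s))"
    proof -
      have "continuous_on (Q \<times> {0..1}) (\<lambda>x. u q (snd x))"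
        by (intro continuous_on_compose2[OF u[OF q]] continuous_intros) auto
      then have "continuous_on (Q \<times> {0..1}) (\<lambda>x. (fst x, snd x, u q (snd x)))"
        by (intro continuous_intros)
      from g this show ?thesis by (rule continuous_on_compose_eq) auto
    qed
    obtain Z where Z: "q \<in> Z" "open Z"
      "\<forall>q'\<in>Z \<inter> Q. \<forall>s\<in>{0..1}. dist (g q' s (u q s)) (g q s (u q s)) \<le> e'"
      by (rule continuous_on_prod_compactE[OF g' compact_Icc q \<open>0 < e'\<close>, unfolded prod.case])
    have "dist (u q' t) (u q t) \<le> e" if q': "q' \<in> (X \<inter> Y \<inter> Z) \<inter> Q" and t: "t \<in> {0..1}" for q' t
    proof -
      have "norm (u q' t - u q t) \<le> 4 * e' * exp (2 * L)"
      proof (rule volterra_compare[where u\<^sub>1 = "u q'" and u\<^sub>2 = "u q" and c\<^sub>1 = "c q'" and c\<^sub>2 = "c q"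
            and g\<^sub>1 = "g q'" and g\<^sub>2 = "g q"])
        show "norm (c q' r - c q r) \<le> e'" if "r \<in> {0..1}" for r
          using Y(3) q' that by (simp add: dist_norm)
        show "norm (g q' s (u q s) - g q s (u q s)) \<le> e'" if "s \<in> {0..1}" for s
          using Z(3) q' that by (simp add: dist_norm)
        have "q' \<in> Q" using q' by simp
        show "continuous_on {0..1} (u q')" by (rule u) fact
        show "continuous_on {0..1} (u q)" by (rule u) fact
        show "continuous_on ({0..1} \<times> UNIV) (\<lambda>(s, z). g q' s z)" by (rule gq) fact
        show "continuous_on ({0..1} \<times> UNIV) (\<lambda>(s, z). g q s z)" by (rule gq) fact
        show "u q' r = c q' r + integral {0..r} (\<lambda>s. g q' s (u q' s))" if "r \<in> {0..1}" for r
          by (rule eq) fact+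
        show "u q r = c q r + integral {0..r} (\<lambda>s. g q s (u q s))" if "r \<in> {0..1}" for r
          by (rule eq) fact+
        show "norm (g q' s z - g q' s z') \<le> L * norm (z - z')" if "s \<in> {0..1}" for s z z'
          using q' that by (intro L) auto
      qed fact+
      also have "\<dots> = e" by (simp add: e'_def)
      finally show ?thesis by (simp add: dist_norm)
    qed
    then show "\<exists>X. open X \<and> q \<in> X \<and> (\<forall>q'\<in>X \<inter> Q. \<forall>t\<in>{0..1}. dist (u q' t) (u q t) \<le> e)"
      using X Y(1,2) Z(1,2) by (intro exI[of _ "X \<inter> Y \<inter> Z"]) auto
  qed
  then show thesis by (rule that) (intro ballI, rule eq)
qed


section \<open>Jets of smooth maps on convex sets\<close>

lemma integral_unit_continuous:
  fixes f :: "'q::topological_space \<Rightarrow> real \<Rightarrow> 'b::banach"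
  assumes "continuous_on (Q \<times> {0..1}) (\<lambda>(q, t). f q t)"
  shows "continuous_on Q (\<lambda>q. integral {0..1} (f q))"
  using integral_continuous_on_param[of Q 0 1 f] assms by (simp add: cbox_interval)

lemma convex_interior_lcs:
  fixes V :: "'a::locally_convex_space set"
  assumes "convex V"
  shows "convex (interior V)"
proof (rule convexI)
  fix x y and u v :: real
  assume x: "x \<in> interior V" and y: "y \<in> interior V" and uv: "0 \<le> u" "0 \<le> v" "u + v = 1"
  show "u *\<^sub>R x + v *\<^sub>R y \<in> interior V"
  proof (cases "v = 0")
    case False
    have "x + v *\<^sub>R (y - x) \<in> interior V"
      using False uv interior_subset x by (intro convex_shrink_interior[OF assms _ y]) auto
    moreover have "u = 1 - v" using uv by simp
    then have "u *\<^sub>R x + v *\<^sub>R y = x + v *\<^sub>R (y - x)"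
      by (simp only:) (simp add: algebra_simps)
    ultimately show ?thesis by simp
  qed (use x uv in simp)
qed

lemma convex_segment_mem:
  fixes V :: "'a::real_vector set"
  assumes "convex V" "a \<in> V" "b \<in> V" "t \<in> {0..1}"
  shows "a + t *\<^sub>R (b - a) \<in> V"
proof -
  have "(1 - t) *\<^sub>R a + t *\<^sub>R b \<in> V"
    using assms by (intro convexD) auto
  then show ?thesis by (simp add: algebra_simps)
qed

lemma continuous_on_fun_upd:
  fixes f :: "'a::topological_space \<Rightarrow> 'i \<Rightarrow> 'b::topological_space"
  assumes "continuous_on S f" "continuous_on S g"
  shows "continuous_on S (\<lambda>x. (f x)(i := g x))"
proof (rule continuous_on_coordinatewise_then_product)
  fix j
  have "continuous_on S (\<lambda>x. f x j)"
    using assms(1) by (rule continuous_on_product_then_coordinatewise)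
  then show "continuous_on S (\<lambda>x. ((f x)(i := g x)) j)"
    using assms(2) by (cases "j = i") auto
qed

text \<open>\<open>D m (x, y)\<close> stands for \<open>d\<^sup>(\<^sup>m\<^sup>) f (x, y\<^sub>0, \<dots>, y\<^sub>m\<^sub>-\<^sub>1)\<close>.\<close>
locale open_tower =
  fixes V :: "'a::locally_convex_space set"
    and D :: "nat \<Rightarrow> 'a \<times> (nat \<Rightarrow> 'a) \<Rightarrow> 'b::euclidean_space"
  assumes open_V: "open V" and convex_V: "convex V"
    and cont: "\<And>m. continuous_on (V \<times> UNIV) (D m)"
    and indep: "\<And>m x y y'. x \<in> V \<Longrightarrow> (\<And>i. i < m \<Longrightarrow> y i = y' i) \<Longrightarrow> D m (x, y) = D m (x, y')"
    and deriv: "\<And>m x y v. x \<in> V \<Longrightarrow>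
      has_dir_derivative (\<lambda>z. D m (z, y)) (D (Suc m) (x, y(m := v))) x v"
begin

lemma ftc:
  assumes a: "a \<in> V" and b: "b \<in> V"
  shows "D m (b, y) - D m (a, y) =
    integral {0..1} (\<lambda>t. D (Suc m) (a + t *\<^sub>R (b - a), y(m := b - a)))"
proof -
  have "((\<lambda>t. D (Suc m) (a + t *\<^sub>R (b - a), y(m := b - a))) has_integral
      (D m (a + 1 *\<^sub>R (b - a), y) - D m (a + 0 *\<^sub>R (b - a), y))) {0..1}"
    by (rule fundamental_theorem_of_calculus)
      (auto intro!: has_dir_derivative_imp_line_derivative deriv convex_segment_mem convex_V a b)
  then show ?thesis by (simp add: integral_unique)
qed

lemma dir_scale:
  assumes "x \<in> V"
  shows "D (Suc m) (x, y(m := c *\<^sub>R v)) = c *\<^sub>R D (Suc m) (x, y(m := v))"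
  using dir_derivative_eq[OF deriv[OF assms, of m y "c *\<^sub>R v"]]
    dir_derivative_eq[OF has_dir_derivative_scale_dir[OF deriv[OF assms, of m y v], of c]]
  by simp

text \<open>Additivity in the direction is not formal; it rests on continuity of
  \<open>D (Suc m)\<close>. The increment from \<open>x\<close> to \<open>x + t (v + w)\<close> is
  split at \<open>x + t v\<close>. By \<open>ftc\<close> the second part divided by \<open>t\<close>
  is the mean value \<open>I t\<close>, which is continuous at \<open>t = 0\<close> with the
  derivative along \<open>w\<close> as its value.\<close>

lemma dir_add:
  assumes x: "x \<in> V"
  shows "D (Suc m) (x, y(m := v + w)) = D (Suc m) (x, y(m := v)) + D (Suc m) (x, y(m := w))"
proof -
  define h where "h z = D m (z, y)" for z
  obtain r1 where r1: "0 < r1" "\<forall>t. \<bar>t\<bar> < r1 \<longrightarrow> x + t *\<^sub>R v \<in> V"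
    by (rule line_in_open_lcs[OF open_V x])
  obtain r2 where r2: "0 < r2" "\<forall>t. \<bar>t\<bar> < r2 \<longrightarrow> x + t *\<^sub>R (v + w) \<in> V"
    by (rule line_in_open_lcs[OF open_V x])
  define r where "r = min r1 r2"
  have r: "0 < r" "\<And>t. \<bar>t\<bar> < r \<Longrightarrow> x + t *\<^sub>R v \<in> V" "\<And>t. \<bar>t\<bar> < r \<Longrightarrow> x + t *\<^sub>R (v + w) \<in> V"
    using r1 r2 by (auto simp: r_def)
  define I where "I t = integral {0..1} (\<lambda>s. D (Suc m) (x + t *\<^sub>R v + s *\<^sub>R (t *\<^sub>R w), y(m := w)))" for t
  have seg: "x + t *\<^sub>R v + s *\<^sub>R (t *\<^sub>R w) \<in> V" if "\<bar>t\<bar> < r" "s \<in> {0..1}" for t s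
  proof -
    have "(x + t *\<^sub>R v) + s *\<^sub>R ((x + t *\<^sub>R (v + w)) - (x + t *\<^sub>R v)) \<in> V"
      using that r by (intro convex_segment_mem convex_V) auto
    then show ?thesis by (simp add: algebra_simps)
  qed
  have "continuous_on {-r<..<r} I"
    unfolding I_def
  proof (rule integral_unit_continuous, rule continuous_on_compose_eq[OF cont])
    show "continuous_on ({-r<..<r} \<times> {0..1})
      (\<lambda>p. (x + fst p *\<^sub>R v + snd p *\<^sub>R (fst p *\<^sub>R w), y(m := w)))"
      by (intro continuous_intros)
    show "(x + fst p *\<^sub>R v + snd p *\<^sub>R (fst p *\<^sub>R w), y(m := w)) \<in> V \<times> UNIV"
      if "p \<in> {-r<..<r} \<times> {0..1}" for p
      using seg[of "fst p" "snd p"] that by auto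
  qed auto
  then have "(I \<longlongrightarrow> I 0) (at 0)"
    using r(1) by (simp add: continuous_on_eq_continuous_at isCont_def)
  then have I: "(I \<longlongrightarrow> D (Suc m) (x, y(m := w))) (at 0)"
    by (simp add: I_def)
  have hv: "((\<lambda>t. inverse t *\<^sub>R (h (x + t *\<^sub>R v) - h x)) \<longlongrightarrow> D (Suc m) (x, y(m := v))) (at 0)"
    using deriv[OF x, of m y v] unfolding has_dir_derivative_def h_def .
  have "((\<lambda>t. inverse t *\<^sub>R (h (x + t *\<^sub>R (v + w)) - h x)) \<longlongrightarrow>
      D (Suc m) (x, y(m := v)) + D (Suc m) (x, y(m := w))) (at 0)"
  proof (rule Lim_transform_eventually[OF tendsto_add[OF hv I]])
    have "I t = inverse t *\<^sub>R (h (x + t *\<^sub>R (v + w)) - h (x + t *\<^sub>R v))" if t: "\<bar>t\<bar> < r" "t \<noteq> 0" for t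
    proof -
      have "h (x + t *\<^sub>R (v + w)) - h (x + t *\<^sub>R v) = integral {0..1}
        (\<lambda>s. D (Suc m) (x + t *\<^sub>R v + s *\<^sub>R (t *\<^sub>R w), y(m := t *\<^sub>R w)))"
        using ftc[OF r(2)[OF t(1)] r(3)[OF t(1)], of m y] by (simp add: h_def algebra_simps)
      also have "\<dots> = integral {0..1}
        (\<lambda>s. t *\<^sub>R D (Suc m) (x + t *\<^sub>R v + s *\<^sub>R (t *\<^sub>R w), y(m := w)))"
        by (rule integral_cong) (simp only: dir_scale[OF seg[OF t(1)]])
      finally show ?thesis using t by (simp add: I_def)
    qed
    then show "\<forall>\<^sub>F t in at 0. inverse t *\<^sub>R (h (x + t *\<^sub>R v) - h x) + I t =
        inverse t *\<^sub>R (h (x + t *\<^sub>R (v + w)) - h x)"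
      using r(1) unfolding eventually_at
      by (intro exI[of _ r]) (auto simp: algebra_simps dist_real_def)
  qed
  then have "has_dir_derivative h (D (Suc m) (x, y(m := v)) + D (Suc m) (x, y(m := w))) x (v + w)"
    unfolding has_dir_derivative_def .
  from dir_derivative_eq[OF this] dir_derivative_eq[OF deriv[OF x, of m y "v + w"]]
  show ?thesis by (simp add: h_def[abs_def])
qed

text \<open>In the last slot this is \<open>dir_add\<close> and \<open>dir_scale\<close>. In an
  earlier slot linearity is known one level below, at all points of the open set \<open>V\<close>;
  differentiating that identity in direction \<open>y m\<close> gives it at level
  \<open>Suc m\<close>, directional derivatives being unique.\<close>

lemma multilinear:
  assumes "x \<in> V" "i < m"
  shows "linear (\<lambda>v. D m (x, y(i := v)))"
  using assms
proof (induction m arbitrary: x y)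
  case (Suc m)
  show ?case
  proof (cases "i = m")
    case True
    show ?thesis
      unfolding True by (intro linearI dir_add dir_scale Suc.prems(1))
  next
    case False
    then have i: "i < m" using Suc.prems by simp
    have d: "has_dir_derivative (\<lambda>z. D m (z, y(i := v))) (D (Suc m) (x, y(i := v))) x (y m)" for v
      using deriv[OF Suc.prems(1), of m "y(i := v)" "y m"] False
      by (simp add: fun_upd_idem)
    show ?thesis
    proof (rule linearI)
      fix v w and c :: real
      have "has_dir_derivative (\<lambda>z. D m (z, y(i := v + w)))
          (D (Suc m) (x, y(i := v)) + D (Suc m) (x, y(i := w))) x (y m)"
        by (rule has_dir_derivative_transform[OF open_V Suc.prems(1) _ has_dir_derivative_add[OF d d]])
          (rule linear_add[OF Suc.IH[OF _ i], symmetric])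
      from dir_derivative_eq[OF this] dir_derivative_eq[OF d[of "v + w"]]
      show "D (Suc m) (x, y(i := v + w)) = D (Suc m) (x, y(i := v)) + D (Suc m) (x, y(i := w))"
        by simp
      have "has_dir_derivative (\<lambda>z. D m (z, y(i := c *\<^sub>R v))) (c *\<^sub>R D (Suc m) (x, y(i := v))) x (y m)"
      proof (rule has_dir_derivative_transform[OF open_V Suc.prems(1) _
            has_dir_derivative_linear[OF linear_scaleR _ d]])
        show "continuous_on UNIV (scaleR c :: 'b \<Rightarrow> 'b)" by (intro continuous_intros)
      qed (rule linear_scale[OF Suc.IH[OF _ i], symmetric])
      from dir_derivative_eq[OF this] dir_derivative_eq[OF d[of "c *\<^sub>R v"]]
      show "D (Suc m) (x, y(i := c *\<^sub>R v)) = c *\<^sub>R D (Suc m) (x, y(i := v))"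
        by simp
    qed
  qed
qed simp

end

section \<open>Jets up to the boundary\<close>

text \<open>At boundary points difference quotients may leave the set, so the derivative clause is
  replaced by the fundamental theorem along segments, and linearity in each slot, a consequence on
  open sets, becomes an axiom. The clauses on \<open>D\<close> other than continuity are equations
  between continuous functions, hence pass from the interior to \<open>V\<close>.\<close>

locale jet_tower =
  fixes V :: "'a::locally_convex_space set"
    and D :: "nat \<Rightarrow> 'a \<times> (nat \<Rightarrow> 'a) \<Rightarrow> 'b::euclidean_space"
  assumes convex_V: "convex V"
    and cont: "\<And>m. continuous_on (V \<times> UNIV) (D m)"
    and indep: "\<And>m x y y'. x \<in> V \<Longrightarrow> (\<And>i. i < m \<Longrightarrow> y i = y' i) \<Longrightarrow> D m (x, y) = D m (x, y')"
    and multilinear: "\<And>m x y i. x \<in> V \<Longrightarrow> i < m \<Longrightarrow> linear (\<lambda>v. D m (x, y(i := v)))"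
    and ftc: "\<And>m a b y. a \<in> V \<Longrightarrow> b \<in> V \<Longrightarrow> D m (b, y) - D m (a, y) =
      integral {0..1} (\<lambda>t. D (Suc m) (a + t *\<^sub>R (b - a), y(m := b - a)))"

lemma open_tower_extend:
  assumes V: "convex V" "interior V \<noteq> {}"
    and cont: "\<And>m. continuous_on (V \<times> UNIV) (D m)"
    and tower: "open_tower (interior V) D"
  shows "jet_tower V D"
proof (rule jet_tower.intro)
  interpret open_tower "interior V" D by (rule tower)
  note ext = eq_on_convex_from_interior[OF V]
  have Dy: "continuous_on V (\<lambda>x. D m (x, y))" for m y
  proof -
    have "continuous_on V (\<lambda>x. (x, y))" by (intro continuous_intros)
    from assms(3) this show ?thesis by (rule continuous_on_compose_eq) auto
  qed
  show "convex V" "\<And>m. continuous_on (V \<times> UNIV) (D m)" by fact+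
  show "D m (x, y) = D m (x, y')" if "x \<in> V" "\<And>i. i < m \<Longrightarrow> y i = y' i" for m x y y'
    by (rule ext[where g = "\<lambda>x. D m (x, y)" and h = "\<lambda>x. D m (x, y')", OF Dy Dy _ that(1)])
      (rule indep, use that in auto)
  show "linear (\<lambda>v. D m (x, y(i := v)))" if x: "x \<in> V" and "i < m" for m x y i
  proof (rule linearI)
    fix v w and c :: real
    show "D m (x, y(i := v + w)) = D m (x, y(i := v)) + D m (x, y(i := w))"
      by (rule ext[where g = "\<lambda>x. D m (x, y(i := v + w))" and
            h = "\<lambda>x. D m (x, y(i := v)) + D m (x, y(i := w))", OF Dy _ _ x])
        (auto intro!: continuous_on_add Dy linear_add[OF multilinear] \<open>i < m\<close>)
    show "D m (x, y(i := c *\<^sub>R v)) = c *\<^sub>R D m (x, y(i := v))"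
      by (rule ext[where g = "\<lambda>x. D m (x, y(i := c *\<^sub>R v))" and
            h = "\<lambda>x. c *\<^sub>R D m (x, y(i := v))", OF Dy _ _ x])
        (auto intro!: continuous_on_scaleR continuous_on_const Dy linear_scale[OF multilinear] \<open>i < m\<close>)
  qed

  show "D m (b, y) - D m (a, y) =
      integral {0..1} (\<lambda>t. D (Suc m) (a + t *\<^sub>R (b - a), y(m := b - a)))"
    if "a \<in> V" "b \<in> V" for m a b y
  proof -
    \<comment> \<open>Here the variable is the pair \<open>(a, b)\<close>: both sides are continuous
      on the convex set \<open>V \<times> V\<close> and agree on its interior.\<close>
    define g where "g p = D m (snd p, y) - D m (fst p, y)" for p
    define h where "h p = integral {0..1}
      (\<lambda>t. D (Suc m) (fst p + t *\<^sub>R (snd p - fst p), y(m := snd p - fst p)))" for p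
    have "g (a, b) = h (a, b)"
    proof (rule eq_on_convex_from_interior[of "V \<times> V"])
      show "continuous_on (V \<times> V) g"
        unfolding g_def
        by (intro continuous_on_diff continuous_on_compose2[OF Dy] continuous_intros) auto
      show "continuous_on (V \<times> V) h"
        unfolding h_def
      proof (rule integral_unit_continuous, rule continuous_on_compose_eq[OF assms(3)])
        show "continuous_on ((V \<times> V) \<times> {0..1}) (\<lambda>(p, t).
          (fst p + t *\<^sub>R (snd p - fst p), y(m := snd p - fst p)))"
          unfolding split_beta by (intro continuous_intros continuous_on_fun_upd)
      qed (auto intro!: convex_segment_mem V)
    qed (use V that in \<open>auto simp: interior_Times convex_Times g_def h_def intro!: ftc\<close>)
    then show ?thesis by (simp add: g_def h_def)
  qed
qed

lemma iter_dir_derivative_cong: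
  assumes "\<And>i. i < m \<Longrightarrow> y i = y' i"
  shows "iter_dir_derivative f m x y = iter_dir_derivative f m x y'"
  using assms by (induction m arbitrary: x) auto

lemma smooth_on_imp_jet_tower:
  fixes f :: "'a::locally_convex_space \<Rightarrow> 'b::euclidean_space"
  assumes f: "smooth_on V f" and V: "convex V" "interior V \<noteq> {}"
  obtains D where "jet_tower V D" "\<forall>x y. D 0 (x, y) = f x"
proof -
  have fc: "continuous_on V f" and fo: "Cr_on_open \<infinity> (interior V) f"
    using f unfolding Cr_on_def by blast+
  have "\<forall>k. \<exists>g. continuous_on (V \<times> directions k) g \<and>
      (\<forall>x\<in>interior V. \<forall>y\<in>directions k. g (x, y) = iter_dir_derivative f k x y)"
    using f unfolding Cr_on_def by simp
  from choice[OF this] obtain g where gc: "\<And>k. continuous_on (V \<times> directions k) (g k)"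
    and gi: "\<And>k x y. x \<in> interior V \<Longrightarrow> y \<in> directions k \<Longrightarrow> g k (x, y) = iter_dir_derivative f k x y"
    by blast
  \<comment> \<open>The extensions \<open>g m\<close> are controlled only on tuples in
    \<open>directions m\<close>, hence the restriction. Level 0 is \<open>f\<close> itself on the
    whole space, so that the field recovered from the tower equals \<open>f\<close> as a function
    and not merely on \<open>V\<close>.\<close>
  define D where "D m p = (if m = 0 then f (fst p) else g m (fst p, restrict (snd p) {..<m}))" for m p
  have D: "D m (x, y) = iter_dir_derivative f m x y" if "x \<in> interior V" for m x y
  proof (cases "m = 0")
    case False
    have "g m (x, restrict y {..<m}) = iter_dir_derivative f m x (restrict y {..<m})"
      using that by (intro gi) auto
    also have "\<dots> = iter_dir_derivative f m x y"
      by (rule iter_dir_derivative_cong) auto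
    finally show ?thesis using False by (simp add: D_def)
  qed (simp add: D_def)
  have cont: "continuous_on (V \<times> UNIV) (D m)" for m
  proof (cases "m = 0")
    case True
    have "continuous_on (V \<times> UNIV) (\<lambda>p. f (fst p))"
      by (rule continuous_on_compose2[OF fc]) (auto intro!: continuous_intros)
    then show ?thesis using True by (simp add: D_def[abs_def])
  next
    case False
    have r: "continuous_on (V \<times> UNIV) (\<lambda>p::'a \<times> (nat \<Rightarrow> 'a). restrict (snd p) {..<m})"
    proof (rule continuous_on_coordinatewise_then_product)
      fix i
      have "continuous_on (V \<times> UNIV) (\<lambda>p::'a \<times> (nat \<Rightarrow> 'a). snd p i)"
        by (rule continuous_on_product_then_coordinatewise) (intro continuous_intros)
      then show "continuous_on (V \<times> UNIV) (\<lambda>p::'a \<times> (nat \<Rightarrow> 'a). restrict (snd p) {..<m} i)"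
        by (cases "i < m") auto
    qed
    have "continuous_on (V \<times> UNIV) (\<lambda>p. g m (fst p, restrict (snd p) {..<m}))"
      by (rule continuous_on_compose2[OF gc[of m]])
        (auto intro!: continuous_on_Pair continuous_on_fst continuous_on_id r split: if_splits)
    then show ?thesis using False by (simp add: D_def[abs_def])
  qed
  have ex: "\<exists>w. has_dir_derivative (\<lambda>z. iter_dir_derivative f m z y) w x (y m)"
    if "x \<in> interior V" for m x y
    using fo that unfolding Cr_on_open_def by simp
  have "open_tower (interior V) D"
  proof
    show "continuous_on (interior V \<times> UNIV) (D m)" for m
      using cont by (rule continuous_on_subset) (use interior_subset in auto)
    show "D m (x, y) = D m (x, y')" if "x \<in> interior V" "\<And>i. i < m \<Longrightarrow> y i = y' i" for m x y y'
      using iter_dir_derivative_cong[of m y y', OF that(2)] D[OF that(1)] by simp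
    fix m :: nat and x v :: 'a and y assume x: "x \<in> interior V"
    \<comment> \<open>The derivative is known to exist in the direction stored in slot
      \<open>m\<close>, so an arbitrary \<open>v\<close> is placed there; the derivative of order
      \<open>m\<close> does not see this slot.\<close>
    define y' where "y' = y(m := v)"
    obtain w where w: "has_dir_derivative (\<lambda>z. iter_dir_derivative f m z y') w x (y' m)"
      using ex[OF x] ..
    then have "w = D (Suc m) (x, y')"
      using dir_derivative_eq[OF w] D[OF x] by simp
    then have w': "has_dir_derivative (\<lambda>z. iter_dir_derivative f m z y') (D (Suc m) (x, y(m := v))) x v"
      using w by (simp add: y'_def)
    show "has_dir_derivative (\<lambda>z. D m (z, y)) (D (Suc m) (x, y(m := v))) x v"
      by (rule has_dir_derivative_transform[OF open_interior x _ w'])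
        (simp add: D y'_def iter_dir_derivative_cong[of m "y(m := v)" y])
  qed (auto intro: convex_interior_lcs V)
  from open_tower_extend[OF V cont this] have "jet_tower V D" .
  then show thesis by (rule that) (simp add: D_def)
qed


section \<open>Iterated derivatives with all directions as arguments\<close>

lemma tendsto_fun_coordinatewise:
  fixes f :: "'a \<Rightarrow> 'i \<Rightarrow> 'b::topological_space"
  assumes "\<And>i. ((\<lambda>x. f x i) \<longlongrightarrow> l i) F"
  shows "(f \<longlongrightarrow> l) F"
proof -
  have "limitin (product_topology (\<lambda>i. euclidean) UNIV) f l F"
    using assms by (auto simp: limitin_componentwise)
  then show ?thesis by (simp add: euclidean_product_topology)
qed

lemma tendsto_fun_upd:
  fixes f :: "'a \<Rightarrow> 'i \<Rightarrow> 'b::topological_space"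
  assumes "(f \<longlongrightarrow> l) F" "(g \<longlongrightarrow> c) F"
  shows "((\<lambda>x. (f x)(i := g x)) \<longlongrightarrow> l(i := c)) F"
proof (rule tendsto_fun_coordinatewise)
  fix j
  have "((\<lambda>x. f x j) \<longlongrightarrow> l j) F"
    using continuous_on_tendsto_compose[OF continuous_on_product_coordinates[of j] assms(1)] by simp
  then show "((\<lambda>x. ((f x)(i := g x)) j) \<longlongrightarrow> (l(i := c)) j) F"
    using assms(2) by (cases "j = i") auto
qed

lemma has_dir_derivative_imp_tendsto_self:
  assumes "has_dir_derivative f v x y"
  shows "((\<lambda>t. inverse t *\<^sub>R (f (x + t *\<^sub>R y) - f x)) \<longlongrightarrow> v) (at 0)"
  using assms unfolding has_dir_derivative_def .

section \<open>The chain rule for jets\<close>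

context jet_tower
begin

lemma cont_D:
  assumes "continuous_on S f" "continuous_on S g" "\<And>x. x \<in> S \<Longrightarrow> f x \<in> V"
  shows "continuous_on S (\<lambda>x. D m (f x, g x))"
proof -
  have "continuous_on S (\<lambda>x. (f x, g x))" by (intro continuous_intros assms)
  from cont this show ?thesis by (rule continuous_on_compose_eq) (use assms(3) in auto)
qed

lemma tendsto_D:
  assumes "(f \<longlongrightarrow> a) F" "(g \<longlongrightarrow> b) F" "a \<in> V" "\<forall>\<^sub>F x in F. f x \<in> V"
  shows "((\<lambda>x. D m (f x, g x)) \<longlongrightarrow> D m (a, b)) F"
  by (rule continuous_on_tendsto_compose[OF cont tendsto_Pair[OF assms(1,2)]])
    (use assms in auto)

lemma scale_last:
  assumes "x \<in> V"
  shows "D (Suc m) (x, y(m := c *\<^sub>R v)) = c *\<^sub>R D (Suc m) (x, y(m := v))"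
  using linear_scale[OF multilinear[OF assms, of m "Suc m" y]] by simp

text \<open>The entries of \<open>v\<^sub>0\<close> are replaced by those of \<open>v\<close> one at
  a time; \<open>w i\<close> already has the first \<open>i\<close> entries of \<open>v\<close>.
  Each replacement costs one term, linear in the change of that entry.\<close>

lemma multilinear_telescope:
  assumes "x \<in> V"
  shows "D m (x, v) - D m (x, v\<^sub>0) =
    (\<Sum>i<m. D m (x, (\<lambda>l. if l < i then v l else v\<^sub>0 l)(i := v i - v\<^sub>0 i)))"
proof -
  define w where "w i = (\<lambda>l. if l < i then v l else v\<^sub>0 l)" for i
  have "D m (x, w (Suc i)) - D m (x, w i) = D m (x, (w i)(i := v i - v\<^sub>0 i))" if "i < m" for i
  proof -
    have 1: "w (Suc i) = (w i)(i := v i)" and 2: "(w i)(i := v\<^sub>0 i) = w i"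
      by (auto simp: w_def fun_eq_iff less_Suc_eq)
    show ?thesis
      using linear_diff[OF multilinear[OF assms that, of "w i"], of "v i" "v\<^sub>0 i"]
      unfolding 1 2 by simp
  qed
  then have "(\<Sum>i<m. D m (x, (w i)(i := v i - v\<^sub>0 i))) = (\<Sum>i<m. D m (x, w (Suc i)) - D m (x, w i))"
    by (intro sum.cong) simp_all
  also have "\<dots> = D m (x, w m) - D m (x, w 0)"
    by (rule sum_lessThan_telescope)
  finally have "(\<Sum>i<m. D m (x, (w i)(i := v i - v\<^sub>0 i))) = D m (x, w m) - D m (x, w 0)" .
  moreover have "D m (x, w m) = D m (x, v)"
    by (rule indep[OF assms]) (simp add: w_def)
  moreover have "w 0 = v\<^sub>0" by (simp add: w_def)
  ultimately show ?thesis by (simp add: w_def)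
qed

text \<open>Chain and product rule in one. The point \<open>\<phi> x\<close> may lie on the boundary
  of \<open>V\<close>, where no derivative of \<open>D m\<close> is at hand. So the increment is
  split into a change of base point with frozen arguments, given by \<open>ftc\<close>, and a change
  of arguments, given by the telescope. Linearity carries the factor \<open>inverse t\<close> into
  the slots, where it forms the difference quotients of \<open>\<phi>\<close> and of
  \<open>v i\<close>.\<close>

lemma has_dir_derivative_comp:
  fixes \<phi> :: "'e::locally_convex_space \<Rightarrow> 'a" and v :: "nat \<Rightarrow> 'e \<Rightarrow> 'a"
  assumes S: "open S" "x \<in> S" and \<phi>V: "\<And>z. z \<in> S \<Longrightarrow> \<phi> z \<in> V"
    and \<phi>: "has_dir_derivative \<phi> \<phi>' x d"
    and v: "\<And>i. has_dir_derivative (v i) (v' i) x d"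
  shows "has_dir_derivative (\<lambda>z. D m (\<phi> z, \<lambda>i. v i z))
    (D (Suc m) (\<phi> x, (\<lambda>i. v i x)(m := \<phi>')) + (\<Sum>i<m. D m (\<phi> x, (\<lambda>i. v i x)(i := v' i)))) x d"
proof -
  define p where "p t = \<phi> (x + t *\<^sub>R d)" for t
  define q where "q t = (\<lambda>i. v i (x + t *\<^sub>R d))" for t
  have x: "\<phi> x \<in> V" using S \<phi>V by blast
  have p0: "p 0 = \<phi> x" and q0: "q 0 = (\<lambda>i. v i x)" by (auto simp: p_def q_def)
  have "\<forall>\<^sub>F t in at 0. x + t *\<^sub>R d \<in> S"
    using eventually_line_lcs[OF S, of d] by (simp add: eventually_at_filter eventually_mono)
  then have pV: "\<forall>\<^sub>F t in at 0. p t \<in> V"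
    by (rule eventually_mono) (simp add: p_def \<phi>V)
  have p: "(p \<longlongrightarrow> \<phi> x) (at 0)"
    unfolding p_def by (rule has_dir_derivative_imp_tendsto[OF \<phi>])
  have q: "((\<lambda>t. q t i) \<longlongrightarrow> v i x) (at 0)" for i
    unfolding q_def by (rule has_dir_derivative_imp_tendsto[OF v])
  have dp: "((\<lambda>t. inverse t *\<^sub>R (p t - \<phi> x)) \<longlongrightarrow> \<phi>') (at 0)"
    using has_dir_derivative_imp_tendsto_self[OF \<phi>] unfolding p_def .
  have dq: "((\<lambda>t. inverse t *\<^sub>R (q t i - v i x)) \<longlongrightarrow> v' i) (at 0)" for i
    using has_dir_derivative_imp_tendsto_self[OF v] unfolding q_def .
  \<comment> \<open>The mean derivative between \<open>\<phi> x\<close> and an end point, as a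
    function of the end point and the direction. It is jointly continuous, so both may tend to their
    limits at once.\<close>
  define I where "I r = integral {0..1}
    (\<lambda>s. D (Suc m) (\<phi> x + s *\<^sub>R (fst r - \<phi> x), (q 0)(m := snd r)))" for r
  have "continuous_on (V \<times> UNIV) I"
    unfolding I_def
  proof (rule integral_unit_continuous)
    have "continuous_on ((V \<times> UNIV) \<times> {0..1}) (\<lambda>z. D (Suc m)
      (\<phi> x + snd z *\<^sub>R (fst (fst z) - \<phi> x), (q 0)(m := snd (fst z))))"
    proof (rule cont_D)
      show "continuous_on ((V \<times> UNIV) \<times> {0..1}) (\<lambda>z::('a \<times> 'a) \<times> real. (q 0)(m := snd (fst z)))"
        by (rule continuous_on_fun_upd[OF continuous_on_const])
          (intro continuous_on_snd continuous_on_fst continuous_on_id)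
      show "continuous_on ((V \<times> UNIV) \<times> {0..1})
        (\<lambda>z::('a \<times> 'a) \<times> real. \<phi> x + snd z *\<^sub>R (fst (fst z) - \<phi> x))"
        by (intro continuous_intros)
      show "\<phi> x + snd z *\<^sub>R (fst (fst z) - \<phi> x) \<in> V" if "z \<in> (V \<times> UNIV) \<times> {0..1}" for z :: "('a \<times> 'a) \<times> real"
        using that by (intro convex_segment_mem convex_V x) auto
    qed
    then show "continuous_on ((V \<times> UNIV) \<times> {0..1}) (\<lambda>(r, s). D (Suc m)
      (\<phi> x + s *\<^sub>R (fst r - \<phi> x), (q 0)(m := snd r)))"
      by (simp add: split_beta)
  qed
  then have "((\<lambda>t. I (p t, inverse t *\<^sub>R (p t - \<phi> x))) \<longlongrightarrow> I (\<phi> x, \<phi>')) (at 0)"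
    by (rule continuous_on_tendsto_compose[OF _ tendsto_Pair[OF p dp]]) (use x pV in auto)
  moreover have "I (\<phi> x, \<phi>') = D (Suc m) (\<phi> x, (\<lambda>i. v i x)(m := \<phi>'))"
    by (simp add: I_def q0)
  ultimately have 1: "((\<lambda>t. I (p t, inverse t *\<^sub>R (p t - \<phi> x))) \<longlongrightarrow>
      D (Suc m) (\<phi> x, (\<lambda>i. v i x)(m := \<phi>'))) (at 0)"
    by simp
  have 2: "((\<lambda>t. \<Sum>i<m. D m (p t, (\<lambda>l. if l < i then q t l else v l x)
        (i := inverse t *\<^sub>R (q t i - v i x)))) \<longlongrightarrow>
      (\<Sum>i<m. D m (\<phi> x, (\<lambda>i. v i x)(i := v' i)))) (at 0)"
  proof (rule tendsto_sum, rule tendsto_D[OF p tendsto_fun_upd[OF tendsto_fun_coordinatewise dq] x pV])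
    fix i l
    show "((\<lambda>t. if l < i then q t l else v l x) \<longlongrightarrow> v l x) (at 0)"
      using q by (cases "l < i") auto
  qed
  have "inverse t *\<^sub>R (D m (p t, q t) - D m (p 0, q 0)) =
      I (p t, inverse t *\<^sub>R (p t - \<phi> x)) + (\<Sum>i<m. D m (p t, (\<lambda>l. if l < i then q t l else v l x)
        (i := inverse t *\<^sub>R (q t i - v i x))))" if "p t \<in> V" for t
  proof -
    have "D m (p t, q 0) - D m (p 0, q 0) = integral {0..1}
        (\<lambda>s. D (Suc m) (\<phi> x + s *\<^sub>R (p t - \<phi> x), (q 0)(m := p t - \<phi> x)))"
      using ftc[OF x that] by (simp add: p0)
    then have "inverse t *\<^sub>R (D m (p t, q 0) - D m (p 0, q 0)) = integral {0..1}
        (\<lambda>s. inverse t *\<^sub>R D (Suc m) (\<phi> x + s *\<^sub>R (p t - \<phi> x), (q 0)(m := p t - \<phi> x)))"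
      by simp
    also have "\<dots> = integral {0..1} (\<lambda>s. D (Suc m) (\<phi> x + s *\<^sub>R (p t - \<phi> x),
        (q 0)(m := inverse t *\<^sub>R (p t - \<phi> x))))"
      by (intro integral_cong scale_last[symmetric] convex_segment_mem convex_V x that) auto
    finally have a: "inverse t *\<^sub>R (D m (p t, q 0) - D m (p 0, q 0)) =
        I (p t, inverse t *\<^sub>R (p t - \<phi> x))" by (simp add: I_def)
    have b: "inverse t *\<^sub>R (D m (p t, q t) - D m (p t, q 0)) =
        (\<Sum>i<m. D m (p t, (\<lambda>l. if l < i then q t l else v l x) (i := inverse t *\<^sub>R (q t i - v i x))))"
      unfolding multilinear_telescope[OF that] scaleR_right.sum q0
      by (rule sum.cong[OF refl], rule linear_scale[OF multilinear[OF that], symmetric]) simp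
    show ?thesis unfolding a[symmetric] b[symmetric] by (simp add: algebra_simps)
  qed
  then have "\<forall>\<^sub>F t in at 0. I (p t, inverse t *\<^sub>R (p t - \<phi> x)) +
      (\<Sum>i<m. D m (p t, (\<lambda>l. if l < i then q t l else v l x) (i := inverse t *\<^sub>R (q t i - v i x)))) =
      inverse t *\<^sub>R (D m (p t, q t) - D m (p 0, q 0))"
    using pV by (auto elim!: eventually_mono)
  from Lim_transform_eventually[OF tendsto_add[OF 1 2] this]
  show ?thesis unfolding has_dir_derivative_def p0 q0 unfolding p_def q_def .
qed

end

text \<open>The direction is entry \<open>j\<close> of the tuple that \<open>G\<close> carries, and
  the tuple stays fixed. As in \<open>Cr_on\<close>, the derivative is tested in the interior of
  \<open>U\<close> only; continuity up to the boundary is demanded of \<open>G'\<close> by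
  \<open>jet_class\<close>. The factor \<open>T\<close> holds a time variable that is not
  differentiated.\<close>

definition jet_deriv :: "'e::locally_convex_space set \<Rightarrow> 't set \<Rightarrow> nat \<Rightarrow>
    (('e \<times> (nat \<Rightarrow> 'e)) \<times> 't \<Rightarrow> 'v::locally_convex_space) \<Rightarrow> (('e \<times> (nat \<Rightarrow> 'e)) \<times> 't \<Rightarrow> 'v) \<Rightarrow> bool" where
  "jet_deriv U T j G G' \<longleftrightarrow> (\<forall>x\<in>interior U. \<forall>y. \<forall>t\<in>T.
      has_dir_derivative (\<lambda>z. G ((z, y), t)) (G' ((x, y), t)) x (y j))"

text \<open>
  All directions \<open>y 0, y 1, \<dots>\<close> are arguments of \<open>G\<close> from the start. So differentiation in \<open>x\<close> does
  not change the type of \<open>G\<close>, which is what makes inductions on \<open>k\<close> possible.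
\<close>
primrec jet_class :: "nat \<Rightarrow> 'e::locally_convex_space set \<Rightarrow> 't::topological_space set \<Rightarrow>
    (('e \<times> (nat \<Rightarrow> 'e)) \<times> 't \<Rightarrow> 'v::locally_convex_space) \<Rightarrow> bool" where
  "jet_class 0 U T G \<longleftrightarrow> continuous_on ((U \<times> UNIV) \<times> T) G"
| "jet_class (Suc k) U T G \<longleftrightarrow> continuous_on ((U \<times> UNIV) \<times> T) G \<and>
    (\<forall>j. \<exists>G'. jet_class k U T G' \<and> jet_deriv U T j G G')"

lemma jet_derivI:
  assumes "\<And>x y t. x \<in> interior U \<Longrightarrow> t \<in> T \<Longrightarrow>
      has_dir_derivative (\<lambda>z. G ((z, y), t)) (G' ((x, y), t)) x (y j)"
  shows "jet_deriv U T j G G'"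
  using assms unfolding jet_deriv_def by simp

lemma jet_derivD:
  assumes "jet_deriv U T j G G'" "x \<in> interior U" "t \<in> T"
  shows "has_dir_derivative (\<lambda>z. G ((z, y), t)) (G' ((x, y), t)) x (y j)"
  using assms unfolding jet_deriv_def by simp

lemma jet_deriv_fixed: "jet_deriv U T j (\<lambda>p. h (snd (fst p)) (snd p)) (\<lambda>_. 0)"
  by (intro jet_derivI) (simp add: has_dir_derivative_const)

lemma jet_deriv_add:
  assumes "jet_deriv U T j G G'" "jet_deriv U T j H H'"
  shows "jet_deriv U T j (\<lambda>p. G p + H p) (\<lambda>p. G' p + H' p)"
  by (intro jet_derivI has_dir_derivative_add jet_derivD[OF assms(1)] jet_derivD[OF assms(2)])

lemma jet_deriv_Pair:
  assumes "jet_deriv U T j G G'" "jet_deriv U T j H H'"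
  shows "jet_deriv U T j (\<lambda>p. (G p, H p)) (\<lambda>p. (G' p, H' p))"
  by (intro jet_derivI has_dir_derivative_Pair jet_derivD[OF assms(1)] jet_derivD[OF assms(2)])

lemma jet_deriv_scaleR:
  fixes G :: "('e::locally_convex_space \<times> (nat \<Rightarrow> 'e)) \<times> 't \<Rightarrow> real"
  assumes "jet_deriv U T j G G'" "jet_deriv U T j H H'"
  shows "jet_deriv U T j (\<lambda>p. G p *\<^sub>R H p) (\<lambda>p. G' p *\<^sub>R H p + G p *\<^sub>R H' p)"
  by (intro jet_derivI has_dir_derivative_scaleR jet_derivD[OF assms(1)] jet_derivD[OF assms(2)])

lemma jet_deriv_linear:
  assumes "linear L" "continuous_on UNIV L" "jet_deriv U T j G G'"
  shows "jet_deriv U T j (\<lambda>p. L (G p)) (\<lambda>p. L (G' p))"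
  by (rule jet_derivI, rule has_dir_derivative_linear[OF assms(1,2)], rule jet_derivD[OF assms(3)])

lemma jet_class_continuous: "jet_class k U T G \<Longrightarrow> continuous_on ((U \<times> UNIV) \<times> T) G"
  by (cases k) auto

lemma jet_class_SucI:
  assumes "continuous_on ((U \<times> UNIV) \<times> T) G" "\<And>j. jet_class k U T (G' j)"
    and "\<And>j. jet_deriv U T j G (G' j)"
  shows "jet_class (Suc k) U T G"
  unfolding jet_class.simps
proof (intro conjI allI)
  show "\<exists>H. jet_class k U T H \<and> jet_deriv U T j G H" for j
    using assms(2,3)[of j] by blast
qed (rule assms(1))

lemma jet_class_SucE:
  assumes "jet_class (Suc k) U T G"
  obtains G' where "\<forall>j. jet_class k U T (G' j) \<and> jet_deriv U T j G (G' j)"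
proof -
  have "\<forall>j. \<exists>G'. jet_class k U T G' \<and> jet_deriv U T j G G'" using assms by simp
  from choice[OF this] obtain G' where
    G': "\<forall>j. jet_class k U T (G' j) \<and> jet_deriv U T j G (G' j)" ..
  then show thesis by (rule that)
qed

lemma jet_class_SucD: "jet_class (Suc k) U T G \<Longrightarrow> jet_class k U T G"
proof (induction k arbitrary: G)
  case (Suc k)
  obtain G' where G': "\<forall>j. jet_class (Suc k) U T (G' j) \<and> jet_deriv U T j G (G' j)"
    by (rule jet_class_SucE[OF Suc.prems])
  note G' = spec[OF G', THEN conjunct1] spec[OF G', THEN conjunct2]
  show ?case
    by (intro G' jet_class_SucI[where G' = G'] jet_class_continuous[OF Suc.prems] Suc.IH)
qed simp

section \<open>Closure properties of the jet classes\<close>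

lemma jet_class_const: "jet_class k U T (\<lambda>_. c)"
proof (induction k arbitrary: c)
  case (Suc k)
  show ?case
    by (rule jet_class_SucI[where G' = "\<lambda>_ _. 0", OF _ Suc.IH])
      (auto intro!: jet_derivI has_dir_derivative_const)
qed simp

lemma jet_class_fixed:
  assumes "continuous_on ((U \<times> UNIV) \<times> T) (\<lambda>p. h (snd (fst p)) (snd p))"
  shows "jet_class k U T (\<lambda>p. h (snd (fst p)) (snd p))"
proof (cases k)
  case (Suc l)
  show ?thesis
    unfolding Suc
    by (rule jet_class_SucI[where G' = "\<lambda>_ _. 0", OF assms jet_class_const jet_deriv_fixed])
qed (use assms in simp)

lemma jet_class_time:
  assumes "continuous_on T h"
  shows "jet_class k U T (\<lambda>p. h (snd p))"
  by (rule jet_class_fixed[where h = "\<lambda>_. h"], rule continuous_on_compose2[OF assms])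
    (auto intro!: continuous_on_snd continuous_on_id)

lemma jet_class_direction:
  assumes "continuous_on UNIV L"
  shows "jet_class k U T (\<lambda>p. L (snd (fst p) j))"
proof (rule jet_class_fixed[where h = "\<lambda>y _. L (y j)"], rule continuous_on_compose2[OF assms])
  show "continuous_on ((U \<times> UNIV) \<times> T) (\<lambda>p. snd (fst p) j)"
    by (rule continuous_on_product_then_coordinatewise)
      (intro continuous_on_snd continuous_on_fst continuous_on_id)
qed auto

text \<open>The derivative of \<open>L x\<close> in direction \<open>y j\<close> is
  \<open>L (y j)\<close>, which no longer depends on the base point, so all orders follow at
  once.\<close>

lemma jet_class_base:
  assumes "linear L" "continuous_on UNIV L"
  shows "jet_class k U T (\<lambda>p. L (fst (fst p)))"
proof -
  have c: "continuous_on ((U \<times> UNIV) \<times> T) (\<lambda>p. L (fst (fst p)))"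
    by (rule continuous_on_compose2[OF assms(2)])
      (auto intro!: continuous_on_fst continuous_on_id)
  show ?thesis
  proof (cases k)
    case (Suc l)
    show ?thesis
      unfolding Suc
      by (rule jet_class_SucI[where G' = "\<lambda>j p. L (snd (fst p) j)", OF c jet_class_direction[OF assms(2)]])
        (auto intro!: jet_derivI has_dir_derivative_linear_self[OF assms(1)])
  qed (use c in simp)
qed

lemma jet_class_linear:
  assumes "linear L" "continuous_on UNIV L" "jet_class k U T G"
  shows "jet_class k U T (\<lambda>p. L (G p))"
proof -
  have c: "continuous_on ((U \<times> UNIV) \<times> T) (\<lambda>p. L (G p))" if "jet_class k U T G" for k G
    by (rule continuous_on_compose2[OF assms(2) jet_class_continuous[OF that]]) simp
  show ?thesis
    using assms(3)
  proof (induction k arbitrary: G)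
    case (Suc k)
    obtain G' where G': "\<forall>j. jet_class k U T (G' j) \<and> jet_deriv U T j G (G' j)"
      by (rule jet_class_SucE[OF Suc.prems])
    note G' = spec[OF G', THEN conjunct1] spec[OF G', THEN conjunct2]
    show ?case
      by (intro G' jet_class_SucI[where G' = "\<lambda>j p. L (G' j p)"] c[OF Suc.prems] Suc.IH
          jet_deriv_linear[OF assms(1,2)])
  qed (simp add: c[of 0, simplified])
qed

lemma jet_class_add:
  assumes "jet_class k U T G" "jet_class k U T H"
  shows "jet_class k U T (\<lambda>p. G p + H p)"
  using assms
proof (induction k arbitrary: G H)
  case (Suc k)
  obtain G' where G': "\<forall>j. jet_class k U T (G' j) \<and> jet_deriv U T j G (G' j)"
    by (rule jet_class_SucE[OF Suc.prems(1)])
  note G' = spec[OF G', THEN conjunct1] spec[OF G', THEN conjunct2]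
  obtain H' where H': "\<forall>j. jet_class k U T (H' j) \<and> jet_deriv U T j H (H' j)"
    by (rule jet_class_SucE[OF Suc.prems(2)])
  note H' = spec[OF H', THEN conjunct1] spec[OF H', THEN conjunct2]
  show ?case
    by (intro G' H' jet_class_SucI[where G' = "\<lambda>j p. G' j p + H' j p"] continuous_on_add Suc.IH
        jet_class_continuous[OF Suc.prems(1)] jet_class_continuous[OF Suc.prems(2)] jet_deriv_add)
qed (simp add: continuous_on_add)

lemma jet_class_Pair:
  assumes "jet_class k U T G" "jet_class k U T H"
  shows "jet_class k U T (\<lambda>p. (G p, H p))"
  using assms
proof (induction k arbitrary: G H)
  case (Suc k)
  obtain G' where G': "\<forall>j. jet_class k U T (G' j) \<and> jet_deriv U T j G (G' j)"
    by (rule jet_class_SucE[OF Suc.prems(1)])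
  note G' = spec[OF G', THEN conjunct1] spec[OF G', THEN conjunct2]
  obtain H' where H': "\<forall>j. jet_class k U T (H' j) \<and> jet_deriv U T j H (H' j)"
    by (rule jet_class_SucE[OF Suc.prems(2)])
  note H' = spec[OF H', THEN conjunct1] spec[OF H', THEN conjunct2]
  show ?case
    by (intro G' H' jet_class_SucI[where G' = "\<lambda>j p. (G' j p, H' j p)"] continuous_on_Pair Suc.IH
        jet_class_continuous[OF Suc.prems(1)] jet_class_continuous[OF Suc.prems(2)] jet_deriv_Pair)
qed (simp add: continuous_on_Pair)

lemma jet_class_scaleR:
  fixes G :: "('e::locally_convex_space \<times> (nat \<Rightarrow> 'e)) \<times> 't::topological_space \<Rightarrow> real"
  assumes "jet_class k U T G" "jet_class k U T H"
  shows "jet_class k U T (\<lambda>p. G p *\<^sub>R H p)"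
  using assms
proof (induction k arbitrary: G H)
  case (Suc k)
  obtain G' where G': "\<forall>j. jet_class k U T (G' j) \<and> jet_deriv U T j G (G' j)"
    by (rule jet_class_SucE[OF Suc.prems(1)])
  note G' = spec[OF G', THEN conjunct1] spec[OF G', THEN conjunct2]
  obtain H' where H': "\<forall>j. jet_class k U T (H' j) \<and> jet_deriv U T j H (H' j)"
    by (rule jet_class_SucE[OF Suc.prems(2)])
  note H' = spec[OF H', THEN conjunct1] spec[OF H', THEN conjunct2]
  show ?case
    by (intro G' H' jet_class_SucI[where G' = "\<lambda>j p. G' j p *\<^sub>R H p + G p *\<^sub>R H' j p"]
        continuous_on_scaleR_lcs jet_class_add Suc.IH jet_class_SucD[OF Suc.prems(1)]
        jet_class_SucD[OF Suc.prems(2)] jet_class_continuous[OF Suc.prems(1)]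
        jet_class_continuous[OF Suc.prems(2)] jet_deriv_scaleR)
qed (simp add: continuous_on_scaleR_lcs)

lemma jet_class_sum:
  assumes "\<And>i. i \<in> I \<Longrightarrow> jet_class k U T (G i)"
  shows "jet_class k U T (\<lambda>p. \<Sum>i\<in>I. G i p)"
  using assms
  by (induction I rule: infinite_finite_induct) (auto intro!: jet_class_add jet_class_const)

text \<open>By the chain rule the derivative is a sum of terms of the same shape, with
  \<open>D m\<close> or \<open>D (Suc m)\<close> and an updated family of arguments. The induction
  therefore runs over all \<open>m\<close> and \<open>v\<close>; since tuples have infinitely many
  entries, raising \<open>m\<close> does not change their type.\<close>

lemma (in jet_tower) jet_class_comp:
  fixes \<phi> :: "('e::locally_convex_space \<times> (nat \<Rightarrow> 'e)) \<times> 't::topological_space \<Rightarrow> 'a"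
  assumes "jet_class k U T \<phi>" "\<And>i. jet_class k U T (v i)"
    and \<phi>V: "\<And>p. p \<in> (U \<times> UNIV) \<times> T \<Longrightarrow> \<phi> p \<in> V"
  shows "jet_class k U T (\<lambda>p. D m (\<phi> p, \<lambda>i. v i p))"
  using assms(1,2)
proof (induction k arbitrary: m v)
  case 0
  then show ?case
    by (simp add: cont_D continuous_on_coordinatewise_then_product \<phi>V)
next
  case (Suc k)
  have cont: "continuous_on ((U \<times> UNIV) \<times> T) (\<lambda>p. D m (\<phi> p, \<lambda>i. v i p))"
    by (intro cont_D continuous_on_coordinatewise_then_product \<phi>V
        jet_class_continuous[OF Suc.prems(1)] jet_class_continuous[OF Suc.prems(2)])
  obtain \<phi>' where \<phi>': "\<forall>j. jet_class k U T (\<phi>' j) \<and> jet_deriv U T j \<phi> (\<phi>' j)"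
    by (rule jet_class_SucE[OF Suc.prems(1)])
  note \<phi>' = spec[OF \<phi>', THEN conjunct1] spec[OF \<phi>', THEN conjunct2]
  have "\<exists>G'. \<forall>j. jet_class k U T (G' j) \<and> jet_deriv U T j (v i) (G' j)" for i
  proof -
    obtain G' where G': "\<forall>j. jet_class k U T (G' j) \<and> jet_deriv U T j (v i) (G' j)"
      by (rule jet_class_SucE[OF Suc.prems(2)])
    note G' = spec[OF G', THEN conjunct1] spec[OF G', THEN conjunct2]
    show ?thesis by (intro exI[of _ G'] allI conjI G')
  qed
  then have "\<forall>i. \<exists>G'. \<forall>j. jet_class k U T (G' j) \<and> jet_deriv U T j (v i) (G' j)" ..
  from choice[OF this] obtain v' where
    v'': "\<forall>i j. jet_class k U T (v' i j) \<and> jet_deriv U T j (v i) (v' i j)" ..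
  then have v': "jet_class k U T (v' i j)" "jet_deriv U T j (v i) (v' i j)" for i j
    by simp_all
  \<comment> \<open>Updating the evaluated tuple amounts to evaluating the updated family, and it is
    families that the induction hypothesis speaks of.\<close>
  have upd: "(\<lambda>i. v i p)(l := w p) = (\<lambda>i. (v(l := w)) i p)" for l w p
    by auto
  define H where "H j p = D (Suc m) (\<phi> p, (\<lambda>i. v i p)(m := \<phi>' j p)) +
    (\<Sum>i<m. D m (\<phi> p, (\<lambda>i. v i p)(i := v' i j p)))" for j p
  have v_upd: "jet_class k U T ((v(l := w)) i)" if "jet_class k U T w" for l w i
    using that jet_class_SucD[OF Suc.prems(2)] by (cases "i = l") auto
  have H: "jet_class k U T (H j)" for j
    unfolding H_def upd
    by (intro jet_class_add jet_class_sum Suc.IH[OF jet_class_SucD[OF Suc.prems(1)]] v_upd \<phi>' v')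
  have "jet_deriv U T j (\<lambda>p. D m (\<phi> p, \<lambda>i. v i p)) (H j)" for j
  proof (rule jet_derivI)
    fix x y t assume x: "x \<in> interior U" and t: "t \<in> T"
    show "has_dir_derivative (\<lambda>z. D m (\<phi> ((z, y), t), \<lambda>i. v i ((z, y), t))) (H j ((x, y), t)) x (y j)"
      unfolding H_def
    proof (rule has_dir_derivative_comp[OF open_interior x])
      show "\<phi> ((z, y), t) \<in> V" if "z \<in> interior U" for z
        using that t interior_subset by (intro \<phi>V) auto
      show "has_dir_derivative (\<lambda>z. \<phi> ((z, y), t)) (\<phi>' j ((x, y), t)) x (y j)"
        by (rule jet_derivD[OF \<phi>'(2) x t])
      show "has_dir_derivative (\<lambda>z. v i ((z, y), t)) (v' i j ((x, y), t)) x (y j)" for i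
        by (rule jet_derivD[OF v'(2) x t])
    qed
  qed
  from jet_class_SucI[OF cont H this] show ?case .
qed


section \<open>Linear Volterra equations\<close>

text \<open>The affine map \<open>z \<mapsto> b + A z\<close> with the matrix given by its columns
  \<open>A i\<close>. With columns instead of operators, the coefficients take values in the same
  space as the solution, and the rules for \<open>jet_class\<close> apply to them directly.\<close>

definition affine_rhs :: "'b::euclidean_space \<Rightarrow> ('b \<Rightarrow> 'b) \<Rightarrow> 'b \<Rightarrow> 'b" where
  "affine_rhs b A z = b + (\<Sum>i\<in>Basis. (z \<bullet> i) *\<^sub>R A i)"

text \<open>The product rule for increments in the arrangement that divided differences call for:
  the change of coefficients acts on the old value \<open>z'\<close>, and what remains is linear in
  the unknown increment \<open>z - z'\<close>.\<close>

lemma affine_rhs_diff: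
  "affine_rhs b A z - affine_rhs b' A' z' =
    affine_rhs (b - b') (\<lambda>i. A i - A' i) z' + (\<Sum>i\<in>Basis. ((z - z') \<bullet> i) *\<^sub>R A i)"
  unfolding affine_rhs_def
  by (simp add: algebra_simps sum_subtractf sum.distrib inner_diff_left)

lemma affine_rhs_scaleR: "c *\<^sub>R affine_rhs b A z = affine_rhs (c *\<^sub>R b) (\<lambda>i. c *\<^sub>R A i) z"
  unfolding affine_rhs_def by (simp add: scaleR_add_right scaleR_right.sum mult.commute)

lemma affine_rhs_lipschitz:
  "norm (affine_rhs b A z - affine_rhs b A z') \<le> (\<Sum>i\<in>Basis. norm (A i)) * norm (z - z')"
proof -
  have "affine_rhs b A z - affine_rhs b A z' = (\<Sum>i\<in>Basis. ((z - z') \<bullet> i) *\<^sub>R A i)"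
    by (simp add: affine_rhs_diff) (simp add: affine_rhs_def)
  also have "norm \<dots> \<le> (\<Sum>i\<in>Basis. norm (A i) * norm (z - z'))"
  proof (rule sum_norm_le)
    fix i :: 'a assume "i \<in> Basis"
    then have "\<bar>(z - z') \<bullet> i\<bar> * norm (A i) \<le> norm (z - z') * norm (A i)"
      by (intro mult_right_mono Basis_le_norm) auto
    then show "norm (((z - z') \<bullet> i) *\<^sub>R A i) \<le> norm (A i) * norm (z - z')"
      by (simp add: mult.commute)
  qed
  finally show ?thesis by (simp add: sum_distrib_right)
qed

lemma continuous_on_affine_rhs:
  assumes "continuous_on S b" "\<And>i. i \<in> Basis \<Longrightarrow> continuous_on S (A i)" "continuous_on S z"
  shows "continuous_on S (\<lambda>x. affine_rhs (b x) (\<lambda>i. A i x) (z x))"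
  unfolding affine_rhs_def
  by (intro continuous_on_add continuous_on_sum continuous_on_scaleR continuous_on_inner
      continuous_on_const assms)

text \<open>At \<open>q\<close> itself compactness of \<open>C\<close> gives a bound; increased by 1
  it holds on a neighbourhood of \<open>q\<close>, over all of \<open>C\<close> at once.\<close>

lemma continuous_on_local_bound:
  fixes h :: "'q::topological_space \<times> 't::topological_space \<Rightarrow> real"
  assumes h: "continuous_on (Q \<times> C) h" and C: "compact C" and q: "q \<in> Q"
  obtains X M where "open X" "q \<in> X" "0 < M" "\<forall>q'\<in>X \<inter> Q. \<forall>s\<in>C. h (q', s) \<le> M"
proof -
  have "continuous_on C (\<lambda>s. (q, s))" by (intro continuous_intros)
  from h this have "continuous_on C (\<lambda>s. h (q, s))"
    by (rule continuous_on_compose_eq) (use q in auto)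
  then have "bounded ((\<lambda>s. h (q, s)) ` C)"
    using C by (intro compact_imp_bounded compact_continuous_image)
  then obtain B where "\<forall>v \<in> (\<lambda>s. h (q, s)) ` C. norm v \<le> B"
    unfolding bounded_iff ..
  then have B: "h (q, s) \<le> B" if "s \<in> C" for s using that by auto
  obtain X where X: "q \<in> X" "open X" "\<forall>q'\<in>X \<inter> Q. \<forall>t\<in>C. dist (h (q', t)) (h (q, t)) \<le> 1"
    by (rule continuous_on_prod_compactE[OF h C q zero_less_one])
  show thesis
  proof (rule that[OF X(2,1)])
    show "0 < \<bar>B\<bar> + 1" by simp
    show "\<forall>q'\<in>X \<inter> Q. \<forall>s\<in>C. h (q', s) \<le> \<bar>B\<bar> + 1"
    proof (intro ballI)
      fix q' s assume that: "q' \<in> X \<inter> Q" "s \<in> C"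
      have "dist (h (q', s)) (h (q, s)) \<le> 1" using bspec[OF bspec[OF X(3) that(1)] that(2)] .
      then show "h (q', s) \<le> \<bar>B\<bar> + 1" using B[OF that(2)] by (simp add: dist_real_def)
    qed
  qed
qed

lemma volterra_linear_exists:
  fixes c b :: "'q::topological_space \<times> real \<Rightarrow> 'b::euclidean_space"
  assumes c: "continuous_on (Q \<times> {0..1}) c" and b: "continuous_on (Q \<times> {0..1}) b"
    and A: "\<And>i. i \<in> Basis \<Longrightarrow> continuous_on (Q \<times> {0..1}) (A i)"
  obtains w where "continuous_on (Q \<times> {0..1}) w"
    and "\<forall>q\<in>Q. \<forall>t\<in>{0..1}.
      w (q, t) = c (q, t) + integral {0..t} (\<lambda>s. affine_rhs (b (q, s)) (\<lambda>i. A i (q, s)) (w (q, s)))"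
proof -
  have lip: "\<exists>X L. open X \<and> q \<in> X \<and> 0 < L \<and> (\<forall>q'\<in>X \<inter> Q. \<forall>s\<in>{0..1}. \<forall>z z'.
      norm (affine_rhs (b (q', s)) (\<lambda>i. A i (q', s)) z - affine_rhs (b (q', s)) (\<lambda>i. A i (q', s)) z')
      \<le> L * norm (z - z'))" if q: "q \<in> Q" for q
  proof -
    have "continuous_on (Q \<times> {0..1}) (\<lambda>p. \<Sum>i\<in>Basis. norm (A i p))"
      by (intro continuous_on_sum continuous_on_norm A)
    then obtain X L where X: "open X" "q \<in> X" "0 < L"
      "\<forall>q'\<in>X \<inter> Q. \<forall>s\<in>{0..1}. (\<Sum>i\<in>Basis. norm (A i (q', s))) \<le> L"
      by (rule continuous_on_local_bound[OF _ compact_Icc q])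
    have "norm (affine_rhs (b (q', s)) (\<lambda>i. A i (q', s)) z - affine_rhs (b (q', s)) (\<lambda>i. A i (q', s)) z')
      \<le> L * norm (z - z')" if "q' \<in> X \<inter> Q" "s \<in> {0..1}" for q' s z z'
      using bspec[OF bspec[OF X(4) that(1)] that(2)]
      by (intro order_trans[OF affine_rhs_lipschitz] mult_right_mono) auto
    then show ?thesis using X(1-3) by (intro exI[of _ X] exI[of _ L] conjI ballI allI) auto
  qed
  have g: "continuous_on (Q \<times> {0..1} \<times> UNIV)
      (\<lambda>p. affine_rhs (b (fst p, fst (snd p))) (\<lambda>i. A i (fst p, fst (snd p))) (snd (snd p)))"
  proof (rule continuous_on_affine_rhs)
    have pr: "continuous_on (Q \<times> {0..1} \<times> UNIV) (\<lambda>p::'q \<times> real \<times> 'b. (fst p, fst (snd p)))"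
      by (intro continuous_on_Pair continuous_on_fst continuous_on_snd continuous_on_id)
    show "continuous_on (Q \<times> {0..1} \<times> UNIV) (\<lambda>p::'q \<times> real \<times> 'b. b (fst p, fst (snd p)))"
      by (rule continuous_on_compose_eq[OF b pr]) auto
    show "continuous_on (Q \<times> {0..1} \<times> UNIV) (\<lambda>p::'q \<times> real \<times> 'b. A i (fst p, fst (snd p)))"
      if "i \<in> Basis" for i
      by (rule continuous_on_compose_eq[OF A[OF that] pr]) auto
    show "continuous_on (Q \<times> {0..1} \<times> UNIV) (\<lambda>p::'q \<times> real \<times> 'b. snd (snd p))"
      by (intro continuous_on_snd continuous_on_id)
  qed
  obtain w where w: "continuous_on (Q \<times> {0..1}) (\<lambda>(q, t). w q t)"
    and eq: "\<forall>q\<in>Q. \<forall>t\<in>{0..1}.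
      w q t = c (q, t) + integral {0..t} (\<lambda>s. affine_rhs (b (q, s)) (\<lambda>i. A i (q, s)) (w q s))"
  proof (rule volterra_family[where c = "\<lambda>q t. c (q, t)" and Q = Q and
        g = "\<lambda>q s z. affine_rhs (b (q, s)) (\<lambda>i. A i (q, s)) z"])
    show "continuous_on (Q \<times> {0..1}) (\<lambda>(q, t). c (q, t))"
      using c by simp
    show "continuous_on (Q \<times> {0..1} \<times> UNIV) (\<lambda>(q, s, z). affine_rhs (b (q, s)) (\<lambda>i. A i (q, s)) z)"
      using g by (simp add: split_beta)
  qed (rule lip)
  show thesis
    by (rule that[OF w]) (simp only: prod.case, rule eq)
qed

lemma volterra_linear_unique:
  fixes w\<^sub>1 w\<^sub>2 :: "real \<Rightarrow> 'b::euclidean_space"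
  assumes w: "continuous_on {0..1} w\<^sub>1" "continuous_on {0..1} w\<^sub>2"
    and b: "continuous_on {0..1} b" and A: "\<And>i. i \<in> Basis \<Longrightarrow> continuous_on {0..1} (A i)"
    and eq1: "\<And>t. t \<in> {0..1} \<Longrightarrow> w\<^sub>1 t = c t + integral {0..t} (\<lambda>s. affine_rhs (b s) (\<lambda>i. A i s) (w\<^sub>1 s))"
    and eq2: "\<And>t. t \<in> {0..1} \<Longrightarrow> w\<^sub>2 t = c t + integral {0..t} (\<lambda>s. affine_rhs (b s) (\<lambda>i. A i s) (w\<^sub>2 s))"
    and t: "t \<in> {0..1}"
  shows "w\<^sub>1 t = w\<^sub>2 t"
proof -
  have "continuous_on {0..1} (\<lambda>s. \<Sum>i\<in>Basis. norm (A i s))"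
    by (intro continuous_on_sum continuous_on_norm A)
  then have "bounded ((\<lambda>s. \<Sum>i\<in>Basis. norm (A i s)) ` {0..1})"
    by (intro compact_imp_bounded compact_continuous_image) auto
  then obtain B where "\<forall>v \<in> (\<lambda>s. \<Sum>i\<in>Basis. norm (A i s)) ` {0..1}. norm v \<le> B"
    unfolding bounded_iff ..
  then have B: "(\<Sum>i\<in>Basis. norm (A i s)) \<le> \<bar>B\<bar> + 1" if "s \<in> {0..1}" for s
    using that by force
  show ?thesis
  proof (rule volterra_unique[where g = "\<lambda>s. affine_rhs (b s) (\<lambda>i. A i s)" and L = "\<bar>B\<bar> + 1", OF w _ eq1 eq2 _ _ t])
    show "norm (affine_rhs (b s) (\<lambda>i. A i s) z - affine_rhs (b s) (\<lambda>i. A i s) z') \<le> (\<bar>B\<bar> + 1) * norm (z - z')"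
      if "s \<in> {0..1}" for s z z'
      using B[OF that] by (intro order_trans[OF affine_rhs_lipschitz] mult_right_mono) auto
    have "continuous_on ({0..1} \<times> UNIV) (\<lambda>p::real \<times> 'b. affine_rhs (b (fst p)) (\<lambda>i. A i (fst p)) (snd p))"
    proof (rule continuous_on_affine_rhs)
      have f: "continuous_on ({0..1} \<times> UNIV) (\<lambda>p::real \<times> 'b. fst p)" by (intro continuous_intros)
      show "continuous_on ({0..1} \<times> UNIV) (\<lambda>p::real \<times> 'b. b (fst p))"
        by (rule continuous_on_compose_eq[OF b f]) auto
      show "continuous_on ({0..1} \<times> UNIV) (\<lambda>p::real \<times> 'b. A i (fst p))" if "i \<in> Basis" for i
        by (rule continuous_on_compose_eq[OF A[OF that] f]) auto
    qed (intro continuous_intros)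
    then show "continuous_on ({0..1} \<times> UNIV) (\<lambda>(s, z). affine_rhs (b s) (\<lambda>i. A i s) z)"
      by (simp add: split_beta)
  qed auto
qed

text \<open>
  A family of curves whose increments satisfy a linear Volterra equation with coefficients
  continuous up to \<open>e = 0\<close>: so do the difference quotients, which therefore converge by
  continuous dependence on \<open>e\<close>.
\<close>
lemma volterra_quotient_tendsto:
  fixes z :: "real \<Rightarrow> real \<Rightarrow> 'b::euclidean_space"
  assumes r: "0 < r"
    and c: "continuous_on ({-r<..<r} \<times> {0..1}) c" and b: "continuous_on ({-r<..<r} \<times> {0..1}) b"
    and A: "\<And>i. i \<in> Basis \<Longrightarrow> continuous_on ({-r<..<r} \<times> {0..1}) (A i)"
    and z: "\<And>e. e \<in> {-r<..<r} \<Longrightarrow> continuous_on {0..1} (z e)"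
    and eq: "\<And>e t. e \<in> {-r<..<r} \<Longrightarrow> t \<in> {0..1} \<Longrightarrow> z e t - z 0 t = e *\<^sub>R c (e, t) +
      integral {0..t} (\<lambda>s. e *\<^sub>R b (e, s) + (\<Sum>i\<in>Basis. ((z e s - z 0 s) \<bullet> i) *\<^sub>R A i (e, s)))"
    and w: "continuous_on {0..1} w"
    and weq: "\<And>t. t \<in> {0..1} \<Longrightarrow>
      w t = c (0, t) + integral {0..t} (\<lambda>s. affine_rhs (b (0, s)) (\<lambda>i. A i (0, s)) (w s))"
    and t: "t \<in> {0..1}"
  shows "((\<lambda>e. inverse e *\<^sub>R (z e t - z 0 t)) \<longlongrightarrow> w t) (at 0)"
proof -
  \<comment> \<open>Solved for all \<open>e\<close> at once, including \<open>e = 0\<close>, where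
    there is no quotient. Uniqueness identifies \<open>W\<close> with \<open>w\<close> at
    \<open>e = 0\<close> and with the quotient elsewhere, so continuity of \<open>W\<close> in
    \<open>e\<close> is the asserted limit.\<close>
  obtain W where W: "continuous_on ({-r<..<r} \<times> {0..1}) W"
    and Weq': "\<forall>e\<in>{-r<..<r}. \<forall>t\<in>{0..1}.
      W (e, t) = c (e, t) + integral {0..t} (\<lambda>s. affine_rhs (b (e, s)) (\<lambda>i. A i (e, s)) (W (e, s)))"
    by (rule volterra_linear_exists[OF c b A])
  note Weq = bspec[OF bspec[OF Weq']]
  have slice: "continuous_on {0..1} (\<lambda>t. h (e, t))"
    if "continuous_on ({-r<..<r} \<times> {0..1}) h" "e \<in> {-r<..<r}" for h :: "real \<times> real \<Rightarrow> 'b" and e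
  proof -
    have "continuous_on {0..1::real} (\<lambda>t. (e, t))" by (intro continuous_intros)
    from that(1) this show ?thesis by (rule continuous_on_compose_eq) (use that(2) in auto)
  qed
  have zero: "0 \<in> {-r<..<r}" using r by simp
  have W0: "W (0, t) = w t"
    by (rule volterra_linear_unique[where c = "\<lambda>t. c (0, t)" and b = "\<lambda>t. b (0, t)" and
          A = "\<lambda>i t. A i (0, t)", OF slice[OF W zero] w slice[OF b zero] slice[OF A zero]
          Weq[OF zero] weq t])
  have We: "W (e, t) = inverse e *\<^sub>R (z e t - z 0 t)" if e: "e \<in> {-r<..<r}" "e \<noteq> 0" for e
  proof (rule volterra_linear_unique[where c = "\<lambda>t. c (e, t)" and b = "\<lambda>t. b (e, t)" and
        A = "\<lambda>i t. A i (e, t)", OF slice[OF W e(1)] _ slice[OF b e(1)] slice[OF A e(1)]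
        Weq[OF e(1)] _ t])
    show "continuous_on {0..1} (\<lambda>t. inverse e *\<^sub>R (z e t - z 0 t))"
      by (intro continuous_on_scaleR continuous_on_const continuous_on_diff z e zero)
    fix t :: real assume t: "t \<in> {0..1}"
    have "inverse e *\<^sub>R (z e t - z 0 t) = c (e, t) + integral {0..t} (\<lambda>s. inverse e *\<^sub>R
        (e *\<^sub>R b (e, s) + (\<Sum>i\<in>Basis. ((z e s - z 0 s) \<bullet> i) *\<^sub>R A i (e, s))))"
      unfolding eq[OF e(1) t] using e(2) by (subst integral_cmul, subst scaleR_add_right) simp
    also have "(\<lambda>s. inverse e *\<^sub>R
        (e *\<^sub>R b (e, s) + (\<Sum>i\<in>Basis. ((z e s - z 0 s) \<bullet> i) *\<^sub>R A i (e, s)))) =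
      (\<lambda>s. affine_rhs (b (e, s)) (\<lambda>i. A i (e, s)) (inverse e *\<^sub>R (z e s - z 0 s)))"
      using e(2) by (simp add: affine_rhs_def scaleR_add_right scaleR_right.sum fun_eq_iff)
    finally show "inverse e *\<^sub>R (z e t - z 0 t) = c (e, t) + integral {0..t}
      (\<lambda>s. affine_rhs (b (e, s)) (\<lambda>i. A i (e, s)) (inverse e *\<^sub>R (z e s - z 0 s)))" .
  qed
  have "continuous_on {-r<..<r} (\<lambda>e. (e, t))" by (intro continuous_intros)
  from W this have "continuous_on {-r<..<r} (\<lambda>e. W (e, t))"
    by (rule continuous_on_compose_eq) (use t in auto)
  then have "((\<lambda>e. W (e, t)) \<longlongrightarrow> W (0, t)) (at 0)"
    using zero by (simp add: continuous_on_eq_continuous_at isCont_def)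
  then have "((\<lambda>e. W (e, t)) \<longlongrightarrow> w t) (at 0)" unfolding W0 .
  moreover have "\<forall>\<^sub>F e in at 0. W (e, t) = inverse e *\<^sub>R (z e t - z 0 t)"
    unfolding eventually_at using r
    by (intro exI[of _ r]) (auto simp: dist_real_def abs_less_iff intro!: We)
  ultimately show ?thesis by (rule Lim_transform_eventually)
qed

text \<open>Hadamard's lemma: \<open>H (e, t)\<close> is the mean of \<open>G'\<close> over the
  segment from \<open>x\<close> to \<open>x + e *\<^sub>R y j\<close>. Unlike the quotient it is
  defined and continuous at \<open>e = 0\<close>.\<close>

lemma jet_deriv_divided_difference:
  fixes G :: "('e::locally_convex_space \<times> (nat \<Rightarrow> 'e)) \<times> 't::topological_space \<Rightarrow> 'b::euclidean_space"
  assumes G': "jet_deriv U T j G G'" "continuous_on ((U \<times> UNIV) \<times> T) G'"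
    and r: "\<forall>e. \<bar>e\<bar> < r \<longrightarrow> x + e *\<^sub>R y j \<in> interior U"
  obtains H where "continuous_on ({-r<..<r} \<times> T) H"
    and "\<forall>e\<in>{-r<..<r}. \<forall>t\<in>T. G ((x + e *\<^sub>R y j, y), t) - G ((x, y), t) = e *\<^sub>R H (e, t)"
    and "\<forall>t. H (0, t) = G' ((x, y), t)"
proof -
  define H where "H p = integral {0..1} (\<lambda>s. G' ((x + s *\<^sub>R (fst p *\<^sub>R y j), y), snd p))" for p
  have mem: "x + s *\<^sub>R (e *\<^sub>R y j) \<in> interior U" if "e \<in> {-r<..<r}" "s \<in> {0..1}" for e s
  proof -
    have "\<bar>s * e\<bar> \<le> 1 * \<bar>e\<bar>" unfolding abs_mult using that by (intro mult_right_mono) auto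
    moreover have "\<bar>e\<bar> < r" using that by auto
    ultimately show ?thesis using spec[OF r, of "s * e"] by simp
  qed
  have "continuous_on ({-r<..<r} \<times> T) H"
    unfolding H_def
  proof (rule integral_unit_continuous, rule continuous_on_compose_eq[OF G'(2)])
    show "continuous_on (({-r<..<r} \<times> T) \<times> {0..1})
      (\<lambda>q. ((x + snd q *\<^sub>R (fst (fst q) *\<^sub>R y j), y), snd (fst q)))"
      by (intro continuous_intros)
    show "((x + snd q *\<^sub>R (fst (fst q) *\<^sub>R y j), y), snd (fst q)) \<in> (U \<times> UNIV) \<times> T"
      if "q \<in> ({-r<..<r} \<times> T) \<times> {0..1}" for q
      using mem[of "fst (fst q)" "snd q"] that interior_subset[of U] by auto
  qed auto
  moreover have "\<forall>e\<in>{-r<..<r}. \<forall>t\<in>T. G ((x + e *\<^sub>R y j, y), t) - G ((x, y), t) = e *\<^sub>R H (e, t)"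
  proof (intro ballI)
    fix e t assume e: "e \<in> {-r<..<r}" and t: "t \<in> T"
    have "((\<lambda>s. e *\<^sub>R G' ((x + s *\<^sub>R (e *\<^sub>R y j), y), t)) has_integral
      (G ((x + 1 *\<^sub>R (e *\<^sub>R y j), y), t) - G ((x + 0 *\<^sub>R (e *\<^sub>R y j), y), t))) {0..1}"
    proof (rule fundamental_theorem_of_calculus)
      fix s :: real assume s: "s \<in> {0..1}"
      show "((\<lambda>s. G ((x + s *\<^sub>R (e *\<^sub>R y j), y), t)) has_vector_derivative
          e *\<^sub>R G' ((x + s *\<^sub>R (e *\<^sub>R y j), y), t)) (at s within {0..1})"
        by (rule has_dir_derivative_imp_line_derivative[where f = "\<lambda>z. G ((z, y), t)"],
            rule has_dir_derivative_scale_dir, rule jet_derivD[OF G'(1) mem[OF e s] t])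
    qed simp
    from integral_unique[OF this]
    show "G ((x + e *\<^sub>R y j, y), t) - G ((x, y), t) = e *\<^sub>R H (e, t)" by (simp add: H_def)
  qed
  moreover have "\<forall>t. H (0, t) = G' ((x, y), t)" by (simp add: H_def)
  ultimately show thesis by (rule that)
qed

lemma jet_class_affine_rhs:
  assumes "jet_class k U T b" "\<And>i. jet_class k U T (A i)" "jet_class k U T z"
  shows "jet_class k U T (\<lambda>p. affine_rhs (b p) (\<lambda>i. A i p) (z p))"
  unfolding affine_rhs_def
proof (rule jet_class_add[OF assms(1)], rule jet_class_sum, rule jet_class_scaleR[OF _ assms(2)])
  fix i :: 'c
  have "linear (\<lambda>z. z \<bullet> i)" by (rule bounded_linear.linear[OF bounded_linear_inner_left])
  then show "jet_class k U T (\<lambda>p. z p \<bullet> i)"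
    by (rule jet_class_linear[OF _ _ assms(3)]) (intro continuous_intros)
qed

text \<open>Differentiating the equation gives one with the same matrix \<open>A\<close> and a new
  inhomogeneity, formed from the derivatives of the coefficients and from \<open>w\<close> itself.
  The induction hypothesis is used twice: for \<open>w\<close>, which puts this inhomogeneity into
  class \<open>k\<close>, and for the solution \<open>w'\<close> of the differentiated
  equation.\<close>

lemma jet_class_volterra:
  fixes w :: "('e::locally_convex_space \<times> (nat \<Rightarrow> 'e)) \<times> real \<Rightarrow> 'b::euclidean_space"
  assumes "jet_class k U {0..1} c" "jet_class k U {0..1} b" "\<And>i. jet_class k U {0..1} (A i)"
    and "continuous_on ((U \<times> UNIV) \<times> {0..1}) w"
    and "\<And>q t. q \<in> U \<times> UNIV \<Longrightarrow> t \<in> {0..1} \<Longrightarrow>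
      w (q, t) = c (q, t) + integral {0..t} (\<lambda>s. affine_rhs (b (q, s)) (\<lambda>i. A i (q, s)) (w (q, s)))"
  shows "jet_class k U {0..1} w"
  using assms
proof (induction k arbitrary: c b w)
  case (Suc k)
  note cj = Suc.prems(1) and bj = Suc.prems(2) and Aj = Suc.prems(3)
    and w = Suc.prems(4) and weq = Suc.prems(5)
  have wk: "jet_class k U {0..1} w"
    by (rule Suc.IH[OF jet_class_SucD[OF cj] jet_class_SucD[OF bj] jet_class_SucD[OF Aj] w weq])
  obtain c' where c': "\<forall>j. jet_class k U {0..1} (c' j) \<and> jet_deriv U {0..1} j c (c' j)"
    by (rule jet_class_SucE[OF cj])
  obtain b' where b': "\<forall>j. jet_class k U {0..1} (b' j) \<and> jet_deriv U {0..1} j b (b' j)"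
    by (rule jet_class_SucE[OF bj])
  have "\<exists>G'. \<forall>j. jet_class k U {0..1} (G' j) \<and> jet_deriv U {0..1} j (A i) (G' j)" for i
    by (rule jet_class_SucE[OF Aj[of i]]) (rule exI)
  then have "\<forall>i. \<exists>G'. \<forall>j. jet_class k U {0..1} (G' j) \<and> jet_deriv U {0..1} j (A i) (G' j)" ..
  from choice[OF this] obtain A' where
    A': "\<forall>i j. jet_class k U {0..1} (A' i j) \<and> jet_deriv U {0..1} j (A i) (A' i j)" ..
  note c' = spec[OF c', THEN conjunct1] spec[OF c', THEN conjunct2]
    and b' = spec[OF b', THEN conjunct1] spec[OF b', THEN conjunct2]
  have A': "jet_class k U {0..1} (A' i j)" "jet_deriv U {0..1} j (A i) (A' i j)" for i j
    using spec[OF spec[OF A', of i], of j] by simp_all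
  have "\<exists>w'. jet_class k U {0..1} w' \<and> jet_deriv U {0..1} j w w'" for j
  proof -
    define B where "B p = affine_rhs (b' j p) (\<lambda>i. A' i j p) (w p)" for p
    have Bk: "jet_class k U {0..1} B"
      unfolding B_def by (intro jet_class_affine_rhs b' A' wk)
    \<comment> \<open>A candidate for the derivative, defined and continuous for all parameters in
      \<open>U\<close>, boundary included; it is identified with the derivative at interior points
      afterwards.\<close>
    obtain w' where w': "continuous_on ((U \<times> UNIV) \<times> {0..1}) w'"
      and weq'': "\<forall>q\<in>U \<times> UNIV. \<forall>t\<in>{0..1}. w' (q, t) = c' j (q, t) +
        integral {0..t} (\<lambda>s. affine_rhs (B (q, s)) (\<lambda>i. A i (q, s)) (w' (q, s)))"
      by (rule volterra_linear_exists[where A = A, OF jet_class_continuous[OF c'(1)[of j]]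
            jet_class_continuous[OF Bk] jet_class_continuous[OF Aj]])
    note weq' = bspec[OF bspec[OF weq'']]
    have w'k: "jet_class k U {0..1} w'"
      by (rule Suc.IH[OF c'(1) Bk jet_class_SucD[OF Aj] w' weq'])
    have "jet_deriv U {0..1} j w w'"
    proof (rule jet_derivI)
      fix x y and t :: real assume x: "x \<in> interior U" and t: "t \<in> {0..1}"
      obtain r where r: "0 < r" "\<forall>e. \<bar>e\<bar> < r \<longrightarrow> x + e *\<^sub>R y j \<in> interior U"
        by (rule line_in_open_lcs[OF open_interior x])
      define q where "q e = (x + e *\<^sub>R y j, y)" for e :: real
      have q0: "q 0 = (x, y)" by (simp add: q_def)
      have q: "q e \<in> U \<times> UNIV" if "e \<in> {-r<..<r}" for e
        using spec[OF r(2), of e] that interior_subset[of U] by (auto simp: q_def)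
      have q0U: "(x, y) \<in> U \<times> UNIV" using x interior_subset by auto
      \<comment> \<open>\<open>C\<close>, \<open>E\<close> and \<open>F i\<close> are the divided
        differences of \<open>c\<close>, \<open>b\<close> and \<open>A i\<close> along the line,
        continuous up to \<open>e = 0\<close>.\<close>
      obtain C where C: "continuous_on ({-r<..<r} \<times> {0..1}) C"
        "\<forall>e\<in>{-r<..<r}. \<forall>t\<in>{0..1}. c (q e, t) - c ((x, y), t) = e *\<^sub>R C (e, t)"
        "\<forall>t. C (0, t) = c' j ((x, y), t)"
        unfolding q_def
        by (rule jet_deriv_divided_difference[where r = r and x = x and y = y, OF c'(2)[of j] jet_class_continuous[OF c'(1)[of j]] r(2)])
      note C = C(1) bspec[OF bspec[OF C(2)]] spec[OF C(3)]
      obtain E where E: "continuous_on ({-r<..<r} \<times> {0..1}) E"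
        "\<forall>e\<in>{-r<..<r}. \<forall>t\<in>{0..1}. b (q e, t) - b ((x, y), t) = e *\<^sub>R E (e, t)"
        "\<forall>t. E (0, t) = b' j ((x, y), t)"
        unfolding q_def
        by (rule jet_deriv_divided_difference[where r = r and x = x and y = y, OF b'(2)[of j] jet_class_continuous[OF b'(1)[of j]] r(2)])
      note E = E(1) bspec[OF bspec[OF E(2)]] spec[OF E(3)]
      have "\<exists>F. continuous_on ({-r<..<r} \<times> {0..1}) F \<and> (\<forall>e\<in>{-r<..<r}. \<forall>t\<in>{0..1}.
          A i (q e, t) - A i ((x, y), t) = e *\<^sub>R F (e, t)) \<and> (\<forall>t. F (0, t) = A' i j ((x, y), t))" for i
        unfolding q_def
        by (rule jet_deriv_divided_difference[where r = r and x = x and y = y, OF A'(2)[of j i] jet_class_continuous[OF A'(1)[of i j]] r(2)])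
          (intro exI conjI)
      then have "\<forall>i. \<exists>F. continuous_on ({-r<..<r} \<times> {0..1}) F \<and> (\<forall>e\<in>{-r<..<r}. \<forall>t\<in>{0..1}.
          A i (q e, t) - A i ((x, y), t) = e *\<^sub>R F (e, t)) \<and> (\<forall>t. F (0, t) = A' i j ((x, y), t))" ..
      from choice[OF this] obtain F where
        F': "\<forall>i. continuous_on ({-r<..<r} \<times> {0..1}) (F i) \<and> (\<forall>e\<in>{-r<..<r}. \<forall>t\<in>{0..1}.
          A i (q e, t) - A i ((x, y), t) = e *\<^sub>R F i (e, t)) \<and> (\<forall>t. F i (0, t) = A' i j ((x, y), t))" ..
      have F: "continuous_on ({-r<..<r} \<times> {0..1}) (F i)"
        "e \<in> {-r<..<r} \<Longrightarrow> t \<in> {0..1} \<Longrightarrow> A i (q e, t) - A i ((x, y), t) = e *\<^sub>R F i (e, t)"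
        "F i (0, t) = A' i j ((x, y), t)" for i e t
        using spec[OF F', of i] by simp_all
      have curve: "continuous_on {0..1} (\<lambda>t. h (p, t))"
        if "continuous_on ((U \<times> UNIV) \<times> {0..1}) h" "p \<in> U \<times> UNIV"
        for h :: "('e \<times> (nat \<Rightarrow> 'e)) \<times> real \<Rightarrow> 'b" and p
      proof -
        have "continuous_on {0..1::real} (\<lambda>t. (p, t))" by (intro continuous_intros)
        from that(1) this show ?thesis by (rule continuous_on_compose_eq) (use that(2) in auto)
      qed
      have qc: "continuous_on ({-r<..<r} \<times> {0..1}) (\<lambda>p. (q (fst p), snd p :: real))"
        unfolding q_def by (intro continuous_intros)
      have "((\<lambda>e. inverse e *\<^sub>R (w (q e, t) - w (q 0, t))) \<longlongrightarrow> w' ((x, y), t)) (at 0)"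
      proof (rule volterra_quotient_tendsto[where z = "\<lambda>e t. w (q e, t)" and w = "\<lambda>t. w' ((x, y), t)"
            and c = C and b = "\<lambda>p. affine_rhs (E p) (\<lambda>i. F i p) (w ((x, y), snd p))"
            and A = "\<lambda>i p. A i (q (fst p), snd p)", OF r(1) C(1) _ _ _ _ _ _ t])
        show "continuous_on ({-r<..<r} \<times> {0..1}) (\<lambda>p. affine_rhs (E p) (\<lambda>i. F i p) (w ((x, y), snd p)))"
        proof (rule continuous_on_affine_rhs[OF E(1) F(1)])
          have "continuous_on ({-r<..<r} \<times> {0..1}) (\<lambda>p. ((x, y), snd p :: real))"
            by (intro continuous_intros)
          from w this show "continuous_on ({-r<..<r} \<times> {0..1}) (\<lambda>p. w ((x, y), snd p))"
            by (rule continuous_on_compose_eq) (use q0U in auto)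
        qed
        show "continuous_on ({-r<..<r} \<times> {0..1}) (\<lambda>p. A i (q (fst p), snd p))" for i
          by (rule continuous_on_compose_eq[OF jet_class_continuous[OF Aj] qc]) (use q in auto)
        show "continuous_on {0..1} (\<lambda>t. w (q e, t))" if "e \<in> {-r<..<r}" for e
          by (rule curve[OF w q[OF that]])
        show "continuous_on {0..1} (\<lambda>t. w' ((x, y), t))"
          by (rule curve[OF w' q0U])
        show "w' ((x, y), t) = C (0, t) + integral {0..t} (\<lambda>s. affine_rhs
            (affine_rhs (E (0, s)) (\<lambda>i. F i (0, s)) (w ((x, y), snd (0, s))))
            (\<lambda>i. A i (q (fst (0, s)), snd (0, s))) (w' ((x, y), s)))" if "t \<in> {0..1}" for t
          using weq'[OF q0U that] by (simp add: C(3) E(3) F(3) B_def q0)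
        fix e t :: real assume e: "e \<in> {-r<..<r}" and t: "t \<in> {0..1}"
        have rhs: "continuous_on {0..1} (\<lambda>s. affine_rhs (b (p, s)) (\<lambda>i. A i (p, s)) (w (p, s)))"
          if "p \<in> U \<times> UNIV" for p
          by (intro continuous_on_affine_rhs curve that w jet_class_continuous[OF bj] jet_class_continuous[OF Aj])
        have int: "(\<lambda>s. affine_rhs (b (p, s)) (\<lambda>i. A i (p, s)) (w (p, s))) integrable_on {0..t}"
          if "p \<in> U \<times> UNIV" for p
          using t by (intro integrable_continuous_interval continuous_on_subset[OF rhs[OF that]]) auto
        have "w (q e, t) - w ((x, y), t) = (c (q e, t) - c ((x, y), t)) + integral {0..t}
            (\<lambda>s. affine_rhs (b (q e, s)) (\<lambda>i. A i (q e, s)) (w (q e, s)) -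
              affine_rhs (b ((x, y), s)) (\<lambda>i. A i ((x, y), s)) (w ((x, y), s)))"
          unfolding weq[OF q[OF e] t] weq[OF q0U t] integral_diff[OF int[OF q[OF e]] int[OF q0U]]
          by simp
        also have "integral {0..t}
            (\<lambda>s. affine_rhs (b (q e, s)) (\<lambda>i. A i (q e, s)) (w (q e, s)) -
              affine_rhs (b ((x, y), s)) (\<lambda>i. A i ((x, y), s)) (w ((x, y), s))) =
          integral {0..t} (\<lambda>s. e *\<^sub>R affine_rhs (E (e, s)) (\<lambda>i. F i (e, s)) (w ((x, y), s)) +
            (\<Sum>i\<in>Basis. ((w (q e, s) - w ((x, y), s)) \<bullet> i) *\<^sub>R A i (q e, s)))"
        proof (rule integral_cong)
          fix s assume "s \<in> {0..t}"
          then have s: "s \<in> {0..1}" using t by auto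
          show "affine_rhs (b (q e, s)) (\<lambda>i. A i (q e, s)) (w (q e, s)) -
              affine_rhs (b ((x, y), s)) (\<lambda>i. A i ((x, y), s)) (w ((x, y), s)) =
            e *\<^sub>R affine_rhs (E (e, s)) (\<lambda>i. F i (e, s)) (w ((x, y), s)) +
            (\<Sum>i\<in>Basis. ((w (q e, s) - w ((x, y), s)) \<bullet> i) *\<^sub>R A i (q e, s))"
            unfolding affine_rhs_diff affine_rhs_scaleR E(2)[OF e s] F(2)[OF e s] ..
        qed
        finally show "w (q e, t) - w (q 0, t) = e *\<^sub>R C (e, t) + integral {0..t}
            (\<lambda>s. e *\<^sub>R affine_rhs (E (e, s)) (\<lambda>i. F i (e, s)) (w ((x, y), snd (e, s))) +
              (\<Sum>i\<in>Basis. ((w (q e, s) - w (q 0, s)) \<bullet> i) *\<^sub>R A i (q (fst (e, s)), snd (e, s))))"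
          unfolding C(2)[OF e t] q0 fst_conv snd_conv .
      qed
      then show "has_dir_derivative (\<lambda>z. w ((z, y), t)) (w' ((x, y), t)) x (y j)"
        unfolding has_dir_derivative_def q0 unfolding q_def .
    qed
    with w'k show ?thesis by blast
  qed
  then show ?case using w by simp
qed simp


section \<open>The flow over the unit interval\<close>

context jet_tower
begin

definition val :: "'a \<Rightarrow> 'b" where "val z = D 0 (z, \<lambda>_. 0)"

text \<open>At points of \<open>V\<close> every tuple with \<open>v\<close> in slot 0 gives the same
  value, by \<open>indep\<close>. The constant tuple makes continuity in the direction a
  coordinatewise matter.\<close>

definition first :: "'a \<Rightarrow> 'a \<Rightarrow> 'b" where "first z v = D (Suc 0) (z, \<lambda>_. v)"



lemma first_eq: "z \<in> V \<Longrightarrow> D (Suc 0) (z, y(0 := v)) = first z v"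
  unfolding first_def by (rule indep) auto

lemma linear_first: "z \<in> V \<Longrightarrow> linear (first z)"
  using multilinear[of z 0 "Suc 0" "\<lambda>_. 0"] first_eq[of z "\<lambda>_. 0"] by simp

lemma val_diff:
  assumes "a \<in> V" "b \<in> V"
  shows "val b - val a = integral {0..1} (\<lambda>t. first (a + t *\<^sub>R (b - a)) (b - a))"
proof -
  have "val b - val a = integral {0..1} (\<lambda>t. D (Suc 0) (a + t *\<^sub>R (b - a), (\<lambda>_. 0)(0 := b - a)))"
    using ftc[OF assms, of 0 "\<lambda>_. 0"] by (simp only: val_def)
  also have "\<dots> = integral {0..1} (\<lambda>t. first (a + t *\<^sub>R (b - a)) (b - a))"
    by (rule integral_cong, rule first_eq) (use assms convex_V in \<open>auto intro!: convex_segment_mem\<close>)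
  finally show ?thesis .
qed

lemma cont_val:
  assumes "continuous_on S f" "\<And>x. x \<in> S \<Longrightarrow> f x \<in> V"
  shows "continuous_on S (\<lambda>x. val (f x))"
  unfolding val_def by (rule cont_D[OF assms(1) continuous_on_const assms(2)])

lemma cont_first:
  assumes "continuous_on S f" "continuous_on S g" "\<And>x. x \<in> S \<Longrightarrow> f x \<in> V"
  shows "continuous_on S (\<lambda>x. first (f x) (g x))"
  unfolding first_def
  by (rule cont_D[OF assms(1) continuous_on_coordinatewise_then_product assms(3)])
    (rule assms(2))

end

text \<open>
  The solution with parameters \<open>x = (p, t\<^sub>0, t, x\<^sub>0)\<close> is reparametrised over the unit interval by
  \<open>s \<mapsto> t\<^sub>0 + s (t - t\<^sub>0)\<close>. The times \<open>t\<^sub>0\<close> and \<open>t\<close> then become parameters of the equation, on the same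
  footing as \<open>p\<close>, and the flow is the value at \<open>s = 1\<close>.
\<close>
definition seg_len :: "'p \<times> real \<times> real \<times> 'b \<Rightarrow> real" where
  "seg_len x = fst (snd (snd x)) - fst (snd x)"

definition seg_time :: "'p \<times> real \<times> real \<times> 'b \<Rightarrow> real \<Rightarrow> real" where
  "seg_time x s = fst (snd x) + s *\<^sub>R seg_len x"

definition start :: "'p \<times> real \<times> real \<times> 'b \<Rightarrow> 'b" where
  "start x = snd (snd (snd x))"

text \<open>Linear in \<open>(x, z)\<close> for fixed \<open>s\<close>. Hence
  \<open>seg_point d s 0\<close> is also the derivative of this point in the parameter direction
  \<open>d\<close> with \<open>z\<close> held fixed.\<close>

definition seg_point :: "'p \<times> real \<times> real \<times> 'b \<Rightarrow> real \<Rightarrow> 'c \<Rightarrow> 'p \<times> real \<times> 'c" where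
  "seg_point x s z = (fst x, seg_time x s, z)"

section \<open>The projected field and its solution\<close>

locale vanishing_field = jet_tower "P \<times> J \<times> K" D
  for P :: "'f::locally_convex_space set" and J :: "real set" and K :: "'b::euclidean_space set"
    and D :: "nat \<Rightarrow> ('f \<times> real \<times> 'b) \<times> (nat \<Rightarrow> 'f \<times> real \<times> 'b) \<Rightarrow> 'b" +
  assumes convex_J: "convex J" and compact_K: "compact K" and convex_K: "convex K"
    and interior_K: "interior K \<noteq> {}"
    and boundary: "\<And>p t x. p \<in> P \<Longrightarrow> t \<in> J \<Longrightarrow> x \<in> frontier K \<Longrightarrow> val (p, t, x) = 0"
begin

abbreviation "X \<equiv> P \<times> J \<times> J \<times> K"
abbreviation "proj \<equiv> closest_point K"

lemma closed_K: "closed K"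
  by (rule compact_imp_closed[OF compact_K])

lemma K_nonempty: "K \<noteq> {}"
  using interior_K interior_subset[of K] by auto

lemma proj_in: "proj z \<in> K"
  by (rule closest_point_in_set[OF closed_K K_nonempty])

text \<open>The nearest point lies on the relative boundary; since \<open>K\<close> has interior
  points, its affine hull is the whole space and the two notions of boundary agree.\<close>

lemma proj_frontier:
  assumes "z \<notin> K"
  shows "proj z \<in> frontier K"
proof -
  have "z \<in> affine hull K - rel_interior K"
    using assms interior_K interior_subset[of K]
    by (auto simp: affine_hull_nonempty_interior rel_interior_nonempty_interior)
  then have "proj z \<in> rel_frontier K"
    by (rule closest_point_in_rel_frontier[OF closed_K K_nonempty])
  then show ?thesis
    using interior_K by (simp add: rel_frontier_nonempty_interior)
qed

lemma seg_time_in: "x \<in> X \<Longrightarrow> s \<in> {0..1} \<Longrightarrow> seg_time x s \<in> J"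
  unfolding seg_time_def seg_len_def by (rule convex_segment_mem[OF convex_J]) auto

lemma seg_point_in: "x \<in> X \<Longrightarrow> s \<in> {0..1} \<Longrightarrow> z \<in> K \<Longrightarrow> seg_point x s z \<in> P \<times> J \<times> K"
  unfolding seg_point_def using seg_time_in[of x s] by auto

text \<open>The part \<open>(q, r)\<close> of the direction becomes an inhomogeneity, the part
  \<open>w\<close> is multiplied by the matrix of partial derivatives. This brings the linearised
  equation into the form of an \<open>affine_rhs\<close>.\<close>

lemma first_affine:
  assumes "z \<in> P \<times> J \<times> K"
  shows "first z (q, r, w) = affine_rhs (first z (q, r, 0)) (\<lambda>i. first z (0, 0, i)) w"
proof -
  have lin: "linear (\<lambda>w. first z (0, 0, w))"
    using linear_first[OF assms]
    by (intro linearI) (simp_all flip: linear_add linear_scale)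
  have "first z (q, r, w) = first z ((q, r, 0) + (0, 0, w))" by simp
  also have "\<dots> = first z (q, r, 0) + first z (0, 0, w)"
    by (rule linear_add[OF linear_first[OF assms]])
  also have "first z (0, 0, w) = first z (0, 0, \<Sum>i\<in>Basis. (w \<bullet> i) *\<^sub>R i)"
    by (simp only: euclidean_representation)
  also have "\<dots> = (\<Sum>i\<in>Basis. (w \<bullet> i) *\<^sub>R first z (0, 0, i))"
    unfolding linear_sum[OF lin] linear_scale[OF lin] ..
  finally show ?thesis unfolding affine_rhs_def .
qed

lemma seg_continuous [continuous_intros]:
  assumes "continuous_on S g"
  shows "continuous_on S (\<lambda>q. seg_len (g q))" "continuous_on S (\<lambda>q. start (g q))"
  unfolding seg_len_def start_def
  by (intro continuous_on_diff continuous_on_fst continuous_on_snd assms)+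

lemma seg_point_continuous:
  assumes "continuous_on S g" "continuous_on S h" "continuous_on S k"
  shows "continuous_on S (\<lambda>q. seg_point (g q) (h q) (k q))"
  unfolding seg_point_def seg_time_def
  by (intro continuous_on_Pair continuous_on_add continuous_on_scaleR seg_continuous
      continuous_on_fst continuous_on_snd assms)

text \<open>The segment between two projected points lies in \<open>K\<close>, and \<open>p\<close>
  and the time are constant along it, so only derivatives in \<real>^n directions enter. These are
  bounded near \<open>q\<close> by compactness of \<open>[0,1] \<times> K\<close>, and the
  projection does not increase distances.\<close>

lemma rhs_lipschitz:
  assumes q: "q \<in> X"
  shows "\<exists>Y L. open Y \<and> q \<in> Y \<and> 0 < L \<and> (\<forall>q'\<in>Y \<inter> X. \<forall>s\<in>{0..1}. \<forall>z z'.
    norm (seg_len q' *\<^sub>R val (seg_point q' s (proj z)) - seg_len q' *\<^sub>R val (seg_point q' s (proj z')))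
    \<le> L * norm (z - z'))"
proof -
  define h where "h r = \<bar>seg_len (fst r)\<bar> *
    (\<Sum>i\<in>Basis. norm (first (seg_point (fst r) (fst (snd r)) (snd (snd r))) (0, 0, i)))"
    for r :: "('f \<times> real \<times> real \<times> 'b) \<times> real \<times> 'b"
  have "continuous_on (X \<times> {0..1} \<times> K) h"
    unfolding h_def
    by (intro continuous_on_mult continuous_on_rabs seg_continuous continuous_on_sum continuous_on_norm
        cont_first seg_point_continuous continuous_on_fst continuous_on_snd continuous_on_id
        continuous_on_const) (auto intro!: seg_point_in)
  then obtain Y L where Y: "open Y" "q \<in> Y" "0 < L" and L: "\<forall>q'\<in>Y \<inter> X. \<forall>r\<in>{0..1} \<times> K. h (q', r) \<le> L"
    by (rule continuous_on_local_bound[OF _ compact_Times[OF compact_Icc compact_K] q])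
  have "norm (seg_len q' *\<^sub>R val (seg_point q' s (proj z)) - seg_len q' *\<^sub>R val (seg_point q' s (proj z')))
    \<le> L * norm (z - z')" if q': "q' \<in> Y \<inter> X" and s: "s \<in> {0..1}" for q' s z z'
  proof -
    define a b where "a = seg_point q' s (proj z')" and "b = seg_point q' s (proj z)"
    have ab: "a \<in> P \<times> J \<times> K" "b \<in> P \<times> J \<times> K"
      unfolding a_def b_def using q' s by (auto intro!: seg_point_in proj_in)
    have ba: "b - a = (0, 0, proj z - proj z')"
      by (simp add: a_def b_def seg_point_def)
    have "norm (seg_len q' *\<^sub>R first (a + t *\<^sub>R (b - a)) (b - a)) \<le> L * norm (proj z - proj z')"
      if t: "t \<in> {0..1}" for t
    proof -
      define c where "c = a + t *\<^sub>R (b - a)"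
      have c: "c \<in> P \<times> J \<times> K"
        unfolding c_def by (rule convex_segment_mem[OF convex_V ab t])
      have "c = seg_point q' s (proj z' + t *\<^sub>R (proj z - proj z'))"
        by (simp add: c_def a_def b_def seg_point_def)
      moreover have "proj z' + t *\<^sub>R (proj z - proj z') \<in> K"
        by (rule convex_segment_mem[OF convex_K proj_in proj_in t])
      ultimately have "\<bar>seg_len q'\<bar> * (\<Sum>i\<in>Basis. norm (first c (0, 0, i))) \<le> L"
        using bspec[OF bspec[OF L q'], of "(s, proj z' + t *\<^sub>R (proj z - proj z'))"] s by (simp add: h_def)
      moreover have "first c (0, 0, 0) = 0"
        using linear_0[OF linear_first[OF c]] by (simp add: zero_prod_def)
      then have "norm (first c (b - a)) \<le> (\<Sum>i\<in>Basis. norm (first c (0, 0, i))) * norm (proj z - proj z')"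
        unfolding ba first_affine[OF c, of 0 0 "proj z - proj z'"]
        using affine_rhs_lipschitz[of 0 "\<lambda>i. first c (0, 0, i)" "proj z - proj z'" 0]
        by (simp add: affine_rhs_def)
      then have "\<bar>seg_len q'\<bar> * norm (first c (b - a)) \<le>
          \<bar>seg_len q'\<bar> * (\<Sum>i\<in>Basis. norm (first c (0, 0, i))) * norm (proj z - proj z')"
        by (simp add: mult.assoc mult_left_mono)
      ultimately show ?thesis
        unfolding c_def[symmetric]
        by (simp only: norm_scaleR) (meson mult_right_mono norm_ge_zero order_trans)
    qed
    note bound = this
    have "norm (integral {0..1} (\<lambda>t. seg_len q' *\<^sub>R first (a + t *\<^sub>R (b - a)) (b - a)))
      \<le> integral {0..1} (\<lambda>t::real. L * norm (proj z - proj z'))"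
    proof (rule integral_norm_bound_integral)
      show "(\<lambda>t. seg_len q' *\<^sub>R first (a + t *\<^sub>R (b - a)) (b - a)) integrable_on {0..1}"
        by (intro integrable_continuous_interval continuous_on_scaleR cont_first continuous_intros
            convex_segment_mem convex_V ab)
    qed (use bound in auto)
    then have "norm (seg_len q' *\<^sub>R (val b - val a)) \<le> L * norm (proj z - proj z')"
      unfolding val_diff[OF ab] by simp
    also have "\<dots> \<le> L * norm (z - z')"
      using closest_point_lipschitz[OF convex_K closed_K K_nonempty, of z z'] Y(3)
      by (intro mult_left_mono) (auto simp: dist_norm)
    finally show ?thesis by (simp add: a_def b_def scaleR_diff_right)
  qed
  then show ?thesis using Y by (intro exI[of _ Y] exI[of _ L] conjI ballI allI)
qed

lemma rhs_continuous:
  "continuous_on (X \<times> {0..1} \<times> UNIV) (\<lambda>(q, s, z). seg_len q *\<^sub>R val (seg_point q s (proj z)))"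
  unfolding split_beta
  by (intro continuous_on_scaleR seg_continuous cont_val seg_point_continuous continuous_on_fst
      continuous_on_snd continuous_on_id continuous_on_compose2[OF continuous_on_closest_point[OF convex_K closed_K K_nonempty]])
    (auto intro!: seg_point_in proj_in)

definition proj_solution where
  "proj_solution u \<longleftrightarrow> continuous_on (X \<times> {0..1}) u \<and> (\<forall>x\<in>X. \<forall>t\<in>{0..1}.
    u (x, t) = start x + integral {0..t} (\<lambda>s. seg_len x *\<^sub>R val (seg_point x s (proj (u (x, s))))))"

definition u :: "('f \<times> real \<times> real \<times> 'b) \<times> real \<Rightarrow> 'b" where
  "u = (SOME u. proj_solution u)"

lemma proj_solution_u: "proj_solution u"
proof -
  have start: "continuous_on (X \<times> {0..1::real}) (\<lambda>(x, t). start x)"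
    unfolding split_beta by (intro seg_continuous continuous_on_fst continuous_on_id)
  obtain v where v: "continuous_on (X \<times> {0..1}) (\<lambda>(q, t). v q t)"
    and eq: "\<forall>q\<in>X. \<forall>t\<in>{0..1}. v q t = start q +
      integral {0..t} (\<lambda>s. seg_len q *\<^sub>R val (seg_point q s (proj (v q s))))"
    by (rule volterra_family[where Q = X and c = "\<lambda>q _. start q" and
          g = "\<lambda>q s z. seg_len q *\<^sub>R val (seg_point q s (proj z))", OF start rhs_continuous rhs_lipschitz])
  have "proj_solution (\<lambda>(q, t). v q t)"
    unfolding proj_solution_def using v eq by simp
  then show ?thesis unfolding u_def by (rule someI[of proj_solution])
qed

lemma u_continuous: "continuous_on (X \<times> {0..1}) u"
  using proj_solution_u unfolding proj_solution_def by (rule conjunct1)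

lemma u_proj_eq:
  assumes "x \<in> X" "t \<in> {0..1}"
  shows "u (x, t) = start x + integral {0..t} (\<lambda>s. seg_len x *\<^sub>R val (seg_point x s (proj (u (x, s)))))"
  using proj_solution_u assms unfolding proj_solution_def by (elim conjE) (drule bspec, assumption, rule bspec)

lemma u_curve: "x \<in> X \<Longrightarrow> continuous_on {0..1} (\<lambda>t. u (x, t))"
proof -
  assume x: "x \<in> X"
  have "continuous_on {0..1::real} (\<lambda>t. (x, t))" by (intro continuous_intros)
  from u_continuous this show ?thesis by (rule continuous_on_compose_eq) (use x in auto)
qed

lemma rhs_curve:
  assumes "x \<in> X" "continuous_on {0..1} v"
  shows "continuous_on {0..1} (\<lambda>s. seg_len x *\<^sub>R val (seg_point x s (proj (v s))))"
proof -
  have "continuous_on {0..1::real} (\<lambda>s. (x, s, v s))" by (intro continuous_intros assms)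
  from rhs_continuous this show ?thesis by (rule continuous_on_compose_eq) (use assms in auto)
qed

text \<open>
  The projected field vanishes off \<open>K\<close>, so a solution is constant after the last time it is in \<open>K\<close>.
\<close>
lemma u_in_K:
  assumes x: "x \<in> X" and t: "t \<in> {0..1}"
  shows "u (x, t) \<in> K"
proof (rule ccontr)
  assume out: "u (x, t) \<notin> K"
  define g where "g s = seg_len x *\<^sub>R val (seg_point x s (proj (u (x, s))))" for s
  have g: "g integrable_on {a..b}" if "{a..b} \<subseteq> {0..1}" for a b
    unfolding g_def
    by (intro integrable_continuous_interval continuous_on_subset[OF rhs_curve[OF x u_curve[OF x]] that])
  have "u (x, 0) \<in> K" using u_proj_eq[OF x, of 0] x by (auto simp: start_def)
  define S where "S = {s \<in> {0..t}. u (x, s) \<in> K}"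
  have "continuous_on {0..t} (\<lambda>s. u (x, s))"
    by (rule continuous_on_subset[OF u_curve[OF x]]) (use t in auto)
  then have "closed ({0..t} \<inter> (\<lambda>s. u (x, s)) -` K)"
    by (rule continuous_closed_preimage[OF _ closed_atLeastAtMost closed_K])
  moreover have "{0..t} \<inter> (\<lambda>s. u (x, s)) -` K = S" by (auto simp: S_def)
  moreover have "bounded S" by (rule bounded_subset[of "{0..t}"]) (auto simp: S_def)
  ultimately have "compact S" by (simp add: compact_eq_bounded_closed)
  moreover have "0 \<in> S" using \<open>u (x, 0) \<in> K\<close> t by (simp add: S_def)
  ultimately obtain r where r: "r \<in> S" "\<And>s. s \<in> S \<Longrightarrow> s \<le> r"
    using compact_attains_sup[of S] by auto
  have r01: "0 \<le> r" "r \<le> t" using r(1) by (auto simp: S_def)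
  \<comment> \<open>At time \<open>r\<close> the curve is still in \<open>K\<close> and the field
    may be non-zero; this single time is discarded below as a null set.\<close>
  have zero: "g s = 0" if "s \<in> {r..t} - {r}" for s
  proof -
    have "s \<notin> S" using r(2)[of s] that by force
    then have "u (x, s) \<notin> K" using that r01 by (simp add: S_def)
    moreover have "s \<in> {0..1}" using that r01 t by auto
    ultimately show ?thesis
      unfolding g_def seg_point_def using x seg_time_in[OF x]
      by (auto simp: boundary proj_frontier)
  qed
  have "integral {r..t} g = integral {r..t} (\<lambda>_. 0)"
    by (rule integral_spike[of "{r}"]) (use zero in auto)
  moreover have "integral {0..r} g + integral {r..t} g = integral {0..t} g"
    by (rule Henstock_Kurzweil_Integration.integral_combine) (use r01 t in \<open>auto intro!: g\<close>)
  moreover have "r \<in> {0..1}" using r01 t by auto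
  ultimately have "u (x, t) = u (x, r)"
    unfolding u_proj_eq[OF x t] using u_proj_eq[OF x, of r] by (simp flip: g_def)
  then show False using r(1) out by (simp add: S_def)
qed

text \<open>As the solution remains in \<open>K\<close>, the projection drops out, and what is left
  can be differentiated.\<close>

lemma u_eq:
  assumes x: "x \<in> X" and t: "t \<in> {0..1}"
  shows "u (x, t) = start x + integral {0..t} (\<lambda>s. seg_len x *\<^sub>R val (seg_point x s (u (x, s))))"
proof -
  have "integral {0..t} (\<lambda>s. seg_len x *\<^sub>R val (seg_point x s (proj (u (x, s))))) =
      integral {0..t} (\<lambda>s. seg_len x *\<^sub>R val (seg_point x s (u (x, s))))"
    using t by (intro integral_cong) (auto simp: closest_point_self u_in_K[OF x])
  then show ?thesis using u_proj_eq[OF x t] by simp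
qed

text \<open>A solution with values in \<open>K\<close> also solves the projected equation, whose
  right-hand side is Lipschitz on the whole space.\<close>

lemma u_unique:
  assumes x: "x \<in> X" and v: "continuous_on {0..1} v" and vK: "\<And>s. s \<in> {0..1} \<Longrightarrow> v s \<in> K"
    and eq: "\<And>t. t \<in> {0..1} \<Longrightarrow> v t = start x + integral {0..t} (\<lambda>s. seg_len x *\<^sub>R val (seg_point x s (v s)))"
    and t: "t \<in> {0..1}"
  shows "v t = u (x, t)"
proof -
  obtain Y L where Y: "x \<in> Y" "0 < L" and L: "\<forall>q'\<in>Y \<inter> X. \<forall>s\<in>{0..1}. \<forall>z z'.
    norm (seg_len q' *\<^sub>R val (seg_point q' s (proj z)) - seg_len q' *\<^sub>R val (seg_point q' s (proj z')))
    \<le> L * norm (z - z')"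
    using rhs_lipschitz[OF x] by (elim exE conjE)
  show ?thesis
  proof (rule volterra_unique[where g = "\<lambda>s z. seg_len x *\<^sub>R val (seg_point x s (proj z))",
        OF v u_curve[OF x] _ _ u_proj_eq[OF x] _ Y(2) t])
    have "continuous_on ({0..1} \<times> UNIV) (\<lambda>p::real \<times> 'b. (x, p))" by (intro continuous_intros)
    from rhs_continuous this
    show "continuous_on ({0..1} \<times> UNIV) (\<lambda>(s, z). seg_len x *\<^sub>R val (seg_point x s (proj z)))"
      by (rule continuous_on_compose_eq) (use x in auto)
    show "norm (seg_len x *\<^sub>R val (seg_point x s (proj z)) - seg_len x *\<^sub>R val (seg_point x s (proj z')))
      \<le> L * norm (z - z')" if "s \<in> {0..1}" for s z z'
      using bspec[OF L, of x] x Y(1) that by simp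
    fix t :: real assume t: "t \<in> {0..1}"
    have proj: "integral {0..t} (\<lambda>s. seg_len x *\<^sub>R val (seg_point x s (proj (v s)))) =
        integral {0..t} (\<lambda>s. seg_len x *\<^sub>R val (seg_point x s (v s)))"
      using t by (intro integral_cong) (auto simp: closest_point_self vK)
    show "v t = start x + integral {0..t} (\<lambda>s. seg_len x *\<^sub>R val (seg_point x s (proj (v s))))"
      unfolding proj by (rule eq[OF t])
  qed
qed

end


section \<open>Differentiating the solution with respect to its parameters\<close>

lemma linear_seg_len: "linear (seg_len :: 'p::real_vector \<times> real \<times> real \<times> 'b::real_vector \<Rightarrow> real)"
  by (intro linearI) (auto simp: seg_len_def algebra_simps)

lemma seg_len_line: "seg_len (x + e *\<^sub>R y) = seg_len x + e *\<^sub>R seg_len y"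
  by (simp add: linear_add[OF linear_seg_len] linear_scale[OF linear_seg_len])

lemma seg_time_line: "seg_time (x + e *\<^sub>R y) s = seg_time x s + e *\<^sub>R seg_time y s"
  unfolding seg_time_def seg_len_line by (simp add: algebra_simps)

lemma start_line: "start (x + e *\<^sub>R y) = start x + e *\<^sub>R start y"
  by (simp add: start_def)

lemma jet_class_seg_time:
  fixes U :: "('p::locally_convex_space \<times> real \<times> real \<times> 'b::locally_convex_space) set" and T :: "real set"
  shows "jet_class k U T (\<lambda>p. seg_time (fst (fst p)) (snd p))"
    and "jet_class k U T (\<lambda>p. seg_time (snd (fst p) j) (snd p))"
proof -
  have t0: "linear (\<lambda>x::'p \<times> real \<times> real \<times> 'b. fst (snd x))"
      "continuous_on UNIV (\<lambda>x::'p \<times> real \<times> real \<times> 'b. fst (snd x))"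
    by (auto intro!: linearI continuous_on_fst continuous_on_snd continuous_on_id)
  have len: "continuous_on UNIV (seg_len :: 'p \<times> real \<times> real \<times> 'b \<Rightarrow> real)"
    unfolding seg_len_def by (intro continuous_on_diff continuous_on_fst continuous_on_snd continuous_on_id)
  show "jet_class k U T (\<lambda>p. seg_time (fst (fst p)) (snd p))"
    unfolding seg_time_def
    by (rule jet_class_add[OF jet_class_base[OF t0] jet_class_scaleR[OF jet_class_time[OF continuous_on_id]
            jet_class_base[OF linear_seg_len len]]])
  show "jet_class k U T (\<lambda>p. seg_time (snd (fst p) j) (snd p))"
    unfolding seg_time_def
    by (rule jet_class_add[OF jet_class_direction[OF t0(2)] jet_class_scaleR[OF jet_class_time[OF continuous_on_id]
            jet_class_direction[OF len]]])
qed

context vanishing_field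
begin

abbreviation "curve p \<equiv> seg_point (fst (fst p)) (snd p) (u (fst (fst p), snd p))"

lemma curve_in: "p \<in> (X \<times> UNIV) \<times> {0..1} \<Longrightarrow> curve p \<in> P \<times> J \<times> K"
  by (auto intro!: seg_point_in u_in_K)

lemma eq_curve:
  assumes "x \<in> X"
  shows "continuous_on {0..1} (\<lambda>s. seg_len x *\<^sub>R val (seg_point x s (u (x, s))))"
  by (intro continuous_on_scaleR continuous_on_const cont_val seg_point_continuous u_curve
      continuous_on_id assms seg_point_in u_in_K)

text \<open>The increments of \<open>u\<close> satisfy a linear equation, by Hadamard's lemma for \<open>val\<close>.\<close>
lemma u_quotient_tendsto:
  assumes x: "x \<in> interior X"
    and w: "continuous_on {0..1} w"
    and weq: "\<And>t. t \<in> {0..1} \<Longrightarrow> w t = start d + integral {0..t} (\<lambda>s. affine_rhs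
      (seg_len d *\<^sub>R val (seg_point x s (u (x, s))) +
        seg_len x *\<^sub>R first (seg_point x s (u (x, s))) (seg_point d s 0))
      (\<lambda>i. seg_len x *\<^sub>R first (seg_point x s (u (x, s))) (0, 0, i)) (w s))"
    and t: "t \<in> {0..1}"
  shows "has_dir_derivative (\<lambda>z. u (z, t)) (w t) x d"
proof -
  obtain r where r: "0 < r" and rX: "\<forall>e. \<bar>e\<bar> < r \<longrightarrow> x + e *\<^sub>R d \<in> interior X"
    by (rule line_in_open_lcs[OF open_interior x])
  define q where "q e = x + e *\<^sub>R d" for e :: real
  have q0: "q 0 = x" by (simp add: q_def)
  have zero: "0 \<in> {-r<..<r}" using r by simp
  have q: "q e \<in> X" if "e \<in> {-r<..<r}" for e
  proof -
    have "\<bar>e\<bar> < r" using that by auto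
    then have "q e \<in> interior X" using rX by (simp add: q_def)
    then show ?thesis using interior_subset by (rule rev_subsetD)
  qed
  \<comment> \<open>The point at which the field is evaluated, at time \<open>s\<close>, along the
    curve with parameter \<open>x + e *\<^sub>R d\<close>.\<close>
  define F where "F e s = seg_point (q e) s (u (q e, s))" for e s
  have FV: "F e s \<in> P \<times> J \<times> K" if "e \<in> {-r<..<r}" "s \<in> {0..1}" for e s
    unfolding F_def by (intro seg_point_in u_in_K q that)
  have Fc: "continuous_on S (\<lambda>p. F (g p) (h p))"
    if "continuous_on S g" "continuous_on S h" "\<And>p. p \<in> S \<Longrightarrow> g p \<in> {-r<..<r}" "\<And>p. p \<in> S \<Longrightarrow> h p \<in> {0..1}"
    for S :: "'s::topological_space set" and g h
  proof -
    have qc: "continuous_on S (\<lambda>p. q (g p))"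
      unfolding q_def by (intro continuous_intros that)
    then have "continuous_on S (\<lambda>p. (q (g p), h p))"
      by (intro continuous_on_Pair that)
    from u_continuous this have "continuous_on S (\<lambda>p. u (q (g p), h p))"
      by (rule continuous_on_compose_eq) (use q that in auto)
    then show ?thesis
      unfolding F_def by (intro seg_point_continuous qc that)
  qed
  define c where "c e s \<theta> = F 0 s + \<theta> *\<^sub>R (F e s - F 0 s)" for e s \<theta>
  have cV: "c e s \<theta> \<in> P \<times> J \<times> K" if "e \<in> {-r<..<r}" "s \<in> {0..1}" "\<theta> \<in> {0..1}" for e s \<theta>
    unfolding c_def by (intro convex_segment_mem convex_V FV zero that)
  \<comment> \<open>The mean derivative of the field between \<open>F 0 s\<close> and
    \<open>F e s\<close> in direction \<open>v s\<close>; at \<open>e = 0\<close> it is the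
    derivative itself.\<close>
  define I where "I v p = integral {0..1} (\<lambda>\<theta>. first (c (fst p) (snd p) \<theta>) (v (snd p)))" for v p
  have Ic: "continuous_on ({-r<..<r} \<times> {0..1}) (I v)" if v: "continuous_on {0..1} v" for v
    unfolding I_def
  proof (rule integral_unit_continuous)
    let ?S = "({-r<..<r} \<times> {0..1}) \<times> {0..1::real}"
    have "continuous_on ?S (\<lambda>z. v (snd (fst z)))"
      by (rule continuous_on_compose2[OF v])
        (auto intro!: continuous_on_fst continuous_on_snd continuous_on_id)
    moreover have "continuous_on ?S (\<lambda>z. c (fst (fst z)) (snd (fst z)) (snd z))"
      unfolding c_def
      by (intro continuous_on_add continuous_on_scaleR_lcs continuous_on_diff Fc
          continuous_on_fst continuous_on_snd continuous_on_id continuous_on_const)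
        (use zero in auto)
    ultimately have "continuous_on ?S (\<lambda>z. first (c (fst (fst z)) (snd (fst z)) (snd z)) (v (snd (fst z))))"
      by (intro cont_first) (auto intro!: cV)
    then show "continuous_on ?S (\<lambda>(p, \<theta>). first (c (fst p) (snd p) \<theta>) (v (snd p)))"
      by (simp add: split_beta)
  qed
  have dc: "continuous_on {0..1} (\<lambda>s. seg_point d s (0::'b))"
    by (rule seg_point_continuous[OF continuous_on_const continuous_on_id continuous_on_const])
  have I0: "I v (0, s) = first (seg_point x s (u (x, s))) (v s)" for v s
    by (simp add: I_def c_def F_def q0)
  have hadamard: "val (F e s) - val (F 0 s) = e *\<^sub>R I (\<lambda>s. seg_point d s 0) (e, s) +
      (\<Sum>i\<in>Basis. ((u (q e, s) - u (x, s)) \<bullet> i) *\<^sub>R I (\<lambda>_. (0, 0, i)) (e, s))"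
    if e: "e \<in> {-r<..<r}" and s: "s \<in> {0..1}" for e s
  proof -
    \<comment> \<open>The last component of the increment is kept apart: it is the increment of the
      unknown, not a known multiple of \<open>e\<close>, and supplies the linear part of the
      equation.\<close>
    define \<delta> where "\<delta> = u (q e, s) - u (x, s)"
    have diff: "F e s - F 0 s = (e *\<^sub>R fst d, e *\<^sub>R seg_time d s, \<delta>)"
      by (simp add: F_def q_def seg_point_def seg_time_line \<delta>_def)
    have int: "((\<lambda>\<theta>. first (c e s \<theta>) v) has_integral I (\<lambda>_. v) (e, s)) {0..1}" for v
      unfolding I_def fst_conv snd_conv
    proof (rule integrable_integral, rule integrable_continuous_interval, rule cont_first)
      show "continuous_on {0..1} (\<lambda>\<theta>. c e s \<theta>)"
        unfolding c_def by (intro continuous_intros)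
    qed (auto intro!: cV e s)
    have Is: "I (\<lambda>_. seg_point d s 0) (e, s) = I (\<lambda>s. seg_point d s 0) (e, s)"
      by (simp add: I_def)
    have "first (c e s \<theta>) (F e s - F 0 s) = e *\<^sub>R first (c e s \<theta>) (seg_point d s 0) +
        (\<Sum>i\<in>Basis. (\<delta> \<bullet> i) *\<^sub>R first (c e s \<theta>) (0, 0, i))" if "\<theta> \<in> {0..1}" for \<theta>
    proof -
      have "(e *\<^sub>R fst d, e *\<^sub>R seg_time d s, 0 :: 'b) = e *\<^sub>R seg_point d s 0"
        by (simp add: seg_point_def)
      then show ?thesis
        unfolding diff first_affine[OF cV[OF e s that], of "e *\<^sub>R fst d" "e *\<^sub>R seg_time d s" \<delta>]
          affine_rhs_def
        by (simp only: linear_scale[OF linear_first[OF cV[OF e s that]]])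
    qed
    then have "val (F e s) - val (F 0 s) = integral {0..1} (\<lambda>\<theta>. e *\<^sub>R first (c e s \<theta>) (seg_point d s 0) +
        (\<Sum>i\<in>Basis. (\<delta> \<bullet> i) *\<^sub>R first (c e s \<theta>) (0, 0, i)))"
      unfolding val_diff[OF FV[OF zero s] FV[OF e s], folded c_def] by (rule integral_cong)
    also have "\<dots> = e *\<^sub>R I (\<lambda>_. seg_point d s 0) (e, s) +
        (\<Sum>i\<in>Basis. (\<delta> \<bullet> i) *\<^sub>R I (\<lambda>_. (0, 0, i)) (e, s))"
      by (intro integral_unique has_integral_add has_integral_cmul has_integral_sum finite_Basis int)
    finally show ?thesis unfolding Is \<delta>_def .
  qed
  have "((\<lambda>e. inverse e *\<^sub>R (u (q e, t) - u (q 0, t))) \<longlongrightarrow> w t) (at 0)"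
  proof (rule volterra_quotient_tendsto[where z = "\<lambda>e t. u (q e, t)" and c = "\<lambda>_. start d"
        and b = "\<lambda>p. seg_len d *\<^sub>R val (F (fst p) (snd p)) + seg_len x *\<^sub>R I (\<lambda>s. seg_point d s 0) p"
        and A = "\<lambda>i p. seg_len x *\<^sub>R I (\<lambda>_. (0, 0, i)) p", OF r continuous_on_const _ _ _ _ w _ t])
    show "continuous_on ({-r<..<r} \<times> {0..1})
      (\<lambda>p. seg_len d *\<^sub>R val (F (fst p) (snd p)) + seg_len x *\<^sub>R I (\<lambda>s. seg_point d s 0) p)"
      by (intro continuous_on_add continuous_on_scaleR continuous_on_const Ic dc cont_val Fc
          continuous_on_fst continuous_on_snd continuous_on_id) (auto intro!: FV)
    show "continuous_on ({-r<..<r} \<times> {0..1}) (\<lambda>p. seg_len x *\<^sub>R I (\<lambda>_. (0, 0, i)) p)" for i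
      by (intro continuous_on_scaleR continuous_on_const Ic)
    show "continuous_on {0..1} (\<lambda>t. u (q e, t))" if "e \<in> {-r<..<r}" for e
      by (rule u_curve[OF q[OF that]])
    show "w t = start d + integral {0..t} (\<lambda>s. affine_rhs
        (seg_len d *\<^sub>R val (F (fst (0, s)) (snd (0, s))) + seg_len x *\<^sub>R I (\<lambda>s. seg_point d s 0) (0, s))
        (\<lambda>i. seg_len x *\<^sub>R I (\<lambda>_. (0, 0, i)) (0, s)) (w s))" if "t \<in> {0..1}" for t
      unfolding I0 fst_conv snd_conv F_def q0 by (rule weq[OF that])
    fix e t :: real assume e: "e \<in> {-r<..<r}" and t: "t \<in> {0..1}"
    have int: "(\<lambda>s. seg_len (q e) *\<^sub>R val (F e s)) integrable_on {0..t}" if "e \<in> {-r<..<r}" for e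
      unfolding F_def
      by (rule integrable_continuous_interval, rule continuous_on_subset[OF eq_curve[OF q[OF that]]])
        (use t in auto)
    have "u (q e, t) - u (q 0, t) = (start (q e) - start (q 0)) +
        integral {0..t} (\<lambda>s. seg_len (q e) *\<^sub>R val (F e s) - seg_len (q 0) *\<^sub>R val (F 0 s))"
      unfolding u_eq[OF q[OF e] t] u_eq[OF q[OF zero] t] integral_diff[OF int[OF e] int[OF zero]]
      by (simp add: F_def)
    also have "start (q e) - start (q 0) = e *\<^sub>R start d"
      by (simp add: q_def start_line)
    also have "integral {0..t} (\<lambda>s. seg_len (q e) *\<^sub>R val (F e s) - seg_len (q 0) *\<^sub>R val (F 0 s)) =
      integral {0..t} (\<lambda>s. e *\<^sub>R (seg_len d *\<^sub>R val (F (fst (e, s)) (snd (e, s))) +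
          seg_len x *\<^sub>R I (\<lambda>s. seg_point d s 0) (e, s)) +
        (\<Sum>i\<in>Basis. ((u (q e, s) - u (q 0, s)) \<bullet> i) *\<^sub>R seg_len x *\<^sub>R I (\<lambda>_. (0, 0, i)) (e, s)))"
    proof (rule integral_cong)
      fix s assume "s \<in> {0..t}"
      then have s: "s \<in> {0..1}" using t by auto
      \<comment> \<open>The product rule for increments; \<open>seg_len\<close> is linear, so its
        own increment is exactly \<open>e *\<^sub>R seg_len d\<close>.\<close>
      have "seg_len (q e) *\<^sub>R val (F e s) - seg_len (q 0) *\<^sub>R val (F 0 s) =
          e *\<^sub>R seg_len d *\<^sub>R val (F e s) + seg_len x *\<^sub>R (val (F e s) - val (F 0 s))"
        by (simp add: q_def seg_len_line algebra_simps)
      also have "\<dots> = e *\<^sub>R (seg_len d *\<^sub>R val (F e s) + seg_len x *\<^sub>R I (\<lambda>s. seg_point d s 0) (e, s)) +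
        (\<Sum>i\<in>Basis. ((u (q e, s) - u (q 0, s)) \<bullet> i) *\<^sub>R seg_len x *\<^sub>R I (\<lambda>_. (0, 0, i)) (e, s))"
        unfolding hadamard[OF e s] q0
        by (simp add: scaleR_add_right scaleR_right.sum mult.commute)
      finally show "seg_len (q e) *\<^sub>R val (F e s) - seg_len (q 0) *\<^sub>R val (F 0 s) =
        e *\<^sub>R (seg_len d *\<^sub>R val (F (fst (e, s)) (snd (e, s))) +
          seg_len x *\<^sub>R I (\<lambda>s. seg_point d s 0) (e, s)) +
        (\<Sum>i\<in>Basis. ((u (q e, s) - u (q 0, s)) \<bullet> i) *\<^sub>R seg_len x *\<^sub>R I (\<lambda>_. (0, 0, i)) (e, s))"
        by simp
    qed
    finally show "u (q e, t) - u (q 0, t) = e *\<^sub>R start d +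
      integral {0..t} (\<lambda>s. e *\<^sub>R (seg_len d *\<^sub>R val (F (fst (e, s)) (snd (e, s))) +
          seg_len x *\<^sub>R I (\<lambda>s. seg_point d s 0) (e, s)) +
        (\<Sum>i\<in>Basis. ((u (q e, s) - u (q 0, s)) \<bullet> i) *\<^sub>R seg_len x *\<^sub>R I (\<lambda>_. (0, 0, i)) (e, s)))" .
  qed
  then show ?thesis unfolding has_dir_derivative_def q0 unfolding q_def .
qed

lemma jet_class_u: "jet_class k X {0..1} (\<lambda>p. u (fst (fst p), snd p))"
proof (induction k)
  case 0
  have "continuous_on ((X \<times> UNIV) \<times> {0..1})
      (\<lambda>p::(('f \<times> real \<times> real \<times> 'b) \<times> (nat \<Rightarrow> 'f \<times> real \<times> real \<times> 'b)) \<times> real. (fst (fst p), snd p))"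
    by (intro continuous_on_Pair continuous_on_fst continuous_on_snd continuous_on_id)
  from u_continuous this have "continuous_on ((X \<times> UNIV) \<times> {0..1})
      (\<lambda>p::(('f \<times> real \<times> real \<times> 'b) \<times> (nat \<Rightarrow> 'f \<times> real \<times> real \<times> 'b)) \<times> real. u (fst (fst p), snd p))"
    by (rule continuous_on_compose_eq) auto
  then show ?case by simp
next
  case (Suc k)
  have fst_lin: "linear (fst :: 'f \<times> real \<times> real \<times> 'b \<Rightarrow> 'f)" "continuous_on UNIV (fst :: 'f \<times> real \<times> real \<times> 'b \<Rightarrow> 'f)"
    by (auto intro!: linearI continuous_on_fst continuous_on_id)
  have start: "continuous_on UNIV (start :: 'f \<times> real \<times> real \<times> 'b \<Rightarrow> 'b)"
    and len: "continuous_on UNIV (seg_len :: 'f \<times> real \<times> real \<times> 'b \<Rightarrow> real)"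
    by (intro seg_continuous continuous_on_id)+
  have curve: "jet_class k X {0..1} (\<lambda>p. curve p)"
    unfolding seg_point_def
    by (rule jet_class_Pair[OF jet_class_base[OF fst_lin] jet_class_Pair[OF jet_class_seg_time(1) Suc.IH]])
  have dir: "jet_class k X {0..1} (\<lambda>p. seg_point (snd (fst p) j) (snd p) (0::'b))" for j
    unfolding seg_point_def
    by (rule jet_class_Pair[OF jet_class_direction[OF fst_lin(2)] jet_class_Pair[OF jet_class_seg_time(2) jet_class_const]])
  have val: "jet_class k X {0..1} (\<lambda>p. val (curve p))"
    unfolding val_def by (rule jet_class_comp[OF curve jet_class_const curve_in])
  have first: "jet_class k X {0..1} (\<lambda>p. first (curve p) (v p))" if "jet_class k X {0..1} v" for v
    unfolding first_def by (rule jet_class_comp[OF curve that curve_in])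
  have len_x: "jet_class k X {0..1} (\<lambda>p. seg_len (fst (fst p)))"
    by (rule jet_class_base[OF linear_seg_len len])
  have "\<exists>W. jet_class k X {0..1} W \<and> jet_deriv X {0..1} j (\<lambda>p. u (fst (fst p), snd p)) W" for j
  proof -
    \<comment> \<open>The derivative of the right-hand side in direction \<open>y j\<close> with the
      values of \<open>u\<close> frozen; \<open>A i\<close> is a column of its derivative in the
      values of \<open>u\<close>.\<close>
    define b where "b p = seg_len (snd (fst p) j) *\<^sub>R val (curve p) +
        seg_len (fst (fst p)) *\<^sub>R first (curve p) (seg_point (snd (fst p) j) (snd p) 0)"
      for p :: "(('f \<times> real \<times> real \<times> 'b) \<times> (nat \<Rightarrow> 'f \<times> real \<times> real \<times> 'b)) \<times> real"
    define A where "A i p = seg_len (fst (fst p)) *\<^sub>R first (curve p) (0, 0, i)"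
      for i and p :: "(('f \<times> real \<times> real \<times> 'b) \<times> (nat \<Rightarrow> 'f \<times> real \<times> real \<times> 'b)) \<times> real"
    have c: "jet_class k X {0..1::real} (\<lambda>p. start (snd (fst p) j))"
      by (rule jet_class_direction[OF start])
    have b: "jet_class k X {0..1} b"
      unfolding b_def
      by (rule jet_class_add[OF jet_class_scaleR[OF jet_class_direction[OF len] val]
            jet_class_scaleR[OF len_x first[OF dir]]])
    have A: "jet_class k X {0..1} (A i)" for i
      unfolding A_def by (rule jet_class_scaleR[OF len_x first[OF jet_class_const]])
    obtain W where W: "continuous_on ((X \<times> UNIV) \<times> {0..1}) W"
      and Weq: "\<forall>q\<in>X \<times> UNIV. \<forall>t\<in>{0..1}. W (q, t) = start (snd (fst (q, t)) j) +
        integral {0..t} (\<lambda>s. affine_rhs (b (q, s)) (\<lambda>i. A i (q, s)) (W (q, s)))"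
      by (rule volterra_linear_exists[where A = A, OF jet_class_continuous[OF c] jet_class_continuous[OF b]
            jet_class_continuous[OF A]])
    have "jet_class k X {0..1} W"
      by (rule jet_class_volterra[OF c b A W bspec[OF bspec[OF Weq]]])
    moreover have "jet_deriv X {0..1} j (\<lambda>p. u (fst (fst p), snd p)) W"
    proof (rule jet_derivI)
      fix x and y :: "nat \<Rightarrow> 'f \<times> real \<times> real \<times> 'b" and t :: real
      assume x: "x \<in> interior X" and t: "t \<in> {0..1}"
      have xy: "(x, y) \<in> X \<times> UNIV" using x interior_subset[of X] by auto
      have "continuous_on {0..1::real} (\<lambda>t. ((x, y), t))" by (intro continuous_intros)
      from W this have Wc: "continuous_on {0..1} (\<lambda>t. W ((x, y), t))"
        by (rule continuous_on_compose_eq) (use xy in auto)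
      show "has_dir_derivative (\<lambda>z. u (fst (fst ((z, y), t)), snd ((z, y), t))) (W ((x, y), t)) x (y j)"
        unfolding fst_conv snd_conv
        by (rule u_quotient_tendsto[OF x Wc _ t])
          (use bspec[OF bspec[OF Weq xy]] in \<open>simp add: A_def b_def\<close>)
    qed
    ultimately show ?thesis by blast
  qed
  then show ?case using jet_class_continuous[OF Suc.IH] by simp
qed

end


section \<open>Solutions of the initial value problem\<close>

text \<open>Passing from order \<open>m\<close> to \<open>Suc m\<close> differentiates in slot
  \<open>m\<close>, in step with the numbering in \<open>iter_dir_derivative\<close>, so one tuple
  \<open>y\<close> serves all orders. Each derivative uses up one class, hence
  \<open>m + k\<close>.\<close>

lemma jet_class_iter_dir_derivative:
  assumes h: "\<And>x y. x \<in> U \<Longrightarrow> h x = G ((x, y), t)" and t: "t \<in> T"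
    and G: "jet_class (m + k) U T G"
  shows "\<exists>H. jet_class k U T H \<and> (\<forall>x\<in>interior U. \<forall>y. iter_dir_derivative h m x y = H ((x, y), t))"
  using G
proof (induction m arbitrary: k)
  case 0
  then show ?case using h interior_subset[of U] by (intro exI[of _ G]) auto
next
  case (Suc m)
  obtain H where H: "jet_class (Suc k) U T H"
    and eq: "\<forall>x\<in>interior U. \<forall>y. iter_dir_derivative h m x y = H ((x, y), t)"
    using Suc.IH[of "Suc k"] Suc.prems by auto
  obtain H' where H': "\<forall>j. jet_class k U T (H' j) \<and> jet_deriv U T j H (H' j)"
    by (rule jet_class_SucE[OF H])
  have "iter_dir_derivative h (Suc m) x y = H' m ((x, y), t)" if x: "x \<in> interior U" for x y
  proof -
    have "has_dir_derivative (\<lambda>z. H ((z, y), t)) (H' m ((x, y), t)) x (y m)"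
      using H' x t by (intro jet_derivD) auto
    then have "has_dir_derivative (\<lambda>z. iter_dir_derivative h m z y) (H' m ((x, y), t)) x (y m)"
      by (rule has_dir_derivative_transform[OF open_interior x, rotated]) (use eq in auto)
    then show ?thesis by (simp add: dir_derivative_eq)
  qed
  then show ?case using H' by (intro exI[of _ "H' m"]) auto
qed

text \<open>With the time \<open>t\<close> frozen, the function \<open>H\<close> that represents a
  derivative in the interior is itself its continuous extension to the boundary. One class more
  gives existence of the next directional derivative.\<close>

lemma jet_class_imp_smooth_on:
  fixes U :: "'e::locally_convex_space set" and T :: "'t::topological_space set"
  assumes h: "\<And>x y. x \<in> U \<Longrightarrow> h x = G ((x, y), t)" and t: "t \<in> T"
    and G: "\<And>k. jet_class k U T G"
  shows "smooth_on U h"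
proof -
  have iter: "\<exists>H. jet_class k U T H \<and>
      (\<forall>x\<in>interior U. \<forall>y. iter_dir_derivative h m x y = H ((x, y), t))" for m k
    by (rule jet_class_iter_dir_derivative[where h = h and G = G, OF h t G])
  have slice: "continuous_on (U \<times> UNIV) (\<lambda>p. H (p, t))" if "jet_class k U T H"
    for k and H :: "('e \<times> (nat \<Rightarrow> 'e)) \<times> 't \<Rightarrow> 'c::locally_convex_space"
  proof -
    have "continuous_on (U \<times> UNIV) (\<lambda>p::'e \<times> (nat \<Rightarrow> 'e). (p, t))" by (intro continuous_intros)
    from jet_class_continuous[OF that] this show ?thesis
      by (rule continuous_on_compose_eq) (use t in auto)
  qed
  have hc: "continuous_on U h"
  proof -
    have "continuous_on U (\<lambda>x. (x, \<lambda>_::nat. 0::'e))" by (intro continuous_on_Pair continuous_on_id continuous_on_const)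
    from slice[OF G] this show ?thesis
      by (rule continuous_on_compose_eq) (use h in auto)
  qed
  have ext: "\<exists>g. continuous_on (U \<times> UNIV) g \<and> (\<forall>x\<in>interior U. \<forall>y. g (x, y) = iter_dir_derivative h k x y)" for k
  proof -
    obtain H where H: "jet_class 0 U T H"
      and eq: "\<forall>x\<in>interior U. \<forall>y. iter_dir_derivative h k x y = H ((x, y), t)"
      using iter[where m = k and k = 0] by (elim exE conjE)
    show ?thesis by (rule exI[of _ "\<lambda>p. H (p, t)"]) (use slice[OF H] eq in auto)
  qed
  have "Cr_on_open \<infinity> (interior U) h"
    unfolding Cr_on_open_def
  proof (intro conjI allI impI ballI)
    show "continuous_on (interior U) h" by (rule continuous_on_subset[OF hc interior_subset])
  next
    fix k x y assume x: "x \<in> interior U"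
    obtain H where H: "jet_class (Suc 0) U T H"
      and eq: "\<forall>x\<in>interior U. \<forall>y. iter_dir_derivative h k x y = H ((x, y), t)"
      using iter[where m = k and k = "Suc 0"] by (elim exE conjE)
    obtain H' where H': "\<forall>j. jet_class 0 U T (H' j) \<and> jet_deriv U T j H (H' j)"
      by (rule jet_class_SucE[OF H])
    have "has_dir_derivative (\<lambda>z. H ((z, y), t)) (H' k ((x, y), t)) x (y k)"
      using H' x t by (intro jet_derivD) auto
    then have "has_dir_derivative (\<lambda>z. iter_dir_derivative h k z y) (H' k ((x, y), t)) x (y k)"
      by (rule has_dir_derivative_transform[OF open_interior x, rotated]) (use eq in auto)
    then show "\<exists>v. has_dir_derivative (\<lambda>z. iter_dir_derivative h k z y) v x (y k)" ..
  next
    fix k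
    obtain g where g: "continuous_on (U \<times> UNIV) g"
      and eq: "\<forall>x\<in>interior U. \<forall>y. g (x, y) = iter_dir_derivative h k x y"
      using ext[of k] by auto
    show "continuous_on (interior U \<times> directions k) (\<lambda>(x, y). iter_dir_derivative h k x y)"
      by (rule continuous_on_compose_eq[OF g continuous_on_id]) (use eq interior_subset[of U] in auto)
  qed
  moreover have "\<exists>g. continuous_on (U \<times> directions k) g \<and>
      (\<forall>x\<in>interior U. \<forall>y\<in>directions k. g (x, y) = iter_dir_derivative h k x y)" for k
  proof -
    obtain g where g: "continuous_on (U \<times> UNIV) g"
      and eq: "\<forall>x\<in>interior U. \<forall>y. g (x, y) = iter_dir_derivative h k x y"
      using ext[of k] by auto
    show ?thesis
      by (rule exI[of _ g]) (use continuous_on_subset[OF g, of "U \<times> directions k"] eq in auto)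
  qed
  ultimately show ?thesis unfolding Cr_on_def using hc by simp
qed

section \<open>Curves in the original time variable\<close>

lemma segment_has_vector_derivative:
  fixes G :: "real \<Rightarrow> 'b::euclidean_space"
  assumes "convex S" "a \<in> S" "b \<in> S" "s \<in> {0..1}"
    and G: "(G has_vector_derivative h) (at (a + s *\<^sub>R (b - a)) within S)"
  shows "((\<lambda>s. G (a + s *\<^sub>R (b - a))) has_vector_derivative (b - a) *\<^sub>R h) (at s within {0..1})"
proof -
  have d: "((\<lambda>s. a + s *\<^sub>R (b - a)) has_vector_derivative (b - a)) (at s within {0..1})"
    by (auto intro!: derivative_eq_intros simp flip: has_real_derivative_iff_has_vector_derivative)
  have "(G has_vector_derivative h) (at (a + s *\<^sub>R (b - a)) within (\<lambda>s. a + s *\<^sub>R (b - a)) ` {0..1})"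
    by (rule has_vector_derivative_within_subset[OF G])
      (use convex_segment_mem[OF assms(1-3)] in auto)
  from vector_diff_chain_within[OF d this] show ?thesis by (simp add: o_def)
qed

text \<open>The factor \<open>b - a\<close> carries the orientation, so \<open>a\<close> and
  \<open>b\<close> may come in either order and times before \<open>t\<^sub>0\<close> are covered as
  well.\<close>

lemma segment_integral:
  fixes G :: "real \<Rightarrow> 'b::euclidean_space"
  assumes "convex S" "a \<in> S" "b \<in> S"
    and G: "\<And>t. t \<in> S \<Longrightarrow> (G has_vector_derivative h t) (at t within S)"
  shows "(b - a) *\<^sub>R integral {0..1} (\<lambda>s. h (a + s *\<^sub>R (b - a))) = G b - G a"
proof -
  have "((\<lambda>s. (b - a) *\<^sub>R h (a + s *\<^sub>R (b - a))) has_integral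
      G (a + 1 *\<^sub>R (b - a)) - G (a + 0 *\<^sub>R (b - a))) {0..1}"
  proof (rule fundamental_theorem_of_calculus)
    show "((\<lambda>s. G (a + s *\<^sub>R (b - a))) has_vector_derivative (b - a) *\<^sub>R h (a + s *\<^sub>R (b - a)))
      (at s within {0..1})" if "s \<in> {0..1}" for s
      by (rule segment_has_vector_derivative[OF assms(1-3) that G[OF convex_segment_mem[OF assms(1-3) that]]])
  qed simp
  from integral_unique[OF this] show ?thesis by simp
qed

text \<open>The increment \<open>y r - y t\<close> is \<open>r - t\<close> times the mean of
  \<open>h\<close> over the segment from \<open>t\<close> to \<open>r\<close>, and this mean is
  continuous in \<open>r\<close> on \<open>J\<close> with value \<open>h t\<close> at
  \<open>r = t\<close>. All limits are taken within \<open>J\<close>, which includes its end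
  points.\<close>

lemma segment_integral_has_vector_derivative:
  fixes y h :: "real \<Rightarrow> 'b::euclidean_space"
  assumes J: "convex J" and h: "continuous_on J h" and t0: "t\<^sub>0 \<in> J" and t: "t \<in> J"
    and y: "\<And>t. t \<in> J \<Longrightarrow> y t = c + (t - t\<^sub>0) *\<^sub>R integral {0..1} (\<lambda>s. h (t\<^sub>0 + s *\<^sub>R (t - t\<^sub>0)))"
  shows "(y has_vector_derivative h t) (at t within J)"
proof -
  define I where "I r = integral {0..1} (\<lambda>s. h (t + s *\<^sub>R (r - t)))" for r
  have diff: "y r - y t = (r - t) *\<^sub>R I r" if r: "r \<in> J" for r
  proof -
    \<comment> \<open>A compact interval containing the three times in whatever order, so that one
      antiderivative \<open>G\<close> of \<open>h\<close> serves all three segments.\<close>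
    define m M where "m = min t\<^sub>0 (min r t)" and "M = max t\<^sub>0 (max r t)"
    have mM: "t\<^sub>0 \<in> {m..M}" "r \<in> {m..M}" "t \<in> {m..M}" by (auto simp: m_def M_def)
    have "{m..M} \<subseteq> J"
    proof -
      have "m \<in> J" "M \<in> J" using r t t0 by (auto simp: m_def M_def min_def max_def)
      then show ?thesis using J by (meson atLeastAtMost_iff is_interval_1 is_interval_convex_1 subsetI)
    qed
    then obtain G where G: "\<And>x. x \<in> {m..M} \<Longrightarrow> (G has_vector_derivative h x) (at x within {m..M})"
      using antiderivative_continuous[OF continuous_on_subset[OF h]] by metis
    have seg: "(b - a) *\<^sub>R integral {0..1} (\<lambda>s. h (a + s *\<^sub>R (b - a))) = G b - G a"
      if "a \<in> {m..M}" "b \<in> {m..M}" for a b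
      by (rule segment_integral[OF convex_real_interval(5) that G])
    have "y r - y t = (G r - G t\<^sub>0) - (G t - G t\<^sub>0)"
      unfolding y[OF r] y[OF t] seg[OF mM(1,2), symmetric] seg[OF mM(1,3), symmetric] by simp
    also have "\<dots> = (r - t) *\<^sub>R I r"
      unfolding I_def seg[OF mM(3,2)] by simp
    finally show ?thesis .
  qed
  have "continuous_on J I"
    unfolding I_def
  proof (rule integral_unit_continuous)
    have "continuous_on (J \<times> {0..1}) (\<lambda>p. t + snd p *\<^sub>R (fst p - t))" by (intro continuous_intros)
    then have "continuous_on (J \<times> {0..1}) (\<lambda>p. h (t + snd p *\<^sub>R (fst p - t)))"
      by (rule continuous_on_compose2[OF h]) (use convex_segment_mem[OF J t] in auto)
    then show "continuous_on (J \<times> {0..1}) (\<lambda>(r, s). h (t + s *\<^sub>R (r - t)))"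
      by (simp add: split_beta)
  qed
  then have "(I \<longlongrightarrow> I t) (at t within J)" using t unfolding continuous_on_def by blast
  then have It: "((\<lambda>r. I r - I t) \<longlongrightarrow> 0) (at t within J)" by (rule LIM_zero)
  have "I t = h t" by (simp add: I_def)
  from tendsto_norm_zero[OF It, unfolded this]
  have "((\<lambda>r. norm (I r - h t)) \<longlongrightarrow> 0) (at t within J)" .
  then have "((\<lambda>r. norm ((1 / norm (r - t)) *\<^sub>R (y r - (y t + (r - t) *\<^sub>R h t)))) \<longlongrightarrow> 0) (at t within J)"
  proof (rule Lim_transform_eventually)
    have "norm (I r - h t) = norm ((1 / norm (r - t)) *\<^sub>R (y r - (y t + (r - t) *\<^sub>R h t)))"
      if "r \<in> J" "r \<noteq> t" for r
    proof -
      have "y r - (y t + (r - t) *\<^sub>R h t) = (r - t) *\<^sub>R (I r - h t)"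
        using diff[OF that(1)] by (simp add: algebra_simps)
      then show ?thesis using that(2) by simp
    qed
    then show "\<forall>\<^sub>F r in at t within J. norm (I r - h t) =
        norm ((1 / norm (r - t)) *\<^sub>R (y r - (y t + (r - t) *\<^sub>R h t)))"
      by (auto simp: eventually_at_filter)
  qed
  then show ?thesis
    unfolding has_vector_derivative_def has_derivative_within
    by (rule conjI[OF bounded_linear_scaleR_left tendsto_norm_zero_cancel])
qed

text \<open>The first iterated derivative is \<open>e 0 *\<^sub>R h t\<close>. This formula makes
  sense on all of \<open>J\<close> and so is the continuous extension that \<open>Cr_on\<close> asks
  for at end points.\<close>

lemma Cr_on_1_curve:
  fixes y h :: "real \<Rightarrow> 'b::real_normed_vector"
  assumes y: "\<And>t. t \<in> J \<Longrightarrow> (y has_vector_derivative h t) (at t within J)" and h: "continuous_on J h"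
  shows "Cr_on 1 J y"
proof -
  have yc: "continuous_on J y"
    unfolding continuous_on_eq_continuous_within
    by (intro ballI has_vector_derivative_continuous[OF y])
  have d: "has_dir_derivative y (r *\<^sub>R h t) t r" if t: "t \<in> interior J" for t r
  proof -
    have "t \<in> J" using t interior_subset by (rule rev_subsetD)
    from y[OF this] have "(y has_vector_derivative h t) (at t)"
      unfolding at_within_interior[OF t] .
    then have "((\<lambda>e. norm (y (t + e) - y t - e *\<^sub>R h t) / norm e) \<longlongrightarrow> 0) (at 0)"
      unfolding has_vector_derivative_def has_derivative_at by (rule conjunct2)
    then have "((\<lambda>e. norm ((y (t + e) - y t) /\<^sub>R e - h t)) \<longlongrightarrow> 0) (at 0)"
    proof (rule Lim_transform_eventually)
      have "norm (v - e *\<^sub>R h t) / norm e = norm (v /\<^sub>R e - h t)" if "e \<noteq> 0" for e and v :: 'b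
      proof -
        have "v /\<^sub>R e - h t = (v - e *\<^sub>R h t) /\<^sub>R e" using that by (simp add: algebra_simps)
        then show ?thesis by (simp add: divide_inverse)
      qed
      then show "\<forall>\<^sub>F e in at 0. norm (y (t + e) - y t - e *\<^sub>R h t) / norm e =
          norm ((y (t + e) - y t) /\<^sub>R e - h t)"
        by (auto simp: eventually_at_filter)
    qed
    then have "((\<lambda>e. (y (t + e) - y t) /\<^sub>R e) \<longlongrightarrow> h t) (at 0)"
      by (rule LIM_zero_cancel[OF tendsto_norm_zero_cancel])
    then have "has_dir_derivative y (h t) t 1" by (simp add: has_dir_derivative_def)
    from has_dir_derivative_scale_dir[OF this, of r] show ?thesis by simp
  qed
  have it: "iter_dir_derivative y (Suc 0) t e = e 0 *\<^sub>R h t" if "t \<in> interior J" for t e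
    by (simp add: dir_derivative_eq[OF d[OF that]])
  have dc: "continuous_on (J \<times> directions k) (\<lambda>p. snd p 0 *\<^sub>R h (fst p))" for k
  proof (rule continuous_on_scaleR)
    show "continuous_on (J \<times> directions k) (\<lambda>p. snd p 0 :: real)"
      by (rule continuous_on_product_then_coordinatewise) (intro continuous_on_snd continuous_on_id)
    show "continuous_on (J \<times> directions k) (\<lambda>p. h (fst p))"
      by (rule continuous_on_compose2[OF h]) (auto intro!: continuous_on_fst continuous_on_id)
  qed
  have yc': "continuous_on (J \<times> directions k) (\<lambda>p. y (fst p))" for k
    by (rule continuous_on_compose2[OF yc]) (auto intro!: continuous_on_fst continuous_on_id)
  have k01: "k = 0 \<or> k = Suc 0" if "enat k \<le> 1" for k
    using that by (simp add: one_enat_def) linarith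
  have ext: "\<exists>g. continuous_on (J \<times> directions k) g \<and>
      (\<forall>t\<in>interior J. \<forall>d. g (t, d) = iter_dir_derivative y k t d)" if "enat k \<le> 1" for k
    using k01[OF that]
  proof
    assume "k = 0"
    then show ?thesis by (intro exI[of _ "\<lambda>p. y (fst p)"]) (use yc'[of k] in auto)
  next
    assume "k = Suc 0"
    then show ?thesis by (intro exI[of _ "\<lambda>p. snd p 0 *\<^sub>R h (fst p)"]) (use dc[of k] it in auto)
  qed
  have "Cr_on_open 1 (interior J) y"
    unfolding Cr_on_open_def
  proof (intro conjI allI impI ballI)
    show "continuous_on (interior J) y" by (rule continuous_on_subset[OF yc interior_subset])
  next
    fix k t d assume "enat (Suc k) \<le> 1" "t \<in> interior J"
    then show "\<exists>v. has_dir_derivative (\<lambda>z. iter_dir_derivative y k z d) v t (d k)"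
      using k01[of "Suc k"] d[of t "d k"] by auto
  next
    fix k assume "enat k \<le> 1"
    then obtain g where g: "continuous_on (J \<times> directions k) g"
      and eq: "\<forall>t\<in>interior J. \<forall>d. g (t, d) = iter_dir_derivative y k t d"
      using ext by blast
    show "continuous_on (interior J \<times> directions k) (\<lambda>(x, y'). iter_dir_derivative y k x y')"
      by (rule continuous_on_compose_eq[OF g continuous_on_id]) (use eq interior_subset[of J] in auto)
  qed
  moreover have "\<exists>g. continuous_on (J \<times> directions k) g \<and>
      (\<forall>x\<in>interior J. \<forall>d\<in>directions k. g (x, d) = iter_dir_derivative y k x d)" if "enat k \<le> 1" for k
  proof -
    obtain g where "continuous_on (J \<times> directions k) g"
      "\<forall>t\<in>interior J. \<forall>d. g (t, d) = iter_dir_derivative y k t d"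
      using ext[OF \<open>enat k \<le> 1\<close>] by blast
    then show ?thesis by (intro exI[of _ g]) auto
  qed
  ultimately show ?thesis unfolding Cr_on_def using yc by blast
qed

section \<open>Solution curves and the flow\<close>

context vanishing_field
begin

text \<open>The part of the curve over \<open>[0,s]\<close>, stretched to the unit interval, solves
  the equation with end time \<open>t\<^sub>0 + s *\<^sub>R (t - t\<^sub>0)\<close>, and uniqueness
  identifies it with the curve for that end time. So the curves for different end times are pieces
  of one solution.\<close>

lemma u_reparam:
  assumes x: "(p, t\<^sub>0, t, x\<^sub>0) \<in> X" and s: "s \<in> {0..1}"
  shows "u ((p, t\<^sub>0, t, x\<^sub>0), s) = u ((p, t\<^sub>0, t\<^sub>0 + s *\<^sub>R (t - t\<^sub>0), x\<^sub>0), 1)"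
proof -
  define x where "x = (p, t\<^sub>0, t, x\<^sub>0)"
  define x' where "x' = (p, t\<^sub>0, t\<^sub>0 + s *\<^sub>R (t - t\<^sub>0), x\<^sub>0)"
  have xX: "x \<in> X" using x by (simp add: x_def)
  have x'X: "x' \<in> X"
    using x s convex_segment_mem[OF convex_J, of t\<^sub>0 t s] by (auto simp: x'_def)
  define g where "g r = seg_len x *\<^sub>R val (seg_point x r (u (x, r)))" for r
  have g: "continuous_on {0..1} g" unfolding g_def by (rule eq_curve[OF xX])
  have sub: "s * r \<in> {0..1}" if "r \<in> {0..1}" for r
    using s that by (simp add: mult_le_one)
  have "u (x, s * r) = u (x', r)" if r: "r \<in> {0..1}" for r
  proof (rule u_unique[OF x'X _ _ _ r, where v = "\<lambda>r. u (x, s * r)"])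
    show "continuous_on {0..1} (\<lambda>r. u (x, s * r))"
      by (rule continuous_on_compose2[OF u_curve[OF xX]]) (auto intro!: continuous_intros sub simp del: atLeastAtMost_iff)
    show "u (x, s * r) \<in> K" if "r \<in> {0..1}" for r
      by (rule u_in_K[OF xX sub[OF that]])
    fix r :: real assume r: "r \<in> {0..1}"
    \<comment> \<open>Substitution in the integral, obtained by differentiating
      \<open>integral {0..s * r} g\<close> in \<open>r\<close>; in this form \<open>s = 0\<close> is
      included.\<close>
    have "((\<lambda>r. s *\<^sub>R g (s * r)) has_integral integral {0..s * r} g - integral {0..s * 0} g) {0..r}"
    proof (rule fundamental_theorem_of_calculus)
      show "0 \<le> r" using r by simp
      fix q assume q: "q \<in> {0..r}"
      then have q1: "q \<in> {0..1}" using r by auto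
      have "((\<lambda>t. integral {0..t} g) has_vector_derivative g (s * q)) (at (s * q) within {0..1})"
        by (rule integral_has_vector_derivative[OF g sub[OF q1]])
      then have "((\<lambda>t. integral {0..t} g) has_vector_derivative g (s * q)) (at (s * q) within (\<lambda>r. s * r) ` {0..r})"
        by (rule has_vector_derivative_within_subset) (use sub r in force)
      moreover have "((\<lambda>r. s * r) has_vector_derivative s) (at q within {0..r})"
        by (auto intro!: derivative_eq_intros simp flip: has_real_derivative_iff_has_vector_derivative)
      ultimately show "((\<lambda>r. integral {0..s * r} g) has_vector_derivative s *\<^sub>R g (s * q)) (at q within {0..r})"
        using vector_diff_chain_within[of "\<lambda>r. s * r" s q "{0..r}" "\<lambda>t. integral {0..t} g"] by (simp add: o_def)
    qed
    from integral_unique[OF this]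
    have "integral {0..r} (\<lambda>r. s *\<^sub>R g (s * r)) = integral {0..s * r} g"
      by (simp only: mult_zero_right integral_singleton atLeastAtMost_singleton diff_zero)
    moreover have "s *\<^sub>R g (s * q) = seg_len x' *\<^sub>R val (seg_point x' q (u (x, s * q)))" for q
      by (simp add: g_def x_def x'_def seg_len_def seg_point_def seg_time_def ac_simps)
    ultimately have "integral {0..r} (\<lambda>q. seg_len x' *\<^sub>R val (seg_point x' q (u (x, s * q)))) =
        integral {0..s * r} g" by simp
    then show "u (x, s * r) = start x' +
        integral {0..r} (\<lambda>q. seg_len x' *\<^sub>R val (seg_point x' q (u (x, s * q))))"
      using u_eq[OF xX sub[OF r]] by (simp add: g_def[abs_def] x_def x'_def start_def)
  qed
  from this[of 1] show ?thesis by (simp add: x_def x'_def)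
qed

text \<open>Each value comes from a different auxiliary curve, taken at its end. Restriction to
  \<open>J\<close> follows the convention in \<open>ivp_solution\<close>.\<close>

definition sol :: "'f \<Rightarrow> real \<Rightarrow> 'b \<Rightarrow> real \<Rightarrow> 'b" where
  "sol p t\<^sub>0 x\<^sub>0 = (\<lambda>t\<in>J. u ((p, t\<^sub>0, t, x\<^sub>0), 1))"

text \<open>The equation for the value at \<open>t\<close> involves the auxiliary curve with end
  time \<open>t\<close>. By \<open>u_reparam\<close> the values of that curve are values of
  \<open>y\<close> at intermediate times, which yields an integral equation for \<open>y\<close>
  alone.\<close>

lemma ivp_solution_sol:
  assumes p: "p \<in> P" and t0: "t\<^sub>0 \<in> J" and x0: "x\<^sub>0 \<in> K"
  shows "ivp_solution (\<lambda>t x. val (p, t, x)) J K t\<^sub>0 x\<^sub>0 (sol p t\<^sub>0 x\<^sub>0)"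
proof -
  define y where "y = sol p t\<^sub>0 x\<^sub>0"
  have X: "(p, t\<^sub>0, t, x\<^sub>0) \<in> X" if "t \<in> J" for t using assms that by simp
  have yu: "y t = u ((p, t\<^sub>0, t, x\<^sub>0), 1)" if "t \<in> J" for t using that by (simp add: y_def sol_def)
  have yK: "y t \<in> K" if "t \<in> J" for t
    unfolding yu[OF that] by (rule u_in_K[OF X[OF that]]) simp
  define h where "h t = val (p, t, y t)" for t
  have yc: "continuous_on J y"
  proof -
    have "continuous_on J (\<lambda>t. ((p, t\<^sub>0, t, x\<^sub>0), 1::real))" by (intro continuous_intros)
    from u_continuous this show ?thesis
      by (rule continuous_on_compose_eq) (use X yu in auto)
  qed
  have hc: "continuous_on J h"
    unfolding h_def
    by (intro cont_val continuous_on_Pair continuous_on_const continuous_on_id yc) (use p yK in auto)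
  have y_eq: "y t = x\<^sub>0 + (t - t\<^sub>0) *\<^sub>R integral {0..1} (\<lambda>s. h (t\<^sub>0 + s *\<^sub>R (t - t\<^sub>0)))" if t: "t \<in> J" for t
  proof -
    have "y t = x\<^sub>0 + integral {0..1} (\<lambda>s. (t - t\<^sub>0) *\<^sub>R val (p, t\<^sub>0 + s *\<^sub>R (t - t\<^sub>0), u ((p, t\<^sub>0, t, x\<^sub>0), s)))"
      using u_eq[OF X[OF t], of 1]
      by (simp add: yu[OF t] start_def seg_len_def seg_point_def seg_time_def)
    also have "integral {0..1} (\<lambda>s. (t - t\<^sub>0) *\<^sub>R val (p, t\<^sub>0 + s *\<^sub>R (t - t\<^sub>0), u ((p, t\<^sub>0, t, x\<^sub>0), s))) =
        integral {0..1} (\<lambda>s. (t - t\<^sub>0) *\<^sub>R h (t\<^sub>0 + s *\<^sub>R (t - t\<^sub>0)))"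
    proof (rule integral_cong)
      fix s :: real assume s: "s \<in> {0..1}"
      show "(t - t\<^sub>0) *\<^sub>R val (p, t\<^sub>0 + s *\<^sub>R (t - t\<^sub>0), u ((p, t\<^sub>0, t, x\<^sub>0), s)) = (t - t\<^sub>0) *\<^sub>R h (t\<^sub>0 + s *\<^sub>R (t - t\<^sub>0))"
        unfolding h_def yu[OF convex_segment_mem[OF convex_J t0 t s]] u_reparam[OF X[OF t] s] ..
    qed
    finally show ?thesis by simp
  qed
  have yd: "(y has_vector_derivative h t) (at t within J)" if "t \<in> J" for t
    by (rule segment_integral_has_vector_derivative[OF convex_J hc t0 that y_eq])
  have "y \<in> J \<rightarrow>\<^sub>E K" using yK by (auto simp: y_def sol_def)
  moreover have "y t\<^sub>0 = x\<^sub>0" using y_eq[OF t0] by simp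
  ultimately show ?thesis
    unfolding ivp_solution_def y_def[symmetric] using yd Cr_on_1_curve[OF yd hc] by (simp add: h_def)
qed

text \<open>Read along the segment from \<open>t\<^sub>0\<close> to \<open>t\<close>, any solution
  satisfies the equation over the unit interval with values in \<open>K\<close>, so
  \<open>u_unique\<close> determines its value at \<open>t\<close>.\<close>

lemma ivp_solution_unique:
  assumes p: "p \<in> P" and t0: "t\<^sub>0 \<in> J" and x0: "x\<^sub>0 \<in> K"
    and y: "ivp_solution (\<lambda>t x. val (p, t, x)) J K t\<^sub>0 x\<^sub>0 y"
  shows "y = sol p t\<^sub>0 x\<^sub>0"
proof (rule extensionalityI[of _ J])
  have yE: "y \<in> J \<rightarrow>\<^sub>E K" and yd: "\<And>t. t \<in> J \<Longrightarrow> (y has_vector_derivative val (p, t, y t)) (at t within J)"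
    and y0: "y t\<^sub>0 = x\<^sub>0" and yC: "Cr_on 1 J y"
    using y unfolding ivp_solution_def by auto
  have yc: "continuous_on J y" using yC unfolding Cr_on_def by blast
  show "y \<in> extensional J" using yE by (auto simp: PiE_def)
  show "sol p t\<^sub>0 x\<^sub>0 \<in> extensional J" by (simp add: sol_def)
  fix t assume t: "t \<in> J"
  define x where "x = (p, t\<^sub>0, t, x\<^sub>0)"
  have x: "x \<in> X" using p t0 t x0 by (simp add: x_def)
  have mem: "t\<^sub>0 + s *\<^sub>R (t - t\<^sub>0) \<in> J" if "s \<in> {0..1}" for s
    by (rule convex_segment_mem[OF convex_J t0 t that])
  define v where "v s = y (t\<^sub>0 + s *\<^sub>R (t - t\<^sub>0))" for s
  have "v 1 = u (x, 1)"
  proof (rule u_unique[OF x])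
    show "continuous_on {0..1} v"
      unfolding v_def
    proof (rule continuous_on_compose2[OF yc])
      show "continuous_on {0..1} (\<lambda>s. t\<^sub>0 + s *\<^sub>R (t - t\<^sub>0))" by (intro continuous_intros)
    qed (use mem in auto)
    show "v s \<in> K" if "s \<in> {0..1}" for s
      unfolding v_def using yE mem[OF that] by auto
    fix r :: real assume r: "r \<in> {0..1}"
    have "((\<lambda>s. seg_len x *\<^sub>R val (seg_point x s (v s))) has_integral v r - v 0) {0..r}"
    proof (rule fundamental_theorem_of_calculus)
      show "0 \<le> r" using r by simp
      fix s assume "s \<in> {0..r}"
      then have s: "s \<in> {0..1}" using r by auto
      have "(v has_vector_derivative (t - t\<^sub>0) *\<^sub>R val (p, t\<^sub>0 + s *\<^sub>R (t - t\<^sub>0), v s)) (at s within {0..1})"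
        unfolding v_def by (rule segment_has_vector_derivative[OF convex_J t0 t s yd[OF mem[OF s]]])
      then show "(v has_vector_derivative seg_len x *\<^sub>R val (seg_point x s (v s))) (at s within {0..r})"
        unfolding x_def seg_len_def seg_point_def seg_time_def fst_conv snd_conv
        by (rule has_vector_derivative_within_subset) (use r in auto)
    qed
    from integral_unique[OF this]
    show "v r = start x + integral {0..r} (\<lambda>s. seg_len x *\<^sub>R val (seg_point x s (v s)))"
      by (simp add: v_def y0 x_def start_def)
  qed simp
  then show "y t = sol p t\<^sub>0 x\<^sub>0 t" using t by (simp add: v_def x_def sol_def)
qed

lemma flow_eq:
  assumes "x \<in> X"
  shows "flow val J K x = u (x, 1)"
proof -
  obtain p t\<^sub>0 t x\<^sub>0 where x: "x = (p, t\<^sub>0, t, x\<^sub>0)" by (cases x)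
  have *: "p \<in> P" "t\<^sub>0 \<in> J" "x\<^sub>0 \<in> K" "t \<in> J" using assms by (auto simp: x)
  have "(THE y. ivp_solution (\<lambda>s x. val (p, s, x)) J K t\<^sub>0 x\<^sub>0 y) = sol p t\<^sub>0 x\<^sub>0"
    by (rule the_equality[where P = "ivp_solution (\<lambda>s x. val (p, s, x)) J K t\<^sub>0 x\<^sub>0",
          OF ivp_solution_sol[OF *(1-3)] ivp_solution_unique[OF *(1-3)]])
  then show ?thesis using * by (simp add: flow_def x sol_def)
qed

lemma ex1_ivp_solution:
  assumes "p \<in> P" "t\<^sub>0 \<in> J" "x\<^sub>0 \<in> K"
  shows "\<exists>!y. ivp_solution (\<lambda>t x. val (p, t, x)) J K t\<^sub>0 x\<^sub>0 y"
  by (rule ex1I[of "ivp_solution (\<lambda>t x. val (p, t, x)) J K t\<^sub>0 x\<^sub>0", OF ivp_solution_sol[OF assms] ivp_solution_unique[OF assms]])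

lemma flow_in_K: "flow val J K \<in> X \<rightarrow> K"
proof (rule funcsetI)
  show "flow val J K x \<in> K" if "x \<in> X" for x
    unfolding flow_eq[OF that] by (rule u_in_K[OF that]) simp
qed

lemma smooth_on_flow: "smooth_on X (flow val J K)"
  by (rule jet_class_imp_smooth_on[where T = "{0..1}" and t = 1, OF _ _ jet_class_u])
    (simp_all only: flow_eq fst_conv snd_conv, simp)

end

theorem theoremB:
  fixes J :: "real set"
    and K :: "(real ^ 'n) set"
    and P :: "'f::locally_convex_space set"
    and f :: "'f \<times> real \<times> (real ^ 'n) \<Rightarrow> real ^ 'n"
  assumes "is_interval J" and "\<exists>a\<in>J. \<exists>b\<in>J. a < b"
    and "compact K" and "convex K" and "interior K \<noteq> {}"
    and "convex P" and "interior P \<noteq> {}"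
    and "smooth_on (P \<times> J \<times> K) f"
    and "\<And>p t x. p \<in> P \<Longrightarrow> t \<in> J \<Longrightarrow> x \<in> frontier K \<Longrightarrow> f (p, t, x) = 0"
  shows "(\<forall>p\<in>P. \<forall>t\<^sub>0\<in>J. \<forall>x\<^sub>0\<in>K. \<exists>!y. ivp_solution (\<lambda>t x. f (p, t, x)) J K t\<^sub>0 x\<^sub>0 y) \<and>
    flow f J K \<in> P \<times> J \<times> J \<times> K \<rightarrow> K \<and>
    smooth_on (P \<times> J \<times> J \<times> K) (flow f J K)"
proof -
  have J: "convex J" using assms(1) by (simp add: is_interval_convex_1)
  obtain a b where ab: "a \<in> J" "b \<in> J" "a < b" using assms(2) by blast
  \<comment> \<open>An open interval inside \<open>J\<close> supplies the interior points from which
    \<open>smooth_on_imp_jet_tower\<close> extends the derivatives.\<close>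
  then have "{a<..<b} \<subseteq> J"
    using assms(1) unfolding is_interval_1 by (meson greaterThanLessThan_iff less_imp_le subsetI)
  then have "{a<..<b} \<subseteq> interior J" by (rule interior_maximal) simp
  then have "interior J \<noteq> {}" using ab(3) dense[of a b] by auto
  then have int: "interior (P \<times> J \<times> K) \<noteq> {}"
    using assms(5,7) by (simp add: interior_Times)
  have conv: "convex (P \<times> J \<times> K)" by (intro convex_Times assms J)
  obtain D where D: "jet_tower (P \<times> J \<times> K) D" "\<forall>x y. D 0 (x, y) = f x"
    by (rule smooth_on_imp_jet_tower[OF assms(8) conv int])
  interpret jet_tower "P \<times> J \<times> K" D by (rule D(1))
  \<comment> \<open>An equality of functions, also off the domain, so that
    \<open>flow val J K\<close> is the same term as \<open>flow f J K\<close> after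
    rewriting.\<close>
  have val: "val = f" by (rule ext) (simp add: val_def D(2))
  interpret vanishing_field P J K D
    by unfold_locales (use assms J in \<open>auto simp: val\<close>)
  show ?thesis
    using ex1_ivp_solution flow_in_K smooth_on_flow unfolding val by blast
qed

end
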